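(* Let $b:[0,\infty)\to\mathbb{R}$ be continuous with $b(0)\le0$ and suppose there is a constant $c<0$ with $b(t)>c$ for all $t\ge0$. Let $(W_t)_{t\ge0}$ be a standard Brownian motion started at $0$, $\tau=\inf\{t>0: W_t\le b(t)\}$, assume $P(\tau=0)=0$, and let $F(t)=P(\tau\le t)$. Then $\int_0^\infty e^{-\alpha b(s)-\alpha^2 s/2}F(ds)=1$ for all $\alpha\ge 0$. Moreover, for every $p<1$, $y\le c$ and $\beta>0$, with $\alpha=\sqrt{2\beta}$, multiplying this Fredholm equation by $\sqrt{\pi}\,2^{p/2}\beta^{(p-1)/2}e^{y\sqrt{2\beta}}$ turns it into the Laplace transform (in $t$, at $\beta$) of a Volterra equation; that is, $$\int_0^{\infty}e^{-\beta t}\left[\int_0^t\frac{e^{-\frac{(b(s)-y)^2}{4(t-s)}}D_{p}\big(\frac{b(s)-y}{\sqrt{t-s}}\big)}{(t-s)^{(p+1)/2}}F(ds)\right]dt=\sqrt{\pi}\,2^{p/2}\beta^{(p-1)/2}e^{y\sqrt{2\beta}}\int_0^\infty e^{-\sqrt{2\beta}\,b(s)-\beta s}F(ds),$$ $$\int_0^{\infty}e^{-\beta t}\,\frac{e^{-\frac{y^2}{4t}}D_{p}\big(\frac{-y}{\sqrt{t}}\big)}{t^{(p+1)/2}}\,dt=\sqrt{\pi}\,2^{p/2}\beta^{(p-1)/2}e^{y\sqrt{2\beta}},$$ and consequently, for all $t>0$, $p<1$ and $y\le c$, $$\int_0^t\frac{e^{-\frac{(b(s)-y)^2}{4(t-s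)}}D_{p}\big(\frac{b(s)-y}{\sqrt{t-s}}\big)}{(t-s)^{(p+1)/2}}F(ds)=\frac{e^{-\frac{y^2}{4t}}D_{p}\big(\frac{-y}{\sqrt{t}}\big)}{t^{(p+1)/2}}.$$
   Context: $D_p$ ($p\in\mathbb{R}$) is the parabolic cylinder function: the entire solution of $u''(z)+\left(p+\tfrac12-\tfrac{z^2}{4}\right)u(z)=0$ normalized by $D_p(z)\sim z^p e^{-z^2/4}$ as $z\to+\infty$. For $p<0$, $D_p(z)=\frac{e^{-z^2/4}}{\Gamma(-p)}\int_0^\infty e^{-xz-x^2/2}x^{-p-1}\,dx$. Integrals $F(ds)$ are Lebesgue–Stieltjes integrals; integrands at $s=t$ are read as their limit $0$ as $s\uparrow t$. *)

theory Defs
  imports "HOL-Probability.Probability" "HOL-Library.Landau_Symbols"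
begin

definition parabolic_cylinder :: "real \<Rightarrow> complex \<Rightarrow> complex" where
  "parabolic_cylinder p = (THE u. u holomorphic_on UNIV \<and>
     (\<forall>z. (deriv ^^ 2) u z + (of_real p + 1/2 - z\<^sup>2 / 4) * u z = 0) \<and>
     (\<lambda>x::real. u (of_real x)) \<sim>[at_top] (\<lambda>x. of_real (x powr p * exp (- x\<^sup>2 / 4))))"

text \<open>For real \<open>p\<close> the function is real-valued on the real line, so taking the real part
  loses nothing.\<close>

definition pcf_D :: "real \<Rightarrow> real \<Rightarrow> real" where
  "pcf_D p x = Re (parabolic_cylinder p (of_real x))"

text \<open>Only the values of \<open>W\<close> at times \<open>t \<ge> 0\<close> are constrained.\<close>

locale standard_brownian_motion = prob_space M for M :: "'a measure" +
  fixes W :: "real \<Rightarrow> 'a \<Rightarrow> real"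
  assumes random_variable_W: "0 \<le> t \<Longrightarrow> random_variable borel (W t)"
    and starts_at_0: "AE \<omega> in M. W 0 \<omega> = 0"
    and continuous_paths: "\<omega> \<in> space M \<Longrightarrow> continuous_on {0..} (\<lambda>t. W t \<omega>)"
    and gaussian_increments: "0 \<le> s \<Longrightarrow> s < t \<Longrightarrow>
      distributed M lborel (\<lambda>\<omega>. W t \<omega> - W s \<omega>) (normal_density 0 (sqrt (t - s)))"
    and independent_increments: "0 \<le> r 0 \<Longrightarrow> (\<And>i. i < n \<Longrightarrow> r i \<le> r (Suc i)) \<Longrightarrow>
      indep_vars (\<lambda>_. borel) (\<lambda>i \<omega>. W (r (Suc i)) \<omega> - W (r i) \<omega>) {..<n::nat}"

text \<open>The value is \<open>\<infinity>\<close>, the infimum of the empty set, if the boundary is never hit.\<close>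

definition hitting_time :: "(real \<Rightarrow> 'a \<Rightarrow> real) \<Rightarrow> (real \<Rightarrow> real) \<Rightarrow> 'a \<Rightarrow> ereal" where
  "hitting_time W b \<omega> = Inf (ereal ` {t. 0 < t \<and> W t \<omega> \<le> b t})"

definition hitting_cdf ::
  "'a measure \<Rightarrow> (real \<Rightarrow> 'a \<Rightarrow> real) \<Rightarrow> (real \<Rightarrow> real) \<Rightarrow> real \<Rightarrow> real" where
  "hitting_cdf M W b t = measure M {\<omega> \<in> space M. hitting_time W b \<omega> \<le> ereal t}"

end

theory Submission
  imports Defs "HOL-Complex_Analysis.Complex_Analysis" "HOL-Real_Asymp.Real_Asymp"
begin

text \<open>For \<open>y \<le> c\<close> the event \<open>W\<^sub>T \<le> y\<close> forces the boundary to be hit before \<open>T\<close>. Stopping the bounded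
  martingale \<open>P(W\<^sub>T \<le> y | W\<^sub>t)\<close> at the hitting time therefore gives
  \<open>P(W\<^sub>T \<le> y) = \<integral> P(b(s) + W\<^sub>T - W\<^sub>s \<le> y) F(ds)\<close>. Differentiating twice in \<open>y\<close> yields the same equation
  for the first passage density \<open>h(b(s) - y, T - s)\<close> against \<open>h(- y, T)\<close>, for almost every \<open>y < c\<close>.
  The Volterra kernel at \<open>(a, t)\<close> is a constant multiple of the mixture
  \<open>\<integral> h(a + w, t) w powr (- p) dw\<close> over \<open>w > 0\<close>, so integrating the equation for \<open>h\<close> against
  \<open>w powr (- p)\<close> gives the Volterra equation pointwise. The Laplace transform of \<open>h(r, t)\<close> in \<open>t\<close> is
  \<open>exp (- r sqrt (2 \<beta>))\<close>; this gives the transform of the Volterra kernel, hence the Fredholm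
  equation for \<open>\<alpha> > 0\<close>, and \<open>\<alpha> = 0\<close> follows by dominated convergence.\<close>

section \<open>Parabolic cylinder functions of order less than one\<close>

text \<open>The exponential martingale exp (- \<alpha> W - \<alpha>^2 t / 2) is bounded up to the
  hitting time, so stopping it would give the Fredholm equation at once; but the way from there to
  the Volterra equation inverts a Laplace transform, which settles only almost every t unless
  continuity in t is known. Working at a fixed T reaches every t > 0, and Laplace transforms are
  only computed, never inverted. The derivatives in y are not taken under the integral against F
  either: by Tonelli both sides are written as integrals of nonnegative functions over a half-line,
  and the integrands are compared. Positivity of all kernels rests on b(s) > c \<ge> y and c < 0.
  The exceptional null set of levels is harmless because the last step integrates over the level.
  The weight x powr (- p - 1) of the classical integral for D_p is not integrable at 0 once p \<ge>
  0, which forces a different integrand. As \<tau> may a priori be infinite, F is treated as a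
  possibly defective law; total mass 1 comes out as the case \<alpha> = 0.\<close>

definition pc_integrand :: "real \<Rightarrow> complex \<Rightarrow> real \<Rightarrow> complex" where
  "pc_integrand q z x = exp (- (of_real x * z) - of_real (x\<^sup>2 / 2)) * of_real (x powr q)"

text \<open>For q > -1 this is Gamma (q + 1) exp (z^2 / 4) times the parabolic cylinder function of
  order - q - 1 at z. With those factors split off, differentiation in z is, up to sign, a shift of
  q by one.\<close>

definition pc_integral :: "real \<Rightarrow> complex \<Rightarrow> complex" where
  "pc_integral q z = (LINT x:{0<..}|lborel. pc_integrand q z x)"

lemma pc_integrand_measurable [measurable]: "pc_integrand q z \<in> borel_measurable borel"
  unfolding pc_integrand_def by measurable

lemma set_integrable_powr_exp:
  assumes "q > -1"
  shows "set_integrable lborel {0<..} (\<lambda>x::real. x powr q * exp (- x))"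
proof -
  have "integrable lborel (\<lambda>x. indicator {0..} x * x powr (q + 1 - 1) / exp x)"
  proof (rule integrableI_nonneg)
    show "(\<integral>\<^sup>+ x. ennreal (indicator {0..} x * x powr (q + 1 - 1) / exp x) \<partial>lborel) < \<infinity>"
      using assms by (subst Gamma_conv_nn_integral_real [symmetric]) auto
  qed auto
  then have "set_integrable lborel {0..} (\<lambda>x::real. x powr q * exp (- x))"
    unfolding set_integrable_def by (simp add: exp_minus field_simps)
  then show ?thesis
    by (rule set_integrable_subset) auto
qed

lemma exp_diff_mult: "exp (a - x) * r = exp a * (r * exp (- x))" for a x r :: real
  by (simp add: exp_diff exp_minus field_simps)

text \<open>From (x - (R + 1))^2 \<ge> 0 follows x R - x^2 / 2 \<le> (R + 1)^2 / 2 - x, so the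
  Gaussian decay absorbs the growth exp (x R) and leaves a Gamma integrand. The constant is uniform
  on the disc of radius R.\<close>

lemma norm_pc_integrand_le:
  assumes "norm z \<le> R" "x > 0"
  shows "norm (pc_integrand q z x) \<le> exp ((R + 1)\<^sup>2 / 2) * (x powr q * exp (- x))"
proof -
  have "- (x * Re z) \<le> x * R"
    using assms abs_Re_le_cmod [of z] by (smt (verit) mult_left_mono mult_minus_right)
  moreover have "x * R - x\<^sup>2 / 2 \<le> (R + 1)\<^sup>2 / 2 - x"
    using zero_le_power2 [of "x - (R + 1)"] by (simp add: power2_eq_square field_simps)
  ultimately have "exp (- (x * Re z) - x\<^sup>2 / 2) \<le> exp ((R + 1)\<^sup>2 / 2 - x)"
    by simp
  then have "exp (- (x * Re z) - x\<^sup>2 / 2) * x powr q \<le> exp ((R + 1)\<^sup>2 / 2 - x) * x powr q"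
    by (rule mult_right_mono) simp
  moreover have "exp ((R + 1)\<^sup>2 / 2 - x) * x powr q = exp ((R + 1)\<^sup>2 / 2) * (x powr q * exp (- x))"
    by (rule exp_diff_mult)
  ultimately show ?thesis
    by (simp add: pc_integrand_def norm_mult)
qed

lemma set_integrable_pc_integrand:
  assumes "q > -1"
  shows "set_integrable lborel {0<..} (pc_integrand q z)"
proof (rule set_integrable_bound)
  show "set_integrable lborel {0<..} (\<lambda>x. exp ((norm z + 1)\<^sup>2 / 2) * (x powr q * exp (- x)))"
    using set_integrable_powr_exp [OF assms] by simp
  show "set_borel_measurable lborel {0<..} (pc_integrand q z)"
    unfolding set_borel_measurable_def by measurable
  show "AE x in lborel. x \<in> {0<..} \<longrightarrow> norm (pc_integrand q z x)
          \<le> norm (exp ((norm z + 1)\<^sup>2 / 2) * (x powr q * exp (- x)))"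
    using norm_pc_integrand_le [of z "norm z"] by auto
qed

lemma norm_exp_minus_one_minus_le:
  fixes w :: complex
  shows "norm (exp w - 1 - w) \<le> (norm w)\<^sup>2 * exp (norm w)"
proof -
  have "norm (exp w - (\<Sum>i\<le>1. w ^ i / fact i)) \<le> exp \<bar>Re w\<bar> * (norm w ^ Suc 1) / fact 1"
    by (rule Taylor_exp)
  also have "\<dots> \<le> exp (norm w) * (norm w)\<^sup>2"
    using abs_Re_le_cmod [of w] by (simp add: power2_eq_square mult_right_mono)
  finally show ?thesis
    by (simp add: algebra_simps)
qed

lemma has_field_derivative_pc_integral:
  assumes q: "q > -1"
  shows "(pc_integral q has_field_derivative - pc_integral (q + 1) z) (at z)"
proof -
  \<comment> \<open>The squared norm of w in the Taylor remainder turns x powr q into x powr (q +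
    2). The factor exp (norm w) \<le> exp x, valid for norm h \<le> 1, raises the growth rate from
    norm z to norm z + 1, and completing the square adds one more.\<close>
  define K where "K = (LINT x:{0<..}|lborel. exp ((norm z + 2)\<^sup>2 / 2) * (x powr (q + 2) * exp (- x)))"
  have intK: "set_integrable lborel {0<..} (\<lambda>x::real. exp ((norm z + 2)\<^sup>2 / 2) * (x powr (q + 2) * exp (- x)))"
    using q by (simp add: set_integrable_powr_exp)
  have bound: "norm (pc_integral q (z + h) - pc_integral q z + h * pc_integral (q + 1) z) \<le> K * (norm h)\<^sup>2"
    if h: "norm h \<le> 1" for h
  proof -
    define D where "D = (\<lambda>x. pc_integrand q (z + h) x - pc_integrand q z x + h * pc_integrand (q + 1) z x)"
    have i1: "set_integrable lborel {0<..} (pc_integrand q (z + h))" "set_integrable lborel {0<..} (pc_integrand q z)"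
       "set_integrable lborel {0<..} (pc_integrand (q + 1) z)"
      using q by (auto intro!: set_integrable_pc_integrand)
    have "pc_integral q (z + h) - pc_integral q z + h * pc_integral (q + 1) z = (LINT x:{0<..}|lborel. D x)"
      using i1 unfolding D_def pc_integral_def
      by (subst set_integral_add) (auto intro!: set_integral_diff set_integrable_mult_right)
    also have "norm \<dots> \<le> (LINT x:{0<..}|lborel. (norm h)\<^sup>2 * (exp ((norm z + 2)\<^sup>2 / 2) * (x powr (q + 2) * exp (- x))))"
      unfolding set_lebesgue_integral_def
    proof (rule Bochner_Integration.integral_norm_bound_integral)
      show "integrable lborel (\<lambda>x. indicat_real {0<..} x *\<^sub>R D x)"
        using i1 unfolding D_def set_integrable_def [symmetric] by (auto intro!: set_integral_add set_integral_diff set_integrable_mult_right)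
      show "integrable lborel (\<lambda>x. indicat_real {0<..} x *\<^sub>R
          ((norm h)\<^sup>2 * (exp ((norm z + 2)\<^sup>2 / 2) * (x powr (q + 2) * exp (- x)))))"
        unfolding set_integrable_def [symmetric] by (rule set_integrable_mult_right, rule intK)
      fix x :: real
      show "norm (indicat_real {0<..} x *\<^sub>R D x) \<le> indicat_real {0<..} x *\<^sub>R
          ((norm h)\<^sup>2 * (exp ((norm z + 2)\<^sup>2 / 2) * (x powr (q + 2) * exp (- x))))"
      proof (cases "x > 0")
        case True
        define w where "w = - (of_real x * h)"
        have nw: "norm w = x * norm h"
          using True by (simp add: w_def norm_mult)
        have "pc_integrand q (z + h) x = pc_integrand q z x * exp w"
          unfolding pc_integrand_def w_def by (simp add: exp_add [symmetric] algebra_simps)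
        moreover have "h * pc_integrand (q + 1) z x = - (pc_integrand q z x * w)"
          using True unfolding pc_integrand_def w_def by (simp add: powr_add)
        ultimately have "D x = pc_integrand q z x * (exp w - 1 - w)"
          unfolding D_def by (simp add: algebra_simps)
        then have "norm (D x) \<le> norm (pc_integrand q z x) * ((norm w)\<^sup>2 * exp (norm w))"
          by (simp add: norm_mult mult_left_mono norm_exp_minus_one_minus_le)
        also have "\<dots> = (norm h)\<^sup>2 * (exp (- (x * Re z) - x\<^sup>2 / 2) * exp (x * norm h) * x powr (q + 2))"
          using True by (simp add: nw pc_integrand_def norm_mult powr_add power_mult_distrib)
        also have "\<dots> \<le> (norm h)\<^sup>2 * (exp ((norm z + 2)\<^sup>2 / 2 - x) * x powr (q + 2))"
        proof (intro mult_left_mono mult_right_mono)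
          have "- (x * Re z) \<le> x * norm z"
            using True abs_Re_le_cmod [of z] by (smt (verit) mult_left_mono mult_minus_right)
          moreover have "x * norm h \<le> x"
            using True h by simp
          moreover have "x * (norm z + 1) - x\<^sup>2 / 2 \<le> (norm z + 2)\<^sup>2 / 2 - x"
            using zero_le_power2 [of "x - (norm z + 2)"] by (simp add: power2_eq_square field_simps)
          ultimately show "exp (- (x * Re z) - x\<^sup>2 / 2) * exp (x * norm h) \<le> exp ((norm z + 2)\<^sup>2 / 2 - x)"
            by (simp add: exp_add [symmetric] algebra_simps)
        qed auto
        also have "exp ((norm z + 2)\<^sup>2 / 2 - x) * x powr (q + 2) =
            exp ((norm z + 2)\<^sup>2 / 2) * (x powr (q + 2) * exp (- x))"
          by (rule exp_diff_mult)
        finally show ?thesis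
          using True by simp
      qed simp
    qed
    also have "\<dots> = K * (norm h)\<^sup>2"
      unfolding K_def by simp
    finally show ?thesis .
  qed
  show ?thesis
    unfolding DERIV_def
  proof (rule LIM_zero_cancel, rule Lim_null_comparison)
    show "((\<lambda>h. K * norm h) \<longlongrightarrow> 0) (at (0::complex))"
      by (auto intro!: tendsto_eq_intros)
    have "eventually (\<lambda>h::complex. norm h < 1 \<and> h \<noteq> 0) (at 0)"
      unfolding eventually_at by (auto intro!: exI [of _ 1])
    then show "\<forall>\<^sub>F h in at 0. norm ((pc_integral q (z + h) - pc_integral q z) / h - - pc_integral (q + 1) z) \<le> K * norm h"
    proof eventually_elim
      case (elim h)
      have "norm ((pc_integral q (z + h) - pc_integral q z) / h - - pc_integral (q + 1) z)
          = norm (pc_integral q (z + h) - pc_integral q z + h * pc_integral (q + 1) z) / norm h"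
        using elim by (simp add: norm_divide [symmetric] add_divide_distrib)
      also have "\<dots> \<le> K * (norm h)\<^sup>2 / norm h"
        using bound [of h] elim by (intro divide_right_mono) auto
      finally show ?case
        using elim by (simp add: power2_eq_square)
    qed
  qed
qed

text \<open>Integrate the derivative of \<open>pc_integrand (q + 1) z\<close> over the half-line:
  the boundary terms vanish, at 0 because q + 1 > 0 and at infinity by exponential decay. Combined
  with the derivative formula, this keeps the derivatives of \<open>pc_fun\<close> within the span
  of two integrals.\<close>

lemma pc_integral_recurrence:
  assumes q: "q > -1"
  shows "of_real (q + 1) * pc_integral q z = z * pc_integral (q + 1) z + pc_integral (q + 2) z"
proof -
  define f where "f = (\<lambda>x. of_real (q + 1) * pc_integrand q z x - (z * pc_integrand (q + 1) z x + pc_integrand (q + 2) z x))"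
  have i1: "set_integrable lborel {0<..} (pc_integrand q z)" "set_integrable lborel {0<..} (pc_integrand (q + 1) z)"
       "set_integrable lborel {0<..} (pc_integrand (q + 2) z)"
    using q by (auto intro!: set_integrable_pc_integrand)
  have ein: "einterval 0 \<infinity> = {0::real<..}"
    by (auto simp: einterval_def)
  have int_f: "set_integrable lborel {0<..} f"
    unfolding f_def using i1 by (auto intro!: set_integral_add set_integral_diff set_integrable_mult_right)
  have "(LBINT x=0..\<infinity>. f x) = 0 - 0"
  proof (rule interval_integral_FTC_integrable)
    show "set_integrable lborel (einterval 0 \<infinity>) f"
      using int_f by (simp add: ein)
    show "(0::ereal) < \<infinity>" by simp
    fix x :: real assume "0 < ereal x"
    then have x: "x > 0" by simp
    have P: "((\<lambda>x. x powr (q + 1)) has_real_derivative (q + 1) * x powr q) (at x)"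
      using x has_real_derivative_powr [of x "q + 1"] by simp
    have E: "((\<lambda>x. exp (- (of_real x * z) - of_real (x\<^sup>2 / 2))) has_vector_derivative
         (- z - of_real x) * exp (- (of_real x * z) - of_real (x\<^sup>2 / 2))) (at x)"
    proof -
      have "((\<lambda>w. exp (- (w * z) - (w\<^sup>2 / 2))) has_field_derivative
         (- z - of_real x) * exp (- (of_real x * z) - ((of_real x)\<^sup>2 / 2))) (at (of_real x))"
        by (auto intro!: derivative_eq_intros)
      from has_vector_derivative_real_field[OF this] show ?thesis by simp
    qed
    show "(pc_integrand (q + 1) z has_vector_derivative f x) (at x)"
      unfolding pc_integrand_def f_def
      by (rule has_vector_derivative_eq_rhs [OF has_vector_derivative_mult [OF E has_vector_derivative_of_real [OF P]]])
        (use x in \<open>simp add: powr_add algebra_simps power2_eq_square\<close>)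
    show "isCont f x"
      using x unfolding f_def pc_integrand_def
      by (auto intro!: continuous_intros)
  next
    have "(pc_integrand (q + 1) z \<longlongrightarrow> 0) (at_right 0)"
    proof (rule Lim_null_comparison)
      show "((\<lambda>x. exp ((norm z + 1)\<^sup>2 / 2) * (x powr (q + 1) * exp (- x))) \<longlongrightarrow> 0) (at_right 0)"
        using q by real_asymp
      show "\<forall>\<^sub>F x in at_right 0. norm (pc_integrand (q + 1) z x) \<le> exp ((norm z + 1)\<^sup>2 / 2) * (x powr (q + 1) * exp (- x))"
        using eventually_at_right_less [of "0::real"]
        by eventually_elim (simp add: norm_pc_integrand_le)
    qed
    then show "((pc_integrand (q + 1) z \<circ> real_of_ereal) \<longlongrightarrow> 0) (at_right 0)"
      by (simp add: zero_ereal_def ereal_tendsto_simps)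
    have "(pc_integrand (q + 1) z \<longlongrightarrow> 0) at_top"
    proof (rule Lim_null_comparison)
      show "((\<lambda>x. exp ((norm z + 1)\<^sup>2 / 2) * (x powr (q + 1) * exp (- x))) \<longlongrightarrow> 0) at_top"
        using q by real_asymp
      show "\<forall>\<^sub>F x in at_top. norm (pc_integrand (q + 1) z x) \<le> exp ((norm z + 1)\<^sup>2 / 2) * (x powr (q + 1) * exp (- x))"
        using eventually_gt_at_top [of "0::real"]
        by eventually_elim (simp add: norm_pc_integrand_le)
    qed
    then show "((pc_integrand (q + 1) z \<circ> real_of_ereal) \<longlongrightarrow> 0) (at_left \<infinity>)"
      by (simp add: zero_ereal_def ereal_tendsto_simps)
  qed
  then have "0 = (LINT x:{0<..}|lborel. f x)"
    by (simp add: interval_lebesgue_integral_def ein)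
  also have "\<dots> = of_real (q + 1) * pc_integral q z - (z * pc_integral (q + 1) z + pc_integral (q + 2) z)"
    unfolding f_def pc_integral_def using i1
    by (simp add: set_integral_add set_integral_diff set_integrable_mult_right)
  finally show ?thesis
    by simp
qed

lemma Gamma_real_nonzero: "x > 0 \<Longrightarrow> Gamma x \<noteq> (0::real)"
  using Gamma_real_pos [of x] by linarith

lemma powr_one_minus: "(s::real) > 0 \<Longrightarrow> s powr (1 - p) = s * s powr (- p)"
  by (simp add: powr_diff powr_minus_divide)

text \<open>For \<open>p < 0\<close> an integration by parts turns this into the integral representation of
  \<open>D\<^sub>p\<close> with integrand \<open>exp (- x z - x\<^sup>2 / 2) x powr (- p - 1)\<close>; the present form also covers \<open>0 \<le> p < 1\<close>.\<close>

definition pc_fun :: "real \<Rightarrow> complex \<Rightarrow> complex" where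
  "pc_fun p z = exp (- (z\<^sup>2 / 4)) / of_real (Gamma (1 - p)) *
     (z * pc_integral (- p) z + pc_integral (1 - p) z)"

lemma has_field_derivative_pc_fun:
  assumes "p < 1"
  shows "(pc_fun p has_field_derivative
     exp (- (z\<^sup>2 / 4)) / of_real (Gamma (1 - p)) *
       (of_real p * pc_integral (- p) z - z / 2 * (z * pc_integral (- p) z + pc_integral (1 - p) z))) (at z)"
proof -
  define A B C where "A = pc_integral (- p)" and "B = pc_integral (1 - p)" and "C = pc_integral (2 - p)"
  have A': "(A has_field_derivative - B z) (at z)" for z
    using assms has_field_derivative_pc_integral [of "- p" z] by (simp add: A_def B_def)
  have B': "(B has_field_derivative - C z) (at z)" for z
    using assms has_field_derivative_pc_integral [of "1 - p" z] by (simp add: B_def C_def)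
  \<comment> \<open>The recurrence at q = - p: in the derivative A - z B - C of z A + B, the part z
    B + C equals (1 - p) A.\<close>
  have R: "A z - z * B z - C z = of_real p * A z"
    using assms pc_integral_recurrence [of "- p" z] by (simp add: A_def B_def C_def algebra_simps)
  have "((\<lambda>z. z * A z + B z) has_field_derivative A z - z * B z - C z) (at z)"
    by (auto intro!: derivative_eq_intros A' B')
  then have v: "((\<lambda>z. z * A z + B z) has_field_derivative of_real p * A z) (at z)"
    by (simp only: R)
  have E: "((\<lambda>z. exp (- (z\<^sup>2 / 4)) / of_real (Gamma (1 - p))) has_field_derivative
      - (z / 2) * (exp (- (z\<^sup>2 / 4)) / of_real (Gamma (1 - p)))) (at z)"
    using Gamma_real_nonzero [of "1 - p"] assms by (auto intro!: derivative_eq_intros)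
  show ?thesis
    unfolding pc_fun_def [abs_def] A_def [symmetric] B_def [symmetric]
    by (rule DERIV_cong [OF DERIV_mult [OF E v]]) (simp add: algebra_simps add_divide_distrib)
qed

lemma pc_fun_holomorphic: "p < 1 \<Longrightarrow> pc_fun p holomorphic_on UNIV"
  using has_field_derivative_pc_fun holomorphic_on_open by blast

text \<open>Writing E for exp (- z^2 / 4) / Gamma (1 - p), the solution is u = E (z A + B), and u' =
  p E A - z u / 2. Differentiating again with A' = - B gives - p E (z A + B) = - p u from the terms
  with A and B, and (z^2 / 4 - 1 / 2) u from the rest.\<close>

lemma pc_fun_ode:
  assumes p: "p < 1"
  shows "(deriv ^^ 2) (pc_fun p) z + (of_real p + 1/2 - z\<^sup>2 / 4) * pc_fun p z = 0"
proof -
  define A B where "A = pc_integral (- p)" and "B = pc_integral (1 - p)"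
  define g where "g = of_real (Gamma (1 - p)) * (1::complex)"
  have A': "(A has_field_derivative - B z) (at z)" for z
    using assms has_field_derivative_pc_integral [of "- p" z] by (simp add: A_def B_def)
  have D: "deriv (pc_fun p) = (\<lambda>z. exp (- (z\<^sup>2 / 4)) / g * (of_real p * A z) - z / 2 * pc_fun p z)"
    using DERIV_imp_deriv [OF has_field_derivative_pc_fun [OF p]]
    by (auto simp: fun_eq_iff A_def B_def g_def pc_fun_def algebra_simps add_divide_distrib)
  have u': "(pc_fun p has_field_derivative exp (- (z\<^sup>2 / 4)) / g * (of_real p * A z) - z / 2 * pc_fun p z) (at z)"
    using has_field_derivative_pc_fun [OF p, of z] by (simp add: A_def g_def pc_fun_def algebra_simps add_divide_distrib)
  have E: "((\<lambda>z. exp (- (z\<^sup>2 / 4)) / g) has_field_derivative - (z / 2) * (exp (- (z\<^sup>2 / 4)) / g)) (at z)"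
    using Gamma_real_nonzero [of "1 - p"] assms by (auto simp: g_def
      intro!: derivative_eq_intros)
  have "((\<lambda>z. exp (- (z\<^sup>2 / 4)) / g * (of_real p * A z) - z / 2 * pc_fun p z) has_field_derivative
      - (z / 2) * (exp (- (z\<^sup>2 / 4)) / g) * (of_real p * A z) + exp (- (z\<^sup>2 / 4)) / g * (of_real p * - B z)
       - (1 / 2 * pc_fun p z + z / 2 * (exp (- (z\<^sup>2 / 4)) / g * (of_real p * A z) - z / 2 * pc_fun p z))) (at z)"
    by (rule DERIV_cong [OF DERIV_diff [OF DERIV_mult [OF E DERIV_cmult [OF A']]
         DERIV_mult [OF DERIV_cdivide [OF DERIV_ident] u']]]) (simp add: algebra_simps)
  then have "(deriv ^^ 2) (pc_fun p) z = - (z / 2) * (exp (- (z\<^sup>2 / 4)) / g) * (of_real p * A z)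
      + exp (- (z\<^sup>2 / 4)) / g * (of_real p * - B z)
      - (1 / 2 * pc_fun p z + z / 2 * (exp (- (z\<^sup>2 / 4)) / g * (of_real p * A z) - z / 2 * pc_fun p z))"
    by (simp add: numeral_2_eq_2 D DERIV_imp_deriv)
  moreover have "pc_fun p z = exp (- (z\<^sup>2 / 4)) / g * (z * A z + B z)"
    by (simp add: pc_fun_def A_def B_def g_def)
  ultimately show ?thesis
    by (simp add: power2_eq_square algebra_simps add_divide_distrib diff_divide_distrib)
qed

section \<open>Values on the real axis: integral form, asymptotics at infinity, positivity\<close>

definition pc_real :: "real \<Rightarrow> real \<Rightarrow> real" where
  "pc_real p x = exp (- (x\<^sup>2 / 4)) / Gamma (1 - p) *
     (LINT s:{0<..}|lborel. (x + s) * exp (- (s * x) - s\<^sup>2 / 2) * s powr (- p))"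

lemma pc_integrand_of_real:
  "pc_integrand q (of_real x) s = of_real (exp (- (s * x) - s\<^sup>2 / 2) * s powr q)"
  by (simp add: pc_integrand_def exp_of_real [symmetric])

lemma pc_real_integrable:
  assumes p: "p < 1"
  shows "set_integrable lborel {0<..} (\<lambda>s::real. (x + s) * exp (- (s * x) - s\<^sup>2 / 2) * s powr (- p))"
proof -
  have *: "set_integrable lborel {0<..} (\<lambda>s::real. exp (- (s * x) - s\<^sup>2 / 2) * s powr q)" if "q > -1" for q
    using set_integrable_pc_integrand [OF that, of "of_real x"]
    unfolding set_integrable_def pc_integrand_of_real scaleR_conv_of_real of_real_mult [symmetric]
    by (subst (asm) complex_of_real_integrable_eq) simp
  have "set_integrable lborel {0<..} (\<lambda>s::real. x * (exp (- (s * x) - s\<^sup>2 / 2) * s powr (- p)) +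
     exp (- (s * x) - s\<^sup>2 / 2) * s powr (1 - p))"
    using p by (intro set_integral_add set_integrable_mult_right *) auto
  then show ?thesis
    by (rule set_integrable_cong [THEN iffD1, rotated -1])
      (auto simp: powr_one_minus algebra_simps)
qed

lemma pc_fun_of_real:
  assumes p: "p < 1"
  shows "pc_fun p (of_real x) = of_real (pc_real p x)"
proof -
  have "of_real x * pc_integral (- p) (of_real x) + pc_integral (1 - p) (of_real x) =
     (LINT s:{0<..}|lborel. of_real x * pc_integrand (- p) (of_real x) s + pc_integrand (1 - p) (of_real x) s)"
    unfolding pc_integral_def using p
    by (subst set_integral_add) (auto intro!: set_integrable_pc_integrand set_integrable_mult_right)
  also have "\<dots> = (LINT s:{0<..}|lborel. of_real ((x + s) * exp (- (s * x) - s\<^sup>2 / 2) * s powr (- p)))"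
    by (intro set_lebesgue_integral_cong) (auto simp: pc_integrand_of_real powr_one_minus algebra_simps)
  also have "\<dots> = of_real (LINT s:{0<..}|lborel. (x + s) * exp (- (s * x) - s\<^sup>2 / 2) * s powr (- p))"
    unfolding set_lebesgue_integral_def scaleR_conv_of_real of_real_mult [symmetric] integral_complex_of_real by simp
  finally show ?thesis
    by (simp add: pc_fun_def pc_real_def exp_of_real [symmetric])
qed

text \<open>The substitution s = w / x extracts the expected asymptotic factor; the remaining
  integral converges as x grows.\<close>

lemma pc_real_scaled:
  assumes x: "x > 0"
  shows "pc_real p x = x powr p * exp (- x\<^sup>2 / 4) / Gamma (1 - p) *
    (LINT w:{0<..}|lborel. (1 + w / x\<^sup>2) * exp (- w - w\<^sup>2 / (2 * x\<^sup>2)) * w powr (- p))"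
proof -
  have "(LINT s:{0<..}|lborel. (x + s) * exp (- (s * x) - s\<^sup>2 / 2) * s powr (- p)) =
     (1 / x) * (LINT w|lborel. indicator {0<..} (w / x) *\<^sub>R ((x + w / x) * exp (- (w / x * x) - (w / x)\<^sup>2 / 2) * (w / x) powr (- p)))"
    unfolding set_lebesgue_integral_def
    using x by (subst lborel_integral_real_affine [where c = "1 / x" and t = 0]) auto
  also have "(LINT w|lborel. indicator {0<..} (w / x) *\<^sub>R ((x + w / x) * exp (- (w / x * x) - (w / x)\<^sup>2 / 2) * (w / x) powr (- p)))
    = (LINT w:{0<..}|lborel. x * x powr p * ((1 + w / x\<^sup>2) * exp (- w - w\<^sup>2 / (2 * x\<^sup>2)) * w powr (- p)))"
    unfolding set_lebesgue_integral_def
  proof (intro Bochner_Integration.integral_cong refl)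
    fix w :: real
    show "indicator {0<..} (w / x) *\<^sub>R ((x + w / x) * exp (- (w / x * x) - (w / x)\<^sup>2 / 2) * (w / x) powr (- p)) =
       indicator {0<..} w *\<^sub>R (x * x powr p * ((1 + w / x\<^sup>2) * exp (- w - w\<^sup>2 / (2 * x\<^sup>2)) * w powr (- p)))"
    proof (cases "w > 0")
      case True
      have "x + w / x = x * (1 + w / x\<^sup>2)" using x by (simp add: power2_eq_square field_simps)
      moreover have "(w / x) powr (- p) = w powr (- p) * x powr p"
        using x True by (simp add: powr_divide powr_minus_divide)
      moreover have "- (w / x * x) - (w / x)\<^sup>2 / 2 = - w - w\<^sup>2 / (2 * x\<^sup>2)"
        using x by (simp add: power_divide)
      ultimately show ?thesis
        using True x by (simp del: powr_minus)
    qed (use x in \<open>simp add: zero_less_divide_iff\<close>)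
  qed
  finally show ?thesis
    using x by (simp add: pc_real_def)
qed

lemma set_integral_powr_exp_Gamma:
  assumes "q > -1"
  shows "(LINT x:{0<..}|lborel. x powr q * exp (- x :: real)) = Gamma (q + 1)"
proof -
  have "ennreal (LINT x:{0<..}|lborel. x powr q * exp (- x :: real)) =
      (\<integral>\<^sup>+x. ennreal (indicator {0<..} x *\<^sub>R (x powr q * exp (- x))) \<partial>lborel)"
    using set_integrable_powr_exp [OF assms] unfolding set_lebesgue_integral_def set_integrable_def
    by (subst nn_integral_eq_integral) auto
  also have "\<dots> = (\<integral>\<^sup>+x. ennreal (indicator {0..} x * x powr (q + 1 - 1) / exp x) \<partial>lborel)"
    using AE_lborel_singleton [of 0]
    by (intro nn_integral_cong_AE) (auto elim!: eventually_mono simp: exp_minus field_simps indicator_def)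
  also have "\<dots> = ennreal (Gamma (q + 1))"
    using assms by (subst Gamma_conv_nn_integral_real) auto
  finally show ?thesis
    using assms by (subst (asm) ennreal_inj) (auto simp: set_lebesgue_integral_def intro!: Bochner_Integration.integral_nonneg less_imp_le Gamma_real_pos)
qed

text \<open>After rescaling, (1 + w) exp (- w) w powr (- p) dominates for x \<ge> 1, and the
  remaining integral tends to Gamma (1 - p). This is the reason for that constant in
  \<open>pc_fun\<close>.\<close>

lemma pc_real_asymp:
  assumes p: "p < 1"
  shows "((\<lambda>x. pc_real p x / (x powr p * exp (- x\<^sup>2 / 4))) \<longlongrightarrow> 1) at_top"
proof -
  have G: "Gamma (1 - p) \<noteq> 0"
    using p by (simp add: Gamma_real_nonzero)
  have "((\<lambda>x. LINT w:{0<..}|lborel. (1 + w / x\<^sup>2) * exp (- w - w\<^sup>2 / (2 * x\<^sup>2)) * w powr (- p)) \<longlongrightarrow>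
      (LINT w:{0<..}|lborel. w powr (- p) * exp (- w))) at_top"
    unfolding set_lebesgue_integral_def
  proof (rule integral_dominated_convergence_at_top)
    have "set_integrable lborel {0<..} (\<lambda>w::real. w powr (- p) * exp (- w) + w powr (1 - p) * exp (- w))"
      using p by (intro set_integral_add set_integrable_powr_exp) auto
    then show "integrable lborel (\<lambda>w::real. indicator {0<..} w *\<^sub>R (w powr (- p) * exp (- w) + w powr (1 - p) * exp (- w)))"
      unfolding set_integrable_def .
    show "\<forall>\<^sub>F x in at_top. AE w in lborel.
       norm (indicat_real {0<..} w *\<^sub>R ((1 + w / x\<^sup>2) * exp (- w - w\<^sup>2 / (2 * x\<^sup>2)) * w powr - p))
       \<le> indicat_real {0<..} w *\<^sub>R (w powr - p * exp (- w) + w powr (1 - p) * exp (- w))"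
      using eventually_ge_at_top [of 1]
    proof eventually_elim
      case (elim x)
      have "norm (indicat_real {0<..} w *\<^sub>R ((1 + w / x\<^sup>2) * exp (- w - w\<^sup>2 / (2 * x\<^sup>2)) * w powr - p))
       \<le> indicat_real {0<..} w *\<^sub>R (w powr - p * exp (- w) + w powr (1 - p) * exp (- w))" for w
      proof (cases "w > 0")
        case True
        have "w / x\<^sup>2 \<le> w"
          using True elim by (simp add: divide_le_eq mult_le_cancel_left1)
        then have "(1 + w / x\<^sup>2) * exp (- w - w\<^sup>2 / (2 * x\<^sup>2)) * w powr - p \<le> (1 + w) * exp (- w) * w powr - p"
          using True by (intro mult_right_mono mult_mono) auto
        also have "\<dots> = w powr - p * exp (- w) + w powr (1 - p) * exp (- w)"
          using True by (simp add: powr_one_minus algebra_simps)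
        finally show ?thesis
          using True by (simp add: abs_mult add_nonneg_nonneg)
      qed simp
      then show ?case by simp
    qed
    show "AE w in lborel. ((\<lambda>x. indicat_real {0<..} w *\<^sub>R ((1 + w / x\<^sup>2) * exp (- w - w\<^sup>2 / (2 * x\<^sup>2)) * w powr - p))
       \<longlongrightarrow> indicat_real {0<..} w *\<^sub>R (w powr - p * exp (- w))) at_top"
    proof (intro AE_I2)
      fix w :: real
      have "((\<lambda>x::real. w / x\<^sup>2) \<longlongrightarrow> 0) at_top" by real_asymp
      moreover have "((\<lambda>x::real. w\<^sup>2 / (2 * x\<^sup>2)) \<longlongrightarrow> 0) at_top" by real_asymp
      ultimately have "((\<lambda>x. indicat_real {0<..} w *\<^sub>R ((1 + w / x\<^sup>2) * exp (- w - w\<^sup>2 / (2 * x\<^sup>2)) * w powr - p))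
       \<longlongrightarrow> indicat_real {0<..} w *\<^sub>R ((1 + 0) * exp (- w - 0) * w powr - p)) at_top"
        by (intro tendsto_intros)
      then show "((\<lambda>x. indicat_real {0<..} w *\<^sub>R ((1 + w / x\<^sup>2) * exp (- w - w\<^sup>2 / (2 * x\<^sup>2)) * w powr - p))
       \<longlongrightarrow> indicat_real {0<..} w *\<^sub>R (w powr - p * exp (- w))) at_top"
        by (simp add: mult_ac)
    qed
  qed measurable
  then have "((\<lambda>x. (LINT w:{0<..}|lborel. (1 + w / x\<^sup>2) * exp (- w - w\<^sup>2 / (2 * x\<^sup>2)) * w powr (- p)) / Gamma (1 - p)) \<longlongrightarrow>
      Gamma (1 - p) / Gamma (1 - p)) at_top"
    using p set_integral_powr_exp_Gamma [of "- p"] G by (intro tendsto_divide) auto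
  then have *: "((\<lambda>x. (LINT w:{0<..}|lborel. (1 + w / x\<^sup>2) * exp (- w - w\<^sup>2 / (2 * x\<^sup>2)) * w powr (- p)) / Gamma (1 - p)) \<longlongrightarrow> 1) at_top"
    using G by simp
  show ?thesis
  proof (rule Lim_transform_eventually [OF *])
    show "\<forall>\<^sub>F x in at_top. (LINT w:{0<..}|lborel. (1 + w / x\<^sup>2) * exp (- w - w\<^sup>2 / (2 * x\<^sup>2)) * w powr (- p)) / Gamma (1 - p)
       = pc_real p x / (x powr p * exp (- x\<^sup>2 / 4))"
      using eventually_gt_at_top [of 0]
      by eventually_elim (simp add: pc_real_scaled)
  qed
qed

text \<open>The integrand is positive for x > 0, and a zero integral would make it vanish almost
  everywhere on the unit interval. Strictness allows \<open>pc_real\<close> as a denominator in the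
  uniqueness proof.\<close>

lemma pc_real_pos:
  assumes "p < 1" "x > 0"
  shows "pc_real p x > 0"
proof -
  let ?f = "\<lambda>s::real. (x + s) * exp (- (s * x) - s\<^sup>2 / 2) * s powr (- p)"
  have nonneg: "0 \<le> (LINT s:{0<..}|lborel. ?f s)"
    unfolding set_lebesgue_integral_def using assms
    by (intro Bochner_Integration.integral_nonneg) (auto simp: indicator_def)
  have "(LINT s:{0<..}|lborel. ?f s) \<noteq> 0"
  proof
    assume "(LINT s:{0<..}|lborel. ?f s) = 0"
    then have "AE s in lborel. indicator {0<..} s *\<^sub>R ?f s = 0"
      using pc_real_integrable [OF assms(1), of x] assms
      unfolding set_lebesgue_integral_def set_integrable_def
      by (subst (asm) integral_nonneg_eq_0_iff_AE) (auto simp: indicator_def)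
    then have "AE s in lborel. s \<notin> {0<..<1::real}"
      by eventually_elim (use assms in \<open>auto simp: indicator_def split: if_splits\<close>)
    then have "emeasure lborel {0<..<1::real} = 0"
      by (subst (asm) AE_iff_measurable [OF _ refl]) (auto simp: greaterThanLessThan_def greaterThan_def lessThan_def Int_def)
    then show False
      by simp
  qed
  with nonneg have "0 < (LINT s:{0<..}|lborel. ?f s)"
    by linarith
  then show ?thesis
    unfolding pc_real_def using assms
    by (intro mult_pos_pos divide_pos_pos Gamma_real_pos) auto
qed

lemma pc_fun_asymp_equiv:
  assumes "p < 1"
  shows "(\<lambda>x::real. pc_fun p (of_real x)) \<sim>[at_top] (\<lambda>x. of_real (x powr p * exp (- x\<^sup>2 / 4)))"
proof (rule asymp_equivI')
  have "((\<lambda>x. complex_of_real (pc_real p x / (x powr p * exp (- x\<^sup>2 / 4)))) \<longlongrightarrow> of_real 1) at_top"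
    by (rule tendsto_of_real [OF pc_real_asymp [OF assms]])
  then show "((\<lambda>x. pc_fun p (of_real x) / of_real (x powr p * exp (- x\<^sup>2 / 4))) \<longlongrightarrow> 1) at_top"
    by (simp add: pc_fun_of_real [OF assms])
qed

text \<open>The Wronskian \<open>C\<close> of two solutions is constant, so their quotient has derivative
  \<open>C / D\<^sub>p\<^sup>2\<close> on the positive axis. This blows up at infinity unless \<open>C = 0\<close>, whereas the quotient
  converges to 1.\<close>

lemma parabolic_cylinder_unique:
  assumes p: "p < 1"
    and hol: "u holomorphic_on UNIV"
    and ode: "\<And>z. (deriv ^^ 2) u z + (of_real p + 1/2 - z\<^sup>2 / 4) * u z = 0"
    and asymp: "(\<lambda>x::real. u (of_real x)) \<sim>[at_top] (\<lambda>x. of_real (x powr p * exp (- x\<^sup>2 / 4)))"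
  shows "u = pc_fun p"
proof -
  define f where "f = pc_fun p"
  have holf: "f holomorphic_on UNIV"
    unfolding f_def by (rule pc_fun_holomorphic [OF p])
  have d: "(v has_field_derivative deriv v z) (at z)" if "v holomorphic_on UNIV" for v z
    using that holomorphic_derivI by blast
  have hold: "deriv u holomorphic_on UNIV" "deriv f holomorphic_on UNIV"
    using hol holf by (auto intro: holomorphic_deriv)
  have "((\<lambda>z. f z * deriv u z - deriv f z * u z) has_field_derivative 0) (at z within UNIV)" for z
  proof -
    have 1: "deriv (deriv u) z = - ((of_real p + 1/2 - z * z / 4) * u z)"
      using ode [of z] by (simp add: numeral_2_eq_2 eq_neg_iff_add_eq_0)
    have 2: "deriv (deriv f) z = - ((of_real p + 1/2 - z * z / 4) * f z)"
      using pc_fun_ode [OF p, of z] by (simp add: numeral_2_eq_2 eq_neg_iff_add_eq_0 f_def)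
    show ?thesis
      by (rule DERIV_cong [OF DERIV_diff [OF DERIV_mult [OF d [OF holf] d [OF hold(1)]]
            DERIV_mult [OF d [OF hold(2)] d [OF hol]]]])
        (simp add: 1 2 algebra_simps)
  qed
  then obtain C where C: "\<And>z. f z * deriv u z - deriv f z * u z = C"
    using has_field_derivative_zero_constant [of UNIV "\<lambda>z. f z * deriv u z - deriv f z * u z"]
    by (metis UNIV_I convex_UNIV)
  define r where "r = pc_real p"
  have fr: "f (of_real x) = of_real (r x)" for x
    using pc_fun_of_real [OF p] by (simp add: f_def r_def)
  have rpos: "r x > 0" if "x > 0" for x
    using pc_real_pos [OF p that] by (simp add: r_def)
  define g where "g = (\<lambda>x::real. u (of_real x) / of_real (r x))"
  have g': "(g has_vector_derivative C / of_real ((r x)\<^sup>2)) (at x)" if "x > 0" for x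
  proof -
    have nz: "f (of_real x) \<noteq> 0"
      using rpos [OF that] by (simp add: fr)
    have "((\<lambda>z. u z / f z) has_field_derivative C / (f (of_real x))\<^sup>2) (at (of_real x))"
      by (rule DERIV_cong [OF DERIV_divide [OF d [OF hol] d [OF holf] nz]])
        (simp add: C [of "of_real x", symmetric] power2_eq_square mult_ac)
    from has_vector_derivative_real_field [OF this] show ?thesis
      by (simp add: g_def fr)
  qed
  have glim: "(g \<longlongrightarrow> 1) at_top"
  proof -
    have "(\<lambda>x::real. u (of_real x)) \<sim>[at_top] (\<lambda>x. f (of_real x))"
      using asymp pc_fun_asymp_equiv [OF p] unfolding f_def
      by (meson asymp_equiv_sym asymp_equiv_trans)
    then have "((\<lambda>x::real. if u (of_real x) = 0 \<and> f (of_real x) = 0 then 1 else u (of_real x) / f (of_real x)) \<longlongrightarrow> 1) at_top"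
      by (simp add: asymp_equiv_def)
    then show ?thesis
    proof (rule Lim_transform_eventually)
      show "\<forall>\<^sub>F x in at_top. (if u (of_real x) = 0 \<and> f (of_real x) = 0 then 1 else u (of_real x) / f (of_real x)) = g x"
        using eventually_gt_at_top [of 0]
        by eventually_elim (use rpos in \<open>force simp: g_def fr\<close>)
    qed
  qed
  have rlim: "(r \<longlongrightarrow> 0) at_top"
  proof -
    have "((\<lambda>x. pc_real p x / (x powr p * exp (- x\<^sup>2 / 4)) * (x powr p * exp (- x\<^sup>2 / 4))) \<longlongrightarrow> 1 * 0) at_top"
      by (intro tendsto_mult pc_real_asymp [OF p]) real_asymp
    then have "((\<lambda>x. pc_real p x / (x powr p * exp (- x\<^sup>2 / 4)) * (x powr p * exp (- x\<^sup>2 / 4))) \<longlongrightarrow> 0) at_top"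
      by simp
    then show ?thesis
    proof (rule Lim_transform_eventually)
      show "\<forall>\<^sub>F x in at_top. pc_real p x / (x powr p * exp (- x\<^sup>2 / 4)) * (x powr p * exp (- x\<^sup>2 / 4)) = r x"
        using eventually_gt_at_top [of 0] by eventually_elim (simp add: r_def)
    qed
  qed
  have "C = 0"
  proof (rule ccontr)
    assume "C \<noteq> 0"
    \<comment> \<open>Dividing by C makes the derivative the real number 1 / r^2, so the real mean
      value theorem applies to the real part.\<close>
    define G where "G = (\<lambda>x. Re (g x / C))"
    have G': "(G has_real_derivative 1 / (r x)\<^sup>2) (at x)" if "x > 0" for x
    proof -
      have "((\<lambda>x. g x / C) has_vector_derivative C / of_real ((r x)\<^sup>2) / C) (at x)"
        using g' [OF that] by (rule has_vector_derivative_divide)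
      then have "((\<lambda>x. g x / C) has_vector_derivative of_real (1 / (r x)\<^sup>2)) (at x)"
        using \<open>C \<noteq> 0\<close> by simp
      from has_field_derivative_Re [OF this] show ?thesis
        unfolding G_def by simp
    qed
    have Glim: "(G \<longlongrightarrow> Re (1 / C)) at_top"
      unfolding G_def using \<open>C \<noteq> 0\<close> by (intro tendsto_intros glim) auto
    \<comment> \<open>Convergence of G forces its increments over unit intervals to tend to 0,
      whereas the mean value theorem makes them at least 1 once r stays below 1.\<close>
    have "((\<lambda>x. G (x + 1) - G x) \<longlongrightarrow> Re (1 / C) - Re (1 / C)) at_top"
      by (intro tendsto_diff Glim filterlim_compose [OF Glim]) real_asymp
    then have "\<forall>\<^sub>F x in at_top. G (x + 1) - G x < 1"
      by (rule order_tendstoD) simp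
    moreover have "\<forall>\<^sub>F x in at_top. \<forall>y\<ge>x. r y < 1"
    proof -
      have "\<forall>\<^sub>F x in at_top. r x < 1"
        using rlim by (rule order_tendstoD) simp
      then show ?thesis
        unfolding eventually_at_top_linorder by (meson order_trans)
    qed
    ultimately have "\<forall>\<^sub>F x::real in at_top. False"
      using eventually_gt_at_top [of 0]
    proof eventually_elim
      case (elim x)
      obtain \<xi> where \<xi>: "x < \<xi>" "G (x + 1) - G x = (x + 1 - x) * (1 / (r \<xi>)\<^sup>2)"
        using MVT2 [of x "x + 1" G "\<lambda>x. 1 / (r x)\<^sup>2"] G' elim by auto
      have "r \<xi> < 1" "r \<xi> > 0"
        using \<xi> elim rpos by auto
      then have "1 / (r \<xi>)\<^sup>2 \<ge> 1"
        by (simp add: power_le_one)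
      with \<xi> elim show ?case by simp
    qed
    then show False by simp
  qed
  have g1: "g x = 1" if "x > 0" for x
  proof -
    obtain k where k: "\<And>x. x \<in> {0<..} \<Longrightarrow> g x = k"
      by (rule has_vector_derivative_zero_constant [of "{0<..}" g])
        (use g' \<open>C = 0\<close> in \<open>auto intro: has_vector_derivative_at_within\<close>)
    have "((\<lambda>_::real. k) \<longlongrightarrow> 1) at_top"
      by (rule Lim_transform_eventually [OF glim])
        (use eventually_gt_at_top [of 0] in \<open>eventually_elim, simp add: k\<close>)
    then have "k = 1"
      by (simp add: tendsto_const_iff)
    with k that show ?thesis by simp
  qed
  \<comment> \<open>The positive axis has the limit point 0, so agreement there extends to the whole
    plane.\<close>
  have "u w - f w = 0" for w
  proof (rule analytic_continuation [where S = UNIV and U = "of_real ` {0::real<..}" and \<xi> = 0 and f = "\<lambda>w. u w - f w"])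
    show "(\<lambda>w. u w - f w) holomorphic_on UNIV"
      using hol holf by (intro holomorphic_intros)
    show "(0::complex) islimpt of_real ` {0::real<..}"
      unfolding islimpt_approachable
    proof (intro allI impI)
      fix e :: real assume "e > 0"
      then show "\<exists>x'\<in>complex_of_real ` {0<..}. x' \<noteq> 0 \<and> dist x' 0 < e"
        by (intro bexI [of _ "of_real (e / 2)"] imageI) auto
    qed
    fix z :: complex assume "z \<in> of_real ` {0::real<..}"
    then obtain x where x: "z = of_real x" "x > 0" by auto
    with g1 [of x] rpos [of x] show "u z - f z = 0"
      by (simp add: g_def fr field_simps)
  qed auto
  then show ?thesis
    by (auto simp: f_def fun_eq_iff)
qed

lemma pcf_D_eq:
  assumes "p < 1"
  shows "pcf_D p x = pc_real p x"
proof -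
  have "parabolic_cylinder p = pc_fun p"
    unfolding parabolic_cylinder_def
    using pc_fun_holomorphic pc_fun_ode pc_fun_asymp_equiv parabolic_cylinder_unique assms
    by (intro the_equality) auto
  then show ?thesis
    by (simp add: pcf_D_def pc_fun_of_real assms)
qed

section \<open>First passage densities and the Volterra kernel\<close>

text \<open>The density at time \<open>v\<close> of the first passage of a Brownian motion to a level at distance \<open>r\<close>.\<close>

definition fp_kernel :: "real \<Rightarrow> real \<Rightarrow> real" where
  "fp_kernel r v = r / v * normal_density 0 (sqrt v) r"

lemma fp_kernel_nonneg: "0 \<le> r \<Longrightarrow> 0 \<le> v \<Longrightarrow> 0 \<le> fp_kernel r v"
  by (simp add: fp_kernel_def)

lemma normal_density_measurable2 [measurable (raw)]:
  assumes [measurable]: "f \<in> borel_measurable M" "g \<in> borel_measurable M" "h \<in> borel_measurable M"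
  shows "(\<lambda>x. normal_density (f x) (g x) (h x)) \<in> borel_measurable M"
  unfolding normal_density_def by measurable

lemma fp_kernel_measurable [measurable (raw)]:
  assumes [measurable]: "f \<in> borel_measurable M" "g \<in> borel_measurable M"
  shows "(\<lambda>x. fp_kernel (f x) (g x)) \<in> borel_measurable M"
  unfolding fp_kernel_def by measurable

lemma fp_kernel_pos_eq:
  "v > 0 \<Longrightarrow> fp_kernel r v = r / (v * sqrt v) * exp (- r\<^sup>2 / (2 * v)) / sqrt (2 * pi)"
  by (simp add: fp_kernel_def normal_density_def real_sqrt_mult)

section \<open>The normal distribution function and integrals of the first passage density\<close>

abbreviation std_normal_cdf :: "real \<Rightarrow> real" where
  "std_normal_cdf \<equiv> cdf (density lborel std_normal_density)"

lemma real_distribution_std_normal: "real_distribution (density lborel std_normal_density)"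
  unfolding real_distribution_def real_distribution_axioms_def
  by (auto intro: prob_space_normal_density)

lemma std_normal_cdf_has_derivative:
  "(std_normal_cdf has_real_derivative std_normal_density x) (at x)"
proof -
  interpret real_distribution "density lborel std_normal_density"
    by (rule real_distribution_std_normal)
  define a b where "a = x - 1" and "b = x + 1"
  have cont: "continuous_on A std_normal_density" for A
    unfolding normal_density_def by (auto intro!: continuous_intros)
  have eq: "std_normal_cdf y = std_normal_cdf a + integral {a..y} std_normal_density" if "y \<in> {a..b}" for y
  proof (cases "y = a")
    case False
    with that have "a < y" by auto
    then have "std_normal_cdf y - std_normal_cdf a = measure (density lborel std_normal_density) {a<..y}"
      by (rule cdf_diff_eq)
    also have "\<dots> = (LINT t:{a..y}|lborel. std_normal_density t)"
    proof -
      have int: "set_integrable lborel {a..y} std_normal_density"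
        by (rule borel_integrable_atLeastAtMost') (rule cont)
      have "emeasure (density lborel std_normal_density) {a<..y} =
          (\<integral>\<^sup>+t. ennreal (std_normal_density t) * indicator {a<..y} t \<partial>lborel)"
        by (rule emeasure_density) auto
      also have "\<dots> = (\<integral>\<^sup>+t. ennreal (indicator {a..y} t *\<^sub>R std_normal_density t) \<partial>lborel)"
        using AE_lborel_singleton [of a]
        by (intro nn_integral_cong_AE) (auto elim!: eventually_mono simp: indicator_def)
      also have "\<dots> = ennreal (LINT t:{a..y}|lborel. std_normal_density t)"
        using int unfolding set_lebesgue_integral_def set_integrable_def
        by (intro nn_integral_eq_integral) auto
      finally show ?thesis
        by (simp add: measure_def set_lebesgue_integral_def)
    qed
    also have "\<dots> = integral {a..y} std_normal_density"
      by (intro set_borel_integral_eq_integral borel_integrable_atLeastAtMost' cont)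
    finally show ?thesis by simp
  qed simp
  have "((\<lambda>y. integral {a..y} std_normal_density) has_real_derivative std_normal_density x) (at x within {a..b})"
    by (rule integral_has_real_derivative) (auto simp: a_def b_def cont)
  then have "((\<lambda>y. std_normal_cdf a + integral {a..y} std_normal_density) has_real_derivative std_normal_density x) (at x within {a..b})"
    by (auto intro!: derivative_eq_intros)
  then have "(std_normal_cdf has_real_derivative std_normal_density x) (at x within {a..b})"
  proof (rule has_field_derivative_transform_within [where d = 1])
    show "std_normal_cdf a + integral {a..y} std_normal_density = std_normal_cdf y" if "y \<in> {a..b}" for y
      using that by (rule eq [symmetric])
  qed (auto simp: a_def b_def)
  then show ?thesis
    by (simp add: at_within_Icc_at a_def b_def)
qed

text \<open>The antiderivative is the distribution function of the inverse Gaussian law.\<close>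

lemma laplace_fp_kernel:
  assumes r: "r > 0" and b: "\<beta> > 0"
  shows "(\<integral>\<^sup>+t. ennreal (exp (- \<beta> * t) * fp_kernel r t) * indicator {0<..} t \<partial>lborel) =
    ennreal (exp (- r * sqrt (2 * \<beta>)))"
proof -
  interpret real_distribution "density lborel std_normal_density"
    by (rule real_distribution_std_normal)
  define \<alpha> where "\<alpha> = sqrt (2 * \<beta>)"
  have \<alpha>: "\<alpha> > 0" "\<alpha>\<^sup>2 = 2 * \<beta>" using b by (auto simp: \<alpha>_def)
  define f where "f = (\<lambda>t. exp (- \<beta> * t) * (r / (t * sqrt t) * exp (- r\<^sup>2 / (2 * t)) / sqrt (2 * pi)))"
  \<comment> \<open>Exponential tilting: exp (- \<beta> t) times the density is exp (- r \<alpha>)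
    times the first passage density to r of a Brownian motion with drift \<alpha>. With positive
    drift the level is reached almost surely, whence the limit exp (- r \<alpha>) at
    infinity.\<close>
  define A where "A = (\<lambda>t. exp (- r * \<alpha>) * std_normal_cdf (\<alpha> * sqrt t - r / sqrt t) +
     exp (r * \<alpha>) * std_normal_cdf (- \<alpha> * sqrt t - r / sqrt t))"
  have ein: "einterval 0 \<infinity> = {0::real<..}"
    by (auto simp: einterval_def)
  have A': "DERIV A t :> f t" if t: "t > 0" for t
  proof -
    define s where "s = sqrt t"
    have s: "s > 0" "t = s\<^sup>2" using t by (auto simp: s_def)
    have d1: "((\<lambda>t. \<alpha> * sqrt t - r / sqrt t) has_real_derivative \<alpha> / (2 * s) + r / (2 * s ^ 3)) (at t)"
      using t s by (auto intro!: derivative_eq_intros simp: s_def [symmetric] field_simps power2_eq_square power3_eq_cube)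
    have d2: "((\<lambda>t. - \<alpha> * sqrt t - r / sqrt t) has_real_derivative - \<alpha> / (2 * s) + r / (2 * s ^ 3)) (at t)"
      using t s by (auto intro!: derivative_eq_intros simp: s_def [symmetric] field_simps power2_eq_square power3_eq_cube)
    \<comment> \<open>Completing the square makes both weighted normal densities equal to one
      expression, so in the derivative of A the terms \<alpha> / (2 s) cancel and r / s^3
      remains.\<close>
    have e1: "exp (- r * \<alpha>) * std_normal_density (\<alpha> * s - r / s) = exp (- \<beta> * t) * exp (- r\<^sup>2 / (2 * t)) / sqrt (2 * pi)"
    proof -
      have "- r * \<alpha> + - (\<alpha> * s - r / s)\<^sup>2 / 2 = - \<beta> * t + - r\<^sup>2 / (2 * t)"
        using s \<alpha> by (simp add: power2_diff power_mult_distrib power_divide field_simps) (simp add: power2_eq_square field_simps)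
      then show ?thesis
        by (simp add: normal_density_def exp_add [symmetric])
    qed
    have e2: "exp (r * \<alpha>) * std_normal_density (- \<alpha> * s - r / s) = exp (- \<beta> * t) * exp (- r\<^sup>2 / (2 * t)) / sqrt (2 * pi)"
    proof -
      have "r * \<alpha> + - (- \<alpha> * s - r / s)\<^sup>2 / 2 = - \<beta> * t + - r\<^sup>2 / (2 * t)"
        using s \<alpha> by (simp add: power2_diff power_mult_distrib power_divide field_simps) (simp add: power2_eq_square field_simps)
      then show ?thesis
        by (simp add: normal_density_def exp_add [symmetric])
    qed
    have "DERIV A t :> exp (- r * \<alpha>) * (std_normal_density (\<alpha> * s - r / s) * (\<alpha> / (2 * s) + r / (2 * s ^ 3))) +
        exp (r * \<alpha>) * (std_normal_density (- \<alpha> * s - r / s) * (- \<alpha> / (2 * s) + r / (2 * s ^ 3)))"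
      unfolding A_def s_def
      by (intro DERIV_add DERIV_cmult DERIV_chain2 [OF std_normal_cdf_has_derivative] d1 [unfolded s_def] d2 [unfolded s_def])
    moreover have "exp (- r * \<alpha>) * (std_normal_density (\<alpha> * s - r / s) * (\<alpha> / (2 * s) + r / (2 * s ^ 3))) +
        exp (r * \<alpha>) * (std_normal_density (- \<alpha> * s - r / s) * (- \<alpha> / (2 * s) + r / (2 * s ^ 3))) = f t" (is "?L = _")
    proof -
      have "?L = (exp (- r * \<alpha>) * std_normal_density (\<alpha> * s - r / s)) * (\<alpha> / (2 * s) + r / (2 * s ^ 3)) +
          (exp (r * \<alpha>) * std_normal_density (- \<alpha> * s - r / s)) * (- \<alpha> / (2 * s) + r / (2 * s ^ 3))"
        by (simp only: mult.assoc)
      also have "\<dots> = exp (- \<beta> * t) * exp (- r\<^sup>2 / (2 * t)) / sqrt (2 * pi) * (r / s ^ 3)"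
        unfolding e1 e2 by (simp only: distrib_left [symmetric]) simp
      also have "\<dots> = f t"
        using s by (simp add: f_def s_def [symmetric] power2_eq_square power3_eq_cube mult_ac)
      finally show ?thesis .
    qed
    ultimately show ?thesis by simp
  qed
  have nonneg: "0 \<le> f t" if "t > 0" for t
    using that r by (simp add: f_def)
  have A0: "(A \<longlongrightarrow> 0) (at_right 0)"
  proof -
    have "filterlim (\<lambda>t. \<alpha> * sqrt t - r / sqrt t) at_bot (at_right 0)"
      using r \<alpha>(1) by real_asymp
    from filterlim_compose [OF cdf_lim_at_bot this] have 1: "((\<lambda>t. std_normal_cdf (\<alpha> * sqrt t - r / sqrt t)) \<longlongrightarrow> 0) (at_right 0)" .
    have "filterlim (\<lambda>t. - \<alpha> * sqrt t - r / sqrt t) at_bot (at_right 0)"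
      using r \<alpha>(1) by real_asymp
    from filterlim_compose [OF cdf_lim_at_bot this] have 2: "((\<lambda>t. std_normal_cdf (- \<alpha> * sqrt t - r / sqrt t)) \<longlongrightarrow> 0) (at_right 0)" .
    show ?thesis
      unfolding A_def using tendsto_add [OF tendsto_mult_left [OF 1] tendsto_mult_left [OF 2]] by simp
  qed
  have A1: "(A \<longlongrightarrow> exp (- r * \<alpha>)) at_top"
  proof -
    have "filterlim (\<lambda>t. \<alpha> * sqrt t - r / sqrt t) at_top at_top"
      using r \<alpha>(1) by real_asymp
    from filterlim_compose [OF cdf_lim_at_top_prob this] have 1: "((\<lambda>t. std_normal_cdf (\<alpha> * sqrt t - r / sqrt t)) \<longlongrightarrow> 1) at_top" .
    have "filterlim (\<lambda>t. - \<alpha> * sqrt t - r / sqrt t) at_bot at_top"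
      using r \<alpha>(1) by real_asymp
    from filterlim_compose [OF cdf_lim_at_bot this] have 2: "((\<lambda>t. std_normal_cdf (- \<alpha> * sqrt t - r / sqrt t)) \<longlongrightarrow> 0) at_top" .
    show ?thesis
      unfolding A_def using tendsto_add [OF tendsto_mult_left [OF 1, of "exp (- r * \<alpha>)"] tendsto_mult_left [OF 2, of "exp (r * \<alpha>)"]] by simp
  qed
  have cont: "isCont f t" if "0 < ereal t" for t
    using that unfolding f_def by (auto intro!: continuous_intros)
  have nonneg': "AE t in lborel. 0 < ereal t \<longrightarrow> ereal t < \<infinity> \<longrightarrow> 0 \<le> f t"
    using nonneg by auto
  have lim0: "((A \<circ> real_of_ereal) \<longlongrightarrow> 0) (at_right 0)"
    using A0 by (simp add: zero_ereal_def ereal_tendsto_simps)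
  have lim1: "((A \<circ> real_of_ereal) \<longlongrightarrow> exp (- r * \<alpha>)) (at_left \<infinity>)"
    using A1 by (simp add: ereal_tendsto_simps)
  have dA: "DERIV A t :> f t" if "0 < ereal t" for t
    using A' that by simp
  have less: "(0::ereal) < \<infinity>"
    by simp
  note FTC = interval_integral_FTC_nonneg [OF less dA cont nonneg' lim0 lim1]
  have "(\<integral>\<^sup>+t. ennreal (exp (- \<beta> * t) * fp_kernel r t) * indicator {0<..} t \<partial>lborel) =
      (\<integral>\<^sup>+t. ennreal (indicator {0<..} t *\<^sub>R f t) \<partial>lborel)"
    by (intro nn_integral_cong) (auto simp: indicator_def f_def fp_kernel_pos_eq)
  also have "\<dots> = ennreal (LINT t:{0<..}|lborel. f t)"
    using FTC(1) nonneg unfolding ein set_lebesgue_integral_def set_integrable_def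
    by (intro nn_integral_eq_integral) (auto simp: indicator_def)
  also have "(LINT t:{0<..}|lborel. f t) = exp (- r * \<alpha>)"
    using FTC(2) by (simp add: interval_lebesgue_integral_def ein)
  finally show ?thesis
    by (simp add: \<alpha>_def)
qed

text \<open>\<open>fp_kernel (m - w) v\<close> is the derivative in w of the normal density with
  mean m, which vanishes at minus infinity. It is nonnegative for w \<le> m, so x \<le> m is what
  permits a nonnegative integral. This is the link between the equation for densities and the one
  for first passage densities.\<close>

lemma nn_integral_fp_kernel:
  assumes v: "v > 0" and xm: "x \<le> m"
  shows "(\<integral>\<^sup>+w. ennreal (fp_kernel (m - w) v) * indicator {..x} w \<partial>lborel) =
    ennreal (normal_density m (sqrt v) x)"
proof -
  let ?f = "\<lambda>w. fp_kernel (m - w) v"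
  have ein: "einterval (-\<infinity>) (ereal x) = {..<x}"
    by (auto simp: einterval_def)
  define k where "k = 1 / sqrt (2 * pi * (sqrt v)\<^sup>2)"
  have n: "normal_density m (sqrt v) w = k * exp (- (w - m)\<^sup>2 / (2 * v))" for w
    using v by (simp add: normal_density_def k_def)
  have f: "?f w = - ((w - m) / v) * (k * exp (- (w - m)\<^sup>2 / (2 * v)))" for w
    using v power2_commute [of m w] by (simp add: fp_kernel_def normal_density_def k_def diff_divide_distrib)
  have d: "DERIV (normal_density m (sqrt v)) w :> ?f w" for w
    unfolding n [abs_def] f using v by (auto intro!: derivative_eq_intros) (simp add: field_simps)
  have cont: "isCont ?f w" for w
    using v unfolding fp_kernel_def normal_density_def by (auto intro!: continuous_intros)
  have nonneg: "AE w in lborel. - \<infinity> < ereal w \<longrightarrow> ereal w < ereal x \<longrightarrow> 0 \<le> ?f w"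
    using v xm by (auto intro!: fp_kernel_nonneg)
  have "((\<lambda>w. normal_density m (sqrt v) w) \<longlongrightarrow> 0) at_bot"
    unfolding normal_density_def using v by real_asymp
  then have lim0: "((normal_density m (sqrt v) \<circ> real_of_ereal) \<longlongrightarrow> 0) (at_right (-\<infinity>))"
    by (simp add: ereal_tendsto_simps)
  have "(normal_density m (sqrt v) \<longlongrightarrow> normal_density m (sqrt v) x) (at_left x)"
    using d [of x] by (meson DERIV_isCont filterlim_at_split isCont_def)
  then have lim1: "((normal_density m (sqrt v) \<circ> real_of_ereal) \<longlongrightarrow> normal_density m (sqrt v) x) (at_left (ereal x))"
    by (simp add: ereal_tendsto_simps)
  have less: "- \<infinity> < ereal x"
    by simp
  note FTC = interval_integral_FTC_nonneg [OF less d cont nonneg lim0 lim1]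
  have "(\<integral>\<^sup>+w. ennreal (?f w) * indicator {..x} w \<partial>lborel) =
      (\<integral>\<^sup>+w. ennreal (indicator {..<x} w *\<^sub>R ?f w) \<partial>lborel)"
    using AE_lborel_singleton [of x]
    by (intro nn_integral_cong_AE) (auto elim!: eventually_mono simp: indicator_def)
  also have "\<dots> = ennreal (LINT w:{..<x}|lborel. ?f w)"
    using FTC(1) v xm unfolding ein set_lebesgue_integral_def set_integrable_def
    by (intro nn_integral_eq_integral) (auto simp: indicator_def intro!: fp_kernel_nonneg)
  also have "(LINT w:{..<x}|lborel. ?f w) = normal_density m (sqrt v) x"
    using FTC(2) by (simp add: interval_lebesgue_integral_def ein)
  finally show ?thesis .
qed

section \<open>The Volterra kernel as a mixture of first passage densities\<close>

definition pcf_kernel :: "real \<Rightarrow> real \<Rightarrow> real \<Rightarrow> real" where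
  "pcf_kernel p a t = exp (- a\<^sup>2 / (4 * t)) * pcf_D p (a / sqrt t) / t powr ((p + 1) / 2)"

lemma pcf_kernel_nonneg:
  assumes "p < 1" "a > 0" "t > 0"
  shows "0 \<le> pcf_kernel p a t"
proof -
  have "0 \<le> pcf_D p (a / sqrt t)"
    unfolding pcf_D_eq [OF assms(1)] using assms by (intro less_imp_le pc_real_pos) auto
  then show ?thesis
    by (simp add: pcf_kernel_def)
qed

text \<open>Substitute w / sqrt t for the integration variable of \<open>pc_real\<close>. The
  explicit factor exp (- a^2 / (4 t)) and the factor exp (- x^2 / 4) of D_p at x = a / sqrt t
  multiply to exp (- a^2 / (2 t)), which is what completes the square to (a + w)^2 / (2 t). In the
  constant, sqrt (2 pi) undoes the normalization of the normal density and Gamma (1 - p) comes from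
  \<open>pc_fun\<close>.\<close>

lemma pcf_kernel_eq_nn_integral:
  assumes p: "p < 1" and a: "a > 0" and t: "t > 0"
  shows "ennreal (pcf_kernel p a t) =
    (\<integral>\<^sup>+w. ennreal (sqrt (2 * pi) / Gamma (1 - p) * (fp_kernel (a + w) t * w powr (- p))) * indicator {0<..} w \<partial>lborel)"
proof -
  define x s where "x = a / sqrt t" and "s = sqrt t"
  have s: "s > 0" "t = s\<^sup>2" using t by (auto simp: s_def)
  have x: "x > 0" using a t by (simp add: x_def)
  have G: "Gamma (1 - p) > 0" using p by (intro Gamma_real_pos) auto
  define C where "C = exp (- a\<^sup>2 / (4 * t)) * (exp (- (x\<^sup>2 / 4)) / Gamma (1 - p)) / t powr ((p + 1) / 2)"
  have C: "C \<ge> 0" unfolding C_def using G by simp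
  let ?f = "\<lambda>s::real. (x + s) * exp (- (s * x) - s\<^sup>2 / 2) * s powr (- p)"
  have "pcf_kernel p a t = C * (LINT s:{0<..}|lborel. ?f s)"
    by (simp add: pcf_kernel_def pcf_D_eq [OF p] pc_real_def C_def x_def)
  then have "ennreal (pcf_kernel p a t) = ennreal C * ennreal (LINT s:{0<..}|lborel. ?f s)"
    using C by (simp add: ennreal_mult')
  also have "ennreal (LINT s:{0<..}|lborel. ?f s) = (\<integral>\<^sup>+s. ennreal (indicator {0<..} s *\<^sub>R ?f s) \<partial>lborel)"
    unfolding set_lebesgue_integral_def
    using pc_real_integrable [OF p, of x] x unfolding set_integrable_def
    by (intro nn_integral_eq_integral [symmetric]) (auto simp: indicator_def)
  also have "\<dots> = ennreal \<bar>1 / s\<bar> * (\<integral>\<^sup>+w. ennreal (indicator {0<..} (0 + 1 / s * w) *\<^sub>R ?f (0 + 1 / s * w)) \<partial>lborel)"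
    using s by (intro nn_integral_real_affine) auto
  also have "ennreal C * \<dots> = (\<integral>\<^sup>+w. ennreal C * (ennreal (1 / s) * ennreal (indicator {0<..} (1 / s * w) *\<^sub>R ?f (1 / s * w))) \<partial>lborel)"
    using s by (simp add: nn_integral_cmult)
  also have "\<dots> = (\<integral>\<^sup>+w. ennreal (sqrt (2 * pi) / Gamma (1 - p) * (fp_kernel (a + w) t * w powr (- p))) * indicator {0<..} w \<partial>lborel)"
  proof (intro nn_integral_cong)
    fix w :: real
    show "ennreal C * (ennreal (1 / s) * ennreal (indicator {0<..} (1 / s * w) *\<^sub>R ?f (1 / s * w))) =
      ennreal (sqrt (2 * pi) / Gamma (1 - p) * (fp_kernel (a + w) t * w powr (- p))) * indicator {0<..} w"
    proof (cases "w > 0")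
      case True
      have f: "?f (1 / s * w) = (a + w) / s * exp (- (a * w / t) - w\<^sup>2 / (2 * t)) * (w powr (- p) * s powr p)"
      proof -
        have "x + 1 / s * w = (a + w) / s"
          by (simp add: x_def s_def add_divide_distrib)
        moreover have "- (1 / s * w * x) - (1 / s * w)\<^sup>2 / 2 = - (a * w / t) - w\<^sup>2 / (2 * t)"
          using s by (simp add: x_def s_def [symmetric] power2_eq_square mult_ac)
        moreover have "(1 / s * w) powr (- p) = w powr (- p) * s powr p"
          using s True by (simp add: powr_divide powr_minus_divide)
        ultimately show ?thesis by simp
      qed
      have C': "C = exp (- a\<^sup>2 / (2 * t)) / Gamma (1 - p) * (s powr (- p) / s)"
      proof -
        have "t powr ((p + 1) / 2) = s powr (p + 1)"
          using s by (simp add: powr_numeral [symmetric] powr_powr add_divide_distrib del: powr_numeral)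
        moreover have "exp (- a\<^sup>2 / (4 * t)) * exp (- (x\<^sup>2 / 4)) = exp (- a\<^sup>2 / (2 * t))"
          unfolding exp_add [symmetric] using t by (simp add: x_def power_divide field_simps)
        ultimately have "C = exp (- a\<^sup>2 / (2 * t)) / Gamma (1 - p) / s powr (p + 1)"
          unfolding C_def by (metis times_divide_eq_right)
        then show ?thesis
          using s by (simp add: powr_add powr_minus_divide)
      qed
      have e: "exp (- a\<^sup>2 / (2 * t)) * exp (- (a * w / t) - w\<^sup>2 / (2 * t)) = exp (- (a + w)\<^sup>2 / (2 * t))"
        unfolding exp_add [symmetric] using t by (simp add: power2_sum field_simps)
      have "C * (1 / s * ?f (1 / s * w)) =
         (s powr (- p) * s powr p) * ((exp (- a\<^sup>2 / (2 * t)) * exp (- (a * w / t) - w\<^sup>2 / (2 * t))) / Gamma (1 - p) * ((a + w) / (s * s * s)) * w powr (- p))"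
        unfolding f C' by (simp add: mult_ac)
      also have "s powr (- p) * s powr p = 1"
        using s by (simp add: powr_minus)
      also have "1 * ((exp (- a\<^sup>2 / (2 * t)) * exp (- (a * w / t) - w\<^sup>2 / (2 * t))) / Gamma (1 - p) * ((a + w) / (s * s * s)) * w powr (- p))
          = sqrt (2 * pi) / Gamma (1 - p) * (fp_kernel (a + w) t * w powr (- p))"
        unfolding e using t s(1) by (simp add: fp_kernel_pos_eq s_def)
      finally have "C * (1 / s * ?f (1 / s * w)) = sqrt (2 * pi) / Gamma (1 - p) * (fp_kernel (a + w) t * w powr (- p))" .
      then show ?thesis
        using True s C by (simp add: ennreal_mult' [symmetric])
    qed (use s in \<open>simp add: zero_less_divide_iff\<close>)
  qed
  finally show ?thesis .
qed

text \<open>Measurability is read off the mixture, an integral depending measurably on its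
  parameters. The indicator confines the claim to positive times, where the mixture formula
  holds.\<close>

lemma pcf_kernel_measurable:
  assumes [measurable]: "f \<in> borel_measurable M" "g \<in> borel_measurable M"
    and p: "p < 1" and f: "\<And>x. 0 < f x"
  shows "(\<lambda>x. ennreal (pcf_kernel p (f x) (g x)) * indicator {0<..} (g x)) \<in> borel_measurable M"
proof -
  have "(\<lambda>x. (\<integral>\<^sup>+w. ennreal (sqrt (2 * pi) / Gamma (1 - p) * (fp_kernel (f x + w) (g x) * w powr (- p))) * indicator {0<..} w \<partial>lborel) *
      indicator {0<..} (g x)) \<in> borel_measurable M"
    by measurable
  also have "?this \<longleftrightarrow> ?thesis"
    using p f by (intro measurable_cong) (auto simp: indicator_def pcf_kernel_eq_nn_integral)
  finally show ?thesis .
qed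

lemma nn_integral_powr_exp:
  assumes p: "p < 1" and \<alpha>: "\<alpha> > 0"
  shows "(\<integral>\<^sup>+w. ennreal (w powr (- p) * exp (- w * \<alpha>)) * indicator {0<..} w \<partial>lborel) =
    ennreal (Gamma (1 - p) * \<alpha> powr (p - 1))"
proof -
  let ?f = "\<lambda>x. ennreal (indicator {0<..} x *\<^sub>R (x powr (- p) * exp (- x)))"
  have "(\<integral>\<^sup>+x. ?f x \<partial>lborel) = ennreal (Gamma (1 - p))"
    using set_integrable_powr_exp [of "- p"] set_integral_powr_exp_Gamma [of "- p"] p
    unfolding set_lebesgue_integral_def set_integrable_def
    by (subst nn_integral_eq_integral) auto
  moreover have "(\<integral>\<^sup>+x. ?f x \<partial>lborel) = ennreal \<bar>\<alpha>\<bar> * (\<integral>\<^sup>+w. ?f (0 + \<alpha> * w) \<partial>lborel)"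
    using \<alpha> by (intro nn_integral_real_affine) auto
  moreover have "(\<integral>\<^sup>+w. ?f (0 + \<alpha> * w) \<partial>lborel) =
      (\<integral>\<^sup>+w. ennreal (\<alpha> powr (- p)) * (ennreal (w powr (- p) * exp (- w * \<alpha>)) * indicator {0<..} w) \<partial>lborel)"
  proof (intro nn_integral_cong)
    fix w :: real
    show "?f (0 + \<alpha> * w) = ennreal (\<alpha> powr (- p)) * (ennreal (w powr (- p) * exp (- w * \<alpha>)) * indicator {0<..} w)"
      using \<alpha> by (cases "w > 0") (auto simp: powr_mult ennreal_mult' [symmetric] zero_less_mult_iff mult_ac)
  qed
  ultimately have *: "ennreal (Gamma (1 - p)) = ennreal \<alpha> * (ennreal (\<alpha> powr (- p)) *
       (\<integral>\<^sup>+w. ennreal (w powr (- p) * exp (- w * \<alpha>)) * indicator {0<..} w \<partial>lborel))"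
    using \<alpha> by (simp add: nn_integral_cmult)
  have "ennreal (\<alpha> powr (p - 1)) * (ennreal \<alpha> * ennreal (\<alpha> powr (- p))) = 1"
  proof -
    have "\<alpha> powr (p - 1) * (\<alpha> * \<alpha> powr (- p)) = 1"
      using \<alpha> by (simp add: powr_diff powr_minus_divide)
    then show ?thesis
      using \<alpha> by (simp add: ennreal_mult' [symmetric])
  qed
  then have "(\<integral>\<^sup>+w. ennreal (w powr (- p) * exp (- w * \<alpha>)) * indicator {0<..} w \<partial>lborel)
     = ennreal (\<alpha> powr (p - 1)) * ennreal (Gamma (1 - p))"
    unfolding * by (simp add: mult.assoc [symmetric])
  then show ?thesis
    by (simp add: ennreal_mult'' mult.commute)
qed

text \<open>By Tonelli the transform acts on the first passage densities and gives exp (- (a + w)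
  \<alpha>) with \<alpha> = sqrt (2 \<beta>). The integral over w is then Gamma (1 - p) \<alpha>
  powr (p - 1), whose Gamma factor cancels that of the mixture. Only exp (- a \<alpha>) depends on
  a, so one prefactor serves all boundary points.\<close>

lemma laplace_pcf_kernel:
  assumes p: "p < 1" and a: "a > 0" and \<beta>: "\<beta> > 0"
  shows "(\<integral>\<^sup>+t. ennreal (exp (- \<beta> * t) * pcf_kernel p a t) * indicator {0<..} t \<partial>lborel) =
    ennreal (sqrt pi * 2 powr (p / 2) * \<beta> powr ((p - 1) / 2) * exp (- a * sqrt (2 * \<beta>)))"
proof -
  define \<alpha> where "\<alpha> = sqrt (2 * \<beta>)"
  have \<alpha>: "\<alpha> > 0" using \<beta> by (simp add: \<alpha>_def)
  define K where "K = sqrt (2 * pi) / Gamma (1 - p)"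
  have G: "Gamma (1 - p) > 0" using p by (intro Gamma_real_pos) auto
  have K: "K \<ge> 0" using G by (simp add: K_def)
  have "(\<integral>\<^sup>+t. ennreal (exp (- \<beta> * t) * pcf_kernel p a t) * indicator {0<..} t \<partial>lborel) =
     (\<integral>\<^sup>+t. (\<integral>\<^sup>+w. ennreal (K * w powr (- p)) * indicator {0<..} w *
        (ennreal (exp (- \<beta> * t) * fp_kernel (a + w) t) * indicator {0<..} t) \<partial>lborel) \<partial>lborel)"
  proof (intro nn_integral_cong)
    fix t :: real
    show "ennreal (exp (- \<beta> * t) * pcf_kernel p a t) * indicator {0<..} t =
      (\<integral>\<^sup>+w. ennreal (K * w powr (- p)) * indicator {0<..} w *
        (ennreal (exp (- \<beta> * t) * fp_kernel (a + w) t) * indicator {0<..} t) \<partial>lborel)"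
    proof (cases "t > 0")
      case True
      then have "ennreal (exp (- \<beta> * t) * pcf_kernel p a t) * indicator {0<..} t =
         (\<integral>\<^sup>+w. ennreal (exp (- \<beta> * t)) * (ennreal (K * (fp_kernel (a + w) t * w powr (- p))) * indicator {0<..} w) \<partial>lborel)"
        using p a by (simp add: ennreal_mult' pcf_kernel_eq_nn_integral K_def nn_integral_cmult)
      also have "\<dots> = (\<integral>\<^sup>+w. ennreal (K * w powr (- p)) * indicator {0<..} w *
        (ennreal (exp (- \<beta> * t) * fp_kernel (a + w) t) * indicator {0<..} t) \<partial>lborel)"
        using True a K
        by (intro nn_integral_cong) (auto simp: indicator_def ennreal_mult' [symmetric] fp_kernel_nonneg mult_ac)
      finally show ?thesis .
    qed simp
  qed
  also have "\<dots> = (\<integral>\<^sup>+w. (\<integral>\<^sup>+t. ennreal (K * w powr (- p)) * indicator {0<..} w *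
        (ennreal (exp (- \<beta> * t) * fp_kernel (a + w) t) * indicator {0<..} t) \<partial>lborel) \<partial>lborel)"
    by (rule lborel_pair.Fubini') measurable
  also have "\<dots> = (\<integral>\<^sup>+w. ennreal (K * w powr (- p)) * indicator {0<..} w * ennreal (exp (- (a + w) * \<alpha>)) \<partial>lborel)"
  proof (intro nn_integral_cong)
    fix w :: real
    show "(\<integral>\<^sup>+t. ennreal (K * w powr (- p)) * indicator {0<..} w *
        (ennreal (exp (- \<beta> * t) * fp_kernel (a + w) t) * indicator {0<..} t) \<partial>lborel) =
        ennreal (K * w powr (- p)) * indicator {0<..} w * ennreal (exp (- (a + w) * \<alpha>))"
      using a \<beta> laplace_fp_kernel [of "a + w" \<beta>]
      by (cases "w > 0") (simp_all add: nn_integral_cmult \<alpha>_def)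
  qed
  also have "\<dots> = (\<integral>\<^sup>+w. ennreal (K * exp (- a * \<alpha>)) * (ennreal (w powr (- p) * exp (- w * \<alpha>)) * indicator {0<..} w) \<partial>lborel)"
    using K by (intro nn_integral_cong) (auto simp: indicator_def ennreal_mult' [symmetric] exp_add [symmetric] algebra_simps)
  also have "\<dots> = ennreal (K * exp (- a * \<alpha>)) * ennreal (Gamma (1 - p) * \<alpha> powr (p - 1))"
    unfolding nn_integral_powr_exp [OF p \<alpha>, symmetric] by (rule nn_integral_cmult) measurable
  also have "\<dots> = ennreal (sqrt (2 * pi) * \<alpha> powr (p - 1) * exp (- a * \<alpha>))"
    using K G by (simp add: ennreal_mult' [symmetric] K_def mult_ac)
  \<comment> \<open>The factor sqrt 2 and the 2 powr ((p - 1) / 2) hidden in \<alpha> = sqrt (2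
    \<beta>) combine to 2 powr (p / 2).\<close>
  also have "sqrt (2 * pi) * \<alpha> powr (p - 1) = sqrt pi * 2 powr (p / 2) * \<beta> powr ((p - 1) / 2)"
  proof -
    have "\<alpha> powr (p - 1) = 2 powr ((p - 1) / 2) * \<beta> powr ((p - 1) / 2)"
      using \<beta> by (simp add: \<alpha>_def powr_half_sqrt [symmetric] powr_powr powr_mult)
    moreover have "sqrt 2 * 2 powr ((p - 1) / 2) = 2 powr (p / 2)"
      by (simp add: powr_half_sqrt [symmetric] powr_add [symmetric] add_divide_distrib [symmetric])
    ultimately show ?thesis
      by (simp add: real_sqrt_mult)
  qed
  finally show ?thesis
    by (simp add: \<alpha>_def)
qed

section \<open>From the distribution of the endpoint to the integral equations\<close>

text \<open>This stands in for differentiation in y. Truncated at d < c, both functions are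
  densities of finite measures with equal distribution functions; the measures then agree, and
  densities are unique almost everywhere.\<close>

lemma AE_eq_if_nn_integral_atMost_eq:
  fixes f g :: "real \<Rightarrow> ennreal"
  assumes [measurable]: "f \<in> borel_measurable borel" "g \<in> borel_measurable borel"
    and eq: "\<And>y. y < c \<Longrightarrow> (\<integral>\<^sup>+x. f x * indicator {..y} x \<partial>lborel) = (\<integral>\<^sup>+x. g x * indicator {..y} x \<partial>lborel)"
    and fin: "\<And>y. y < c \<Longrightarrow> (\<integral>\<^sup>+x. g x * indicator {..y} x \<partial>lborel) < \<infinity>"
  shows "AE x in lborel. x < c \<longrightarrow> f x = g x"
proof -
  have "AE x in lborel. x \<le> d \<longrightarrow> f x = g x" if d: "d < c" for d
  proof -
    let ?F = "density lborel (\<lambda>x. f x * indicator {..d} x)"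
    let ?G = "density lborel (\<lambda>x. g x * indicator {..d} x)"
    have e: "emeasure (density lborel (\<lambda>x. h x * indicator {..d} x)) {..y} =
        (\<integral>\<^sup>+x. h x * indicator {..min d y} x \<partial>lborel)"
      if [measurable]: "h \<in> borel_measurable borel" for h :: "real \<Rightarrow> ennreal" and y
      by (subst emeasure_density) (auto intro!: nn_integral_cong simp: indicator_def)
    have U: "emeasure (density lborel (\<lambda>x. h x * indicator {..d} x)) UNIV =
        (\<integral>\<^sup>+x. h x * indicator {..d} x \<partial>lborel)"
      if [measurable]: "h \<in> borel_measurable borel" for h :: "real \<Rightarrow> ennreal"
      by (subst emeasure_density) auto
    have fb: "finite_borel_measure ?F" "finite_borel_measure ?G"
      using eq [OF d] fin [OF d] U [of f] U [of g]
      by (auto intro!: finite_borel_measure.intro finite_measureI finite_borel_measure_axioms.intro)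
    have "?F = ?G"
    proof (rule cdf_unique' [OF fb])
      have "measure ?F {..y} = measure ?G {..y}" for y
        unfolding measure_def using d by (simp add: e eq)
      then show "cdf ?F = cdf ?G"
        by (simp add: cdf_def fun_eq_iff)
    qed
    then have "AE x in lborel. f x * indicator {..d} x = g x * indicator {..d} x"
      by (subst (asm) sigma_finite_measure.density_unique_iff [OF lborel.sigma_finite_measure_axioms]) auto
    then show ?thesis
      by eventually_elim (auto simp: indicator_def split: if_splits)
  qed
  \<comment> \<open>The countably many truncation points c - 1 / (n + 1) exhaust the levels below c,
    with a single null set.\<close>
  then have "AE x in lborel. \<forall>n::nat. x \<le> c - 1 / Suc n \<longrightarrow> f x = g x"
    unfolding AE_all_countable by simp
  then show ?thesis
  proof eventually_elim
    case (elim x)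
    show ?case
    proof
      assume "x < c"
      then obtain n where "inverse (real (Suc n)) < c - x"
        using reals_Archimedean [of "c - x"] by auto
      then have "x \<le> c - 1 / Suc n"
        by (simp add: inverse_eq_divide)
      with elim show "f x = g x" by blast
    qed
  qed
qed

text \<open>One comparison of integrands leaves a null set of levels, but the next one starts from
  an equation at every level. Points of equality are dense below c, and a monotone f is squeezed at
  x between its values at such points on either side, whose common limit is h x.\<close>

lemma mono_AE_eq_continuous_imp_eq:
  fixes f :: "real \<Rightarrow> ennreal" and h :: "real \<Rightarrow> real"
  assumes mono: "\<And>x y. x \<le> y \<Longrightarrow> f x \<le> f y"
    and cont: "\<And>x. isCont h x"
    and AE: "AE x in lborel. x < c \<longrightarrow> f x = ennreal (h x)"
    and x: "x < c"
  shows "f x = ennreal (h x)"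
proof -
  have dense: "\<exists>y. a < y \<and> y < e \<and> f y = ennreal (h y)" if "a < e" "e \<le> c" for a e
  proof (rule ccontr)
    assume "\<not> ?thesis"
    then have "AE y in lborel. y \<notin> {a<..<e}"
      using AE that by (auto elim!: eventually_mono)
    then have "emeasure lborel {a<..<e} = 0"
      by (subst (asm) AE_iff_measurable [OF _ refl]) (auto simp: greaterThanLessThan_def greaterThan_def lessThan_def Int_def)
    then show False
      using that by simp
  qed
  have lim: "(\<lambda>n. ennreal (h (s n))) \<longlonglongrightarrow> ennreal (h x)" if "s \<longlonglongrightarrow> x" for s
    using isCont_tendsto_compose [OF cont that] by (intro tendsto_ennrealI)
  \<comment> \<open>The widths tend to 0 and keep the right-hand neighbourhoods of x below
    c.\<close>
  define e where "e = (\<lambda>n::nat. (c - x) / Suc n)"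
  have e: "e n > 0" "x + e n \<le> c" for n
    using x by (auto simp: e_def field_simps intro: mult_right_mono)
  have e0: "e \<longlonglongrightarrow> 0"
    unfolding e_def by real_asymp
  have "\<forall>n. \<exists>y. x < y \<and> y < x + e n \<and> f y = ennreal (h y)"
    using dense e by simp
  then obtain s where s: "\<And>n. x < s n" "\<And>n. s n < x + e n" "\<And>n. f (s n) = ennreal (h (s n))"
    by metis
  have "s \<longlonglongrightarrow> x"
    by (rule tendsto_sandwich [of "\<lambda>_. x" _ _ "\<lambda>n. x + e n"])
      (use s e0 in \<open>auto intro!: tendsto_eq_intros always_eventually less_imp_le\<close>)
  from lim [OF this] have 1: "f x \<le> ennreal (h x)"
    by (rule tendsto_lowerbound) (auto intro!: always_eventually mono less_imp_le [OF s(1)] simp flip: s(3))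
  have "\<forall>n. \<exists>y. x - e n < y \<and> y < x \<and> f y = ennreal (h y)"
    using dense e x by simp
  then obtain s where s: "\<And>n. x - e n < s n" "\<And>n. s n < x" "\<And>n. f (s n) = ennreal (h (s n))"
    by metis
  have "s \<longlonglongrightarrow> x"
    by (rule tendsto_sandwich [of "\<lambda>n. x - e n" _ _ "\<lambda>_. x"])
      (use s e0 in \<open>auto intro!: tendsto_eq_intros always_eventually less_imp_le\<close>)
  from lim [OF this] have 2: "ennreal (h x) \<le> f x"
    by (rule tendsto_upperbound) (auto intro!: always_eventually mono less_imp_le [OF s(2)] simp flip: s(3))
  from 1 2 show ?thesis by simp
qed

text \<open>N stands for the law of the hitting time without its mass at infinity, so only
  finiteness is assumed; total mass 1 is \<open>fredholm\<close> at \<alpha> = 0. Brownian motion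
  enters through \<open>pos\<close> and \<open>cdf_eq\<close> alone, the latter being the stopped
  martingale identity. Its indicator excludes s = T, where the stopped value is 0 because b(T) > c
  \<ge> y.\<close>

locale first_passage_law = finite_borel_measure N for N :: "real measure" +
  fixes b :: "real \<Rightarrow> real" and c :: real
  assumes b_measurable [measurable]: "b \<in> borel_measurable borel"
    and b_gt: "\<And>s. c < b s"
    and c_neg: "c < 0"
    and pos: "AE s in N. 0 < s"
    and cdf_eq: "\<And>T y. 0 < T \<Longrightarrow> y \<le> c \<Longrightarrow>
      (\<integral>\<^sup>+s. (\<integral>\<^sup>+x. ennreal (normal_density (b s) (sqrt (T - s)) x) * indicator {..y} x \<partial>lborel) * indicator {..<T} s \<partial>N) =
      (\<integral>\<^sup>+x. ennreal (normal_density 0 (sqrt T) x) * indicator {..y} x \<partial>lborel)"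
begin

lemma sets_N [measurable_cong]: "sets N = sets borel"
  using M_is_borel by simp

interpretation NL: pair_sigma_finite N lborel
  by unfold_locales

text \<open>The first differentiation of \<open>cdf_eq\<close> in y: by Tonelli its left side is the
  integral over {..y} of the mixed density, so the two densities have equal integrals over all
  half-lines below c.\<close>

lemma normal_density_equation:
  assumes T: "0 < T"
  shows "AE x in lborel. x < c \<longrightarrow>
    (\<integral>\<^sup>+s. ennreal (normal_density (b s) (sqrt (T - s)) x) * indicator {..<T} s \<partial>N) =
    ennreal (normal_density 0 (sqrt T) x)"
proof (rule AE_eq_if_nn_integral_atMost_eq)
  fix y assume y: "y < c"
  have "(\<integral>\<^sup>+x. (\<integral>\<^sup>+s. ennreal (normal_density (b s) (sqrt (T - s)) x) * indicator {..<T} s \<partial>N) * indicator {..y} x \<partial>lborel) =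
    (\<integral>\<^sup>+x. (\<integral>\<^sup>+s. ennreal (normal_density (b s) (sqrt (T - s)) x) * indicator {..<T} s * indicator {..y} x \<partial>N) \<partial>lborel)"
    by (intro nn_integral_cong nn_integral_multc [symmetric]) measurable
  also have "\<dots> = (\<integral>\<^sup>+s. (\<integral>\<^sup>+x. ennreal (normal_density (b s) (sqrt (T - s)) x) * indicator {..<T} s * indicator {..y} x \<partial>lborel) \<partial>N)"
    by (rule NL.Fubini') measurable
  also have "\<dots> = (\<integral>\<^sup>+s. (\<integral>\<^sup>+x. ennreal (normal_density (b s) (sqrt (T - s)) x) * indicator {..y} x \<partial>lborel) * indicator {..<T} s \<partial>N)"
    by (intro nn_integral_cong) (auto simp: indicator_def)
  also have "\<dots> = (\<integral>\<^sup>+x. ennreal (normal_density 0 (sqrt T) x) * indicator {..y} x \<partial>lborel)"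
    using T y by (intro cdf_eq) auto
  finally show "(\<integral>\<^sup>+x. (\<integral>\<^sup>+s. ennreal (normal_density (b s) (sqrt (T - s)) x) * indicator {..<T} s \<partial>N) * indicator {..y} x \<partial>lborel) =
    (\<integral>\<^sup>+x. ennreal (normal_density 0 (sqrt T) x) * indicator {..y} x \<partial>lborel)" .
  have "(\<integral>\<^sup>+x. ennreal (normal_density 0 (sqrt T) x) * indicator {..y} x \<partial>lborel) \<le>
     (\<integral>\<^sup>+x. ennreal (normal_density 0 (sqrt T) x) \<partial>lborel)"
    by (intro nn_integral_mono) (auto simp: indicator_def)
  also have "\<dots> = 1"
    using prob_space.emeasure_space_1 [OF prob_space_normal_density, of "sqrt T" 0] T
    by (simp add: emeasure_density)
  finally show "(\<integral>\<^sup>+x. ennreal (normal_density 0 (sqrt T) x) * indicator {..y} x \<partial>lborel) < \<infinity>"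
    by (simp add: le_less_trans)
qed measurable

text \<open>The second differentiation: by \<open>nn_integral_fp_kernel\<close> both sides integrate
  over {..y} to the sides of the density equation. That equation is known for almost every y only,
  but its left side, being such an integral, is monotone in y, and its right side is continuous;
  hence it holds for every y < c.\<close>

lemma fp_kernel_equation:
  assumes T: "0 < T"
  shows "AE x in lborel. x < c \<longrightarrow>
    (\<integral>\<^sup>+s. ennreal (fp_kernel (b s - x) (T - s)) * indicator {..<T} s \<partial>N) = ennreal (fp_kernel (- x) T)"
proof (rule AE_eq_if_nn_integral_atMost_eq)
  define G where "G = (\<lambda>x. \<integral>\<^sup>+s. ennreal (fp_kernel (b s - x) (T - s)) * indicator {..<T} s \<partial>N)"
  have G: "(\<integral>\<^sup>+x. G x * indicator {..y} x \<partial>lborel) =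
     (\<integral>\<^sup>+s. ennreal (normal_density (b s) (sqrt (T - s)) y) * indicator {..<T} s \<partial>N)" if y: "y < c" for y
  proof -
    have "(\<integral>\<^sup>+x. G x * indicator {..y} x \<partial>lborel) =
       (\<integral>\<^sup>+x. (\<integral>\<^sup>+s. ennreal (fp_kernel (b s - x) (T - s)) * indicator {..<T} s * indicator {..y} x \<partial>N) \<partial>lborel)"
      unfolding G_def by (intro nn_integral_cong nn_integral_multc [symmetric]) measurable
    also have "\<dots> = (\<integral>\<^sup>+s. (\<integral>\<^sup>+x. ennreal (fp_kernel (b s - x) (T - s)) * indicator {..<T} s * indicator {..y} x \<partial>lborel) \<partial>N)"
      by (rule NL.Fubini') measurable
    also have "\<dots> = (\<integral>\<^sup>+s. ennreal (normal_density (b s) (sqrt (T - s)) y) * indicator {..<T} s \<partial>N)"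
    proof (intro nn_integral_cong)
      fix s
      have "y \<le> b s" using b_gt [of s] y by simp
      then show "(\<integral>\<^sup>+x. ennreal (fp_kernel (b s - x) (T - s)) * indicator {..<T} s * indicator {..y} x \<partial>lborel) =
        ennreal (normal_density (b s) (sqrt (T - s)) y) * indicator {..<T} s"
        using nn_integral_fp_kernel [of "T - s" y "b s"] by (cases "s < T") auto
    qed
    finally show ?thesis .
  qed
  have R: "(\<integral>\<^sup>+x. ennreal (fp_kernel (- x) T) * indicator {..y} x \<partial>lborel) = ennreal (normal_density 0 (sqrt T) y)"
    if "y < c" for y
    using nn_integral_fp_kernel [of T y 0] T that c_neg by simp
  fix y assume y: "y < c"
  have "(\<integral>\<^sup>+x. G x * indicator {..y} x \<partial>lborel) = ennreal (normal_density 0 (sqrt T) y)"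
  proof (rule mono_AE_eq_continuous_imp_eq [OF _ _ _ y])
    show "(\<integral>\<^sup>+x. G x * indicator {..y} x \<partial>lborel) \<le> (\<integral>\<^sup>+x. G x * indicator {..z} x \<partial>lborel)" if "y \<le> z" for y z
      using that by (intro nn_integral_mono) (auto simp: indicator_def)
    show "isCont (normal_density 0 (sqrt T)) x" for x
      unfolding normal_density_def using T by (auto intro!: continuous_intros)
    show "AE x in lborel. x < c \<longrightarrow> (\<integral>\<^sup>+z. G z * indicator {..x} z \<partial>lborel) = ennreal (normal_density 0 (sqrt T) x)"
      using normal_density_equation [OF T] by eventually_elim (simp add: G)
  qed
  then show "(\<integral>\<^sup>+x. (\<integral>\<^sup>+s. ennreal (fp_kernel (b s - x) (T - s)) * indicator {..<T} s \<partial>N) * indicator {..y} x \<partial>lborel) =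
      (\<integral>\<^sup>+x. ennreal (fp_kernel (- x) T) * indicator {..y} x \<partial>lborel)"
    using R [OF y] by (simp add: G_def)
  show "(\<integral>\<^sup>+x. ennreal (fp_kernel (- x) T) * indicator {..y} x \<partial>lborel) < \<infinity>"
    using R [OF y] by simp
qed measurable

text \<open>Put x = y - w in the equation for \<open>fp_kernel\<close> and integrate against w powr
  (- p). Since w > 0, all these levels lie below c even when y = c, and the null set of bad levels
  does not affect the integral; so the result holds for every t and y.\<close>

lemma volterra_nn:
  assumes t: "0 < t" and p: "p < 1" and y: "y \<le> c"
  shows "(\<integral>\<^sup>+s. ennreal (pcf_kernel p (b s - y) (t - s)) * indicator {..<t} s \<partial>N) = ennreal (pcf_kernel p (- y) t)"
proof -
  define K where "K = sqrt (2 * pi) / Gamma (1 - p)"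
  have K: "K \<ge> 0" unfolding K_def using Gamma_real_pos [of "1 - p"] p by simp
  have pos_arg: "b s - y > 0" for s using b_gt [of s] y by simp
  have "(\<integral>\<^sup>+s. ennreal (pcf_kernel p (b s - y) (t - s)) * indicator {..<t} s \<partial>N) =
    (\<integral>\<^sup>+s. (\<integral>\<^sup>+w. ennreal (K * w powr (- p)) * indicator {0<..} w * (ennreal (fp_kernel (b s - y + w) (t - s)) * indicator {..<t} s) \<partial>lborel) \<partial>N)"
  proof (intro nn_integral_cong)
    fix s
    show "ennreal (pcf_kernel p (b s - y) (t - s)) * indicator {..<t} s =
      (\<integral>\<^sup>+w. ennreal (K * w powr (- p)) * indicator {0<..} w * (ennreal (fp_kernel (b s - y + w) (t - s)) * indicator {..<t} s) \<partial>lborel)"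
    proof (cases "s < t")
      case True
      then have "ennreal (pcf_kernel p (b s - y) (t - s)) =
         (\<integral>\<^sup>+w. ennreal (K * (fp_kernel (b s - y + w) (t - s) * w powr (- p))) * indicator {0<..} w \<partial>lborel)"
        unfolding K_def using pos_arg [of s] p by (intro pcf_kernel_eq_nn_integral) auto
      also have "\<dots> = (\<integral>\<^sup>+w. ennreal (K * w powr (- p)) * indicator {0<..} w * (ennreal (fp_kernel (b s - y + w) (t - s)) * indicator {..<t} s) \<partial>lborel)"
        using True K pos_arg [of s]
        by (intro nn_integral_cong) (auto simp: indicator_def ennreal_mult' [symmetric] mult_ac)
      finally show ?thesis using True by simp
    qed simp
  qed
  also have "\<dots> = (\<integral>\<^sup>+w. (\<integral>\<^sup>+s. ennreal (K * w powr (- p)) * indicator {0<..} w * (ennreal (fp_kernel (b s - y + w) (t - s)) * indicator {..<t} s) \<partial>N) \<partial>lborel)"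
    by (rule NL.Fubini' [symmetric]) measurable
  also have "\<dots> = (\<integral>\<^sup>+w. ennreal (K * w powr (- p)) * indicator {0<..} w * (\<integral>\<^sup>+s. ennreal (fp_kernel (b s - y + w) (t - s)) * indicator {..<t} s \<partial>N) \<partial>lborel)"
    by (intro nn_integral_cong nn_integral_cmult) measurable
  also have "\<dots> = (\<integral>\<^sup>+w. ennreal (K * w powr (- p)) * indicator {0<..} w * ennreal (fp_kernel (- y + w) t) \<partial>lborel)"
  proof (rule nn_integral_cong_AE)
    \<comment> \<open>Lebesgue measure is invariant under the reflection sending w to y - w, so the
      null set of levels x becomes a null set of w.\<close>
    have "AE x in distr lborel borel (\<lambda>w. y + - 1 * w). x < c \<longrightarrow>
      (\<integral>\<^sup>+s. ennreal (fp_kernel (b s - x) (t - s)) * indicator {..<t} s \<partial>N) = ennreal (fp_kernel (- x) t)"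
    proof -
      have "distr lborel borel (\<lambda>w. y + - 1 * w) = lborel"
        using lborel_real_affine [of "- 1" y] by (simp add: density_1 one_ennreal_def [symmetric])
      then show ?thesis
        using fp_kernel_equation [OF t] by (simp only:)
    qed
    then have "AE w in lborel. y + - 1 * w < c \<longrightarrow>
      (\<integral>\<^sup>+s. ennreal (fp_kernel (b s - (y + - 1 * w)) (t - s)) * indicator {..<t} s \<partial>N) = ennreal (fp_kernel (- (y + - 1 * w)) t)"
      by (subst (asm) AE_distr_iff) measurable
    then show "AE w in lborel. ennreal (K * w powr (- p)) * indicator {0<..} w * (\<integral>\<^sup>+s. ennreal (fp_kernel (b s - y + w) (t - s)) * indicator {..<t} s \<partial>N) =
      ennreal (K * w powr (- p)) * indicator {0<..} w * ennreal (fp_kernel (- y + w) t)"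
      by eventually_elim (use y in \<open>auto simp: indicator_def algebra_simps\<close>)
  qed
  also have "\<dots> = (\<integral>\<^sup>+w. ennreal (K * (fp_kernel (- y + w) t * w powr (- p))) * indicator {0<..} w \<partial>lborel)"
    using K y c_neg t
    by (intro nn_integral_cong) (auto simp: indicator_def ennreal_mult' [symmetric] fp_kernel_nonneg mult_ac)
  also have "\<dots> = ennreal (pcf_kernel p (- y) t)"
    unfolding K_def using p y c_neg t by (intro pcf_kernel_eq_nn_integral [symmetric]) auto
  finally show ?thesis .
qed

text \<open>Take the Laplace transform at \<beta> = \<alpha>^2 / 2 of the Volterra equation for p =
  0 and y = c; any other admissible pair would serve. By \<open>laplace_pcf_kernel\<close> both
  sides carry the finite positive factor C exp (c \<alpha>), which cancels.\<close>

lemma fredholm_nn: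
  assumes \<alpha>: "0 < \<alpha>"
  shows "(\<integral>\<^sup>+s. ennreal (exp (- \<alpha> * b s - \<alpha>\<^sup>2 * s / 2)) \<partial>N) = 1"
proof -
  define \<beta> where "\<beta> = \<alpha>\<^sup>2 / 2"
  have \<beta>: "\<beta> > 0" and sq: "sqrt (2 * \<beta>) = \<alpha>"
    using \<alpha> by (auto simp: \<beta>_def)
  define C where "C = sqrt pi * 2 powr (0 / 2) * \<beta> powr ((0 - 1) / 2)"
  have C: "C > 0" using \<beta> by (simp add: C_def)
  have pos_arg: "b s - c > 0" for s using b_gt [of s] by simp
  let ?H = "\<lambda>s t. ennreal (pcf_kernel 0 (b s - c) (t - s)) * indicator {0<..} (t - s)"
  have H [measurable]: "(\<lambda>z. ennreal (pcf_kernel 0 (b (g z) - c) (f z - g z)) * indicator {0<..} (f z - g z)) \<in> borel_measurable M"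
    if [measurable]: "f \<in> borel_measurable M" "g \<in> borel_measurable M" for f g and M :: "'b measure"
    using pos_arg by (intro pcf_kernel_measurable) auto
  have m1 [measurable]: "(\<lambda>z. ?H (fst z) (snd z)) \<in> borel_measurable (N \<Otimes>\<^sub>M lborel)"
    by (rule H) measurable
  have m2 [measurable]: "(\<lambda>z. ?H (snd z) (fst z)) \<in> borel_measurable (lborel \<Otimes>\<^sub>M N)"
    by (rule H) measurable
  have "ennreal (C * exp (c * \<alpha>)) = (\<integral>\<^sup>+t. ennreal (exp (- \<beta> * t) * pcf_kernel 0 (- c) t) * indicator {0<..} t \<partial>lborel)"
    using laplace_pcf_kernel [of 0 "- c" \<beta>] c_neg \<beta> sq by (simp add: C_def)
  also have "\<dots> = (\<integral>\<^sup>+t. (\<integral>\<^sup>+s. ennreal (exp (- \<beta> * t)) * indicator {0<..} t * ?H s t \<partial>N) \<partial>lborel)"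
  proof (intro nn_integral_cong)
    fix t :: real
    have [measurable]: "(\<lambda>s. ?H s t) \<in> borel_measurable N"
      by (rule H) measurable
    show "ennreal (exp (- \<beta> * t) * pcf_kernel 0 (- c) t) * indicator {0<..} t =
       (\<integral>\<^sup>+s. ennreal (exp (- \<beta> * t)) * indicator {0<..} t * ?H s t \<partial>N)"
    proof (cases "t > 0")
      case True
      have "(\<integral>\<^sup>+s. ?H s t \<partial>N) = (\<integral>\<^sup>+s. ennreal (pcf_kernel 0 (b s - c) (t - s)) * indicator {..<t} s \<partial>N)"
        by (intro nn_integral_cong) (auto simp: indicator_def)
      with True volterra_nn [of t 0 c] show ?thesis
        by (simp add: nn_integral_cmult ennreal_mult')
    qed simp
  qed
  also have "\<dots> = (\<integral>\<^sup>+s. (\<integral>\<^sup>+t. ennreal (exp (- \<beta> * t)) * indicator {0<..} t * ?H s t \<partial>lborel) \<partial>N)"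
    by (rule NL.Fubini') (unfold split_beta', measurable)
  also have "\<dots> = (\<integral>\<^sup>+s. ennreal (C * exp (c * \<alpha>)) * ennreal (exp (- \<alpha> * b s - \<alpha>\<^sup>2 * s / 2)) \<partial>N)"
  \<comment> \<open>Shifting time by s leaves exp (- \<beta> s) times the transform of the kernel.
    Because s > 0 almost everywhere, the condition t > 0 is implied by t - s > 0 and
    disappears.\<close>
  proof (rule nn_integral_cong_AE, use pos in eventually_elim)
    fix s :: real assume s: "0 < s"
    have [measurable]: "(\<lambda>t. ?H s t) \<in> borel_measurable borel"
      by (rule H) measurable
    have [measurable]: "(\<lambda>t. ennreal (pcf_kernel 0 (b s - c) t) * indicator {0<..} t) \<in> borel_measurable borel"
      using pos_arg by (intro pcf_kernel_measurable) auto
    have "(\<integral>\<^sup>+t. ennreal (exp (- \<beta> * t)) * indicator {0<..} t * ?H s t \<partial>lborel) =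
       ennreal \<bar>1\<bar> * (\<integral>\<^sup>+t. ennreal (exp (- \<beta> * (s + 1 * t))) * indicator {0<..} (s + 1 * t) * ?H s (s + 1 * t) \<partial>lborel)"
      by (rule nn_integral_real_affine) auto
    also have "\<dots> = (\<integral>\<^sup>+t. ennreal (exp (- \<beta> * s)) * (ennreal (exp (- \<beta> * t)) * (ennreal (pcf_kernel 0 (b s - c) t) * indicator {0<..} t)) \<partial>lborel)"
    proof -
      have "exp (- \<beta> * (s + t)) = exp (- \<beta> * s) * exp (- \<beta> * t)" for t
        by (simp add: exp_add [symmetric] algebra_simps)
      then show ?thesis
        using s by (auto intro!: nn_integral_cong simp: indicator_def ennreal_mult' mult.assoc)
    qed
    also have "\<dots> = ennreal (exp (- \<beta> * s)) * (\<integral>\<^sup>+t. ennreal (exp (- \<beta> * t)) * (ennreal (pcf_kernel 0 (b s - c) t) * indicator {0<..} t) \<partial>lborel)"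
      by (rule nn_integral_cmult) measurable
    also have "(\<integral>\<^sup>+t. ennreal (exp (- \<beta> * t)) * (ennreal (pcf_kernel 0 (b s - c) t) * indicator {0<..} t) \<partial>lborel) =
       ennreal (C * exp (- (b s - c) * \<alpha>))"
      using laplace_pcf_kernel [of 0 "b s - c" \<beta>] pos_arg [of s] \<beta> sq
      by (simp add: C_def ennreal_mult' mult.assoc)
    also have "ennreal (exp (- \<beta> * s)) * ennreal (C * exp (- (b s - c) * \<alpha>)) =
       ennreal (C * exp (c * \<alpha>)) * ennreal (exp (- \<alpha> * b s - \<alpha>\<^sup>2 * s / 2))"
    proof -
      have "exp (- \<beta> * s) * exp (- (b s - c) * \<alpha>) = exp (c * \<alpha>) * exp (- \<alpha> * b s - \<alpha>\<^sup>2 * s / 2)"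
        unfolding exp_add [symmetric] by (simp add: \<beta>_def algebra_simps)
      then have "exp (- \<beta> * s) * (C * exp (- (b s - c) * \<alpha>)) = C * exp (c * \<alpha>) * exp (- \<alpha> * b s - \<alpha>\<^sup>2 * s / 2)"
        by (simp add: mult.left_commute mult.assoc)
      then have "ennreal (exp (- \<beta> * s) * (C * exp (- (b s - c) * \<alpha>))) =
          ennreal (C * exp (c * \<alpha>) * exp (- \<alpha> * b s - \<alpha>\<^sup>2 * s / 2))"
        by (simp only:)
      then show ?thesis
        using less_imp_le [OF C] by (simp only: ennreal_mult' exp_ge_zero mult_nonneg_nonneg)
    qed
    finally show "(\<integral>\<^sup>+t. ennreal (exp (- \<beta> * t)) * indicator {0<..} t * ?H s t \<partial>lborel) =
      ennreal (C * exp (c * \<alpha>)) * ennreal (exp (- \<alpha> * b s - \<alpha>\<^sup>2 * s / 2))" .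
  qed
  also have "\<dots> = ennreal (C * exp (c * \<alpha>)) * (\<integral>\<^sup>+s. ennreal (exp (- \<alpha> * b s - \<alpha>\<^sup>2 * s / 2)) \<partial>N)"
    by (rule nn_integral_cmult) measurable
  finally have "ennreal (C * exp (c * \<alpha>)) * 1 = ennreal (C * exp (c * \<alpha>)) * (\<integral>\<^sup>+s. ennreal (exp (- \<alpha> * b s - \<alpha>\<^sup>2 * s / 2)) \<partial>N)"
    by simp
  then show ?thesis
    using C by (subst (asm) ennreal_mult_cancel_left) auto
qed

lemma fredholm:
  assumes "0 \<le> \<alpha>"
  shows "(LINT s:{0..}|N. exp (- \<alpha> * b s - \<alpha>\<^sup>2 * s / 2)) = 1"
proof -
  have *: "(LINT s|N. exp (- \<alpha> * b s - \<alpha>\<^sup>2 * s / 2)) = 1" if "0 < \<alpha>" for \<alpha>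
    using fredholm_nn [OF that] by (subst integral_eq_nn_integral) auto
  have "(LINT s|N. exp (- \<alpha> * b s - \<alpha>\<^sup>2 * s / 2)) = 1"
  proof (cases "\<alpha> = 0")
    case True
    define a where "a = (\<lambda>n::nat. 1 / real (Suc n))"
    have a: "0 < a n" "a n \<le> 1" for n by (auto simp: a_def)
    have a0: "a \<longlonglongrightarrow> 0" unfolding a_def by real_asymp
    \<comment> \<open>The bound exp (- c) works because s > 0 gives the quadratic term the right
      sign, and a n b s \<ge> a n c \<ge> c by 0 < a n \<le> 1 and c < 0. The limit is the total
      mass of N.\<close>
    have "(\<lambda>n. LINT s|N. exp (- a n * b s - (a n)\<^sup>2 * s / 2)) \<longlonglongrightarrow> (LINT s|N. 1)"
    proof (rule integral_dominated_convergence [where w = "\<lambda>_. exp (- c)"])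
      show "AE s in N. (\<lambda>n. exp (- a n * b s - (a n)\<^sup>2 * s / 2)) \<longlonglongrightarrow> 1"
        using a0 by (intro AE_I2) (auto intro!: tendsto_eq_intros)
      show "AE s in N. norm (exp (- a n * b s - (a n)\<^sup>2 * s / 2)) \<le> exp (- c)" for n
        using pos
      proof eventually_elim
        case (elim s)
        have "a n * c \<le> a n * b s"
          using a(1) [of n] b_gt [of s] by simp
        moreover have "a n * c \<ge> c"
          using a [of n] c_neg by (simp add: mult_le_cancel_right1)
        moreover have "0 \<le> (a n)\<^sup>2 * s / 2"
          using elim by simp
        ultimately have "- a n * b s - (a n)\<^sup>2 * s / 2 \<le> - c"
          by simp
        then show ?case by simp
      qed
    qed auto
    moreover have "(LINT s|N. exp (- a n * b s - (a n)\<^sup>2 * s / 2)) = 1" for n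
      using * a by blast
    ultimately have "(LINT s|N. 1) = (1::real)"
      by (simp only: LIMSEQ_const_iff)
    with True show ?thesis by simp
  qed (use * assms in auto)
  also have "(LINT s|N. exp (- \<alpha> * b s - \<alpha>\<^sup>2 * s / 2)) = (LINT s:{0..}|N. exp (- \<alpha> * b s - \<alpha>\<^sup>2 * s / 2))"
    unfolding set_lebesgue_integral_def
    by (intro integral_cong_AE) (use pos in \<open>auto elim!: eventually_mono\<close>)
  finally show ?thesis .
qed

lemma volterra:
  assumes t: "0 < t" and p: "p < 1" and y: "y \<le> c"
  shows "(LINT s:{0..t}|N. (if s < t then pcf_kernel p (b s - y) (t - s) else 0)) = pcf_kernel p (- y) t"
proof -
  have pos_arg: "b s - y > 0" for s using b_gt [of s] y by simp
  let ?f = "\<lambda>s. if s < t then pcf_kernel p (b s - y) (t - s) else 0"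
  have nonneg: "0 \<le> ?f s" for s
    using pcf_kernel_nonneg [OF p pos_arg] by simp
  have eq: "ennreal (pcf_kernel p (b s - y) (t - s)) * indicator {0<..} (t - s) = ennreal (?f s)" for s
    by (auto simp: indicator_def)
  have "(\<lambda>s. ennreal (pcf_kernel p (b s - y) (t - s)) * indicator {0<..} (t - s)) \<in> borel_measurable N"
    by (rule pcf_kernel_measurable) (use p pos_arg in auto)
  then have "(\<lambda>s. enn2real (ennreal (?f s))) \<in> borel_measurable N"
    unfolding eq by measurable
  then have [measurable]: "?f \<in> borel_measurable N"
    using nonneg by simp
  have "(LINT s:{0..t}|N. ?f s) = (LINT s|N. ?f s)"
    unfolding set_lebesgue_integral_def
    by (intro integral_cong_AE) (use pos in \<open>auto elim!: eventually_mono simp: indicator_def\<close>)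
  also have "\<dots> = enn2real (\<integral>\<^sup>+s. ennreal (?f s) \<partial>N)"
    using nonneg by (intro integral_eq_nn_integral) auto
  also have "(\<integral>\<^sup>+s. ennreal (?f s) \<partial>N) = ennreal (pcf_kernel p (- y) t)"
    unfolding volterra_nn [OF t p y, symmetric] by (intro nn_integral_cong) (auto simp: indicator_def)
  finally show ?thesis
    using p y c_neg t by (simp add: pcf_kernel_nonneg)
qed

end

section \<open>Brownian motion and hitting times\<close>

text \<open>Cylinders over finitely many coordinates form an intersection-stable generator of the
  product sigma-algebra, so independence on them extends to all of it. The index set may be
  uncountable, as for a whole path segment.\<close>

lemma (in prob_space) indep_var_PiM_if_finite_indep:
  assumes I: "\<And>J. finite J \<Longrightarrow> J \<subseteq> I \<Longrightarrow>
      indep_var (PiM J S) (\<lambda>\<omega>. \<lambda>j\<in>J. X j \<omega>) T Z"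
    and X: "\<And>i. i \<in> I \<Longrightarrow> random_variable (S i) (X i)"
  shows "indep_var (PiM I S) (\<lambda>\<omega>. \<lambda>i\<in>I. X i \<omega>) T Z"
proof -
  let ?X = "\<lambda>\<omega>. \<lambda>i\<in>I. X i \<omega>"
  \<comment> \<open>The finite case with J empty already supplies measurability of Z.\<close>
  have Z: "random_variable T Z"
    using indep_var_rv2 [OF I [of "{}"]] by simp
  have XI: "random_variable (PiM I S) ?X"
    using X by (intro measurable_restrict)
  let ?A = "{?X -` A \<inter> space M | A. A \<in> prod_algebra I S}"
  let ?B = "{Z -` A \<inter> space M | A. A \<in> sets T}"
  have "indep_set (sigma_sets (space M) ?A) (sigma_sets (space M) ?B)"
  proof (rule indep_set_sigma_sets)
    have alg: "A \<in> sets (PiM I S)" if "A \<in> prod_algebra I S" for A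
      using that by (simp add: sets_PiM sigma_sets.Basic)
    show "indep_set ?A ?B"
    proof (rule indep_setI)
      show "?A \<subseteq> events"
        using XI alg by (auto intro: measurable_sets)
      show "?B \<subseteq> events"
        using Z by (auto intro: measurable_sets)
      fix a b assume "a \<in> ?A" "b \<in> ?B"
      then obtain A B where A: "A \<in> prod_algebra I S" "a = ?X -` A \<inter> space M"
        and B: "B \<in> sets T" "b = Z -` B \<inter> space M" by auto
      from A(1) obtain J E where J: "A = prod_emb I S J (\<Pi>\<^sub>E j\<in>J. E j)" "finite J" "J \<subseteq> I"
        and E: "\<And>i. i \<in> J \<Longrightarrow> E i \<in> sets (S i)"
        by (elim prod_algebraE) blast
      let ?XJ = "\<lambda>\<omega>. \<lambda>j\<in>J. X j \<omega>"
      have "?X \<omega> \<in> A \<longleftrightarrow> ?XJ \<omega> \<in> (\<Pi>\<^sub>E j\<in>J. E j)" if "\<omega> \<in> space M" for \<omega>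
      proof -
        have "?X \<omega> \<in> (\<Pi>\<^sub>E i\<in>I. space (S i))"
          using X that by (auto dest: measurable_space)
        moreover have "restrict (?X \<omega>) J = ?XJ \<omega>"
          using J(3) by (auto simp: restrict_def fun_eq_iff)
        ultimately show ?thesis
          by (auto simp: J(1) prod_emb_def)
      qed
      then have a: "a = ?XJ -` (\<Pi>\<^sub>E j\<in>J. E j) \<inter> space M"
        using A(2) by auto
      have PE: "(\<Pi>\<^sub>E j\<in>J. E j) \<in> sets (PiM J S)"
        using J E by (intro sets_PiM_I_finite) auto
      have "prob ((\<lambda>x. (?XJ x, Z x)) -` ((\<Pi>\<^sub>E j\<in>J. E j) \<times> B) \<inter> space M) = prob a * prob b"
        unfolding a B(2) by (rule indep_varD [OF I PE B(1)]) (use J in auto)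
      also have "(\<lambda>x. (?XJ x, Z x)) -` ((\<Pi>\<^sub>E j\<in>J. E j) \<times> B) \<inter> space M = a \<inter> b"
        unfolding a B(2) by auto
      finally show "prob (a \<inter> b) = prob a * prob b" .
    qed
    show "Int_stable ?A"
    proof (rule Int_stableI)
      fix a b assume "a \<in> ?A" "b \<in> ?A"
      then obtain A B where "A \<in> prod_algebra I S" "B \<in> prod_algebra I S"
        and ab: "a = ?X -` A \<inter> space M" "b = ?X -` B \<inter> space M" by auto
      then have "A \<inter> B \<in> prod_algebra I S"
        using Int_stable_prod_algebra by (auto simp: Int_stable_def)
      moreover have "a \<inter> b = ?X -` (A \<inter> B) \<inter> space M"
        using ab by auto
      ultimately show "a \<inter> b \<in> ?A" by blast
    qed
    show "Int_stable ?B"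
    proof (rule Int_stableI)
      fix a b assume "a \<in> ?B" "b \<in> ?B"
      then obtain A B where "A \<in> sets T" "B \<in> sets T"
        and ab: "a = Z -` A \<inter> space M" "b = Z -` B \<inter> space M" by auto
      moreover have "a \<inter> b = Z -` (A \<inter> B) \<inter> space M"
        using ab by auto
      ultimately show "a \<inter> b \<in> ?B" by blast
    qed
  qed
  moreover have "sigma_sets (space M) {?X -` A \<inter> space M | A. A \<in> sets (PiM I S)} = sigma_sets (space M) ?A"
  proof -
    have "?X \<in> space M \<rightarrow> (\<Pi>\<^sub>E i\<in>I. space (S i))"
      using measurable_space [OF X] by (intro Pi_I PiE_I) auto
    then have "{?X -` A \<inter> space M | A. A \<in> sets (PiM I S)} = sigma_sets (space M) ?A"
      unfolding sets_PiM by (rule sigma_sets_vimage_commute)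
    then show ?thesis
      by (simp only:) (rule sigma_sets_sigma_sets_eq, blast)
  qed
  ultimately show ?thesis
    unfolding indep_var_eq using XI Z by simp
qed

section \<open>Independence of an increment from the whole past\<close>

context standard_brownian_motion
begin

text \<open>Shifting to \<open>W\<^sub>t - W\<^sub>0\<close> makes the start at 0 hold for every path, not just almost surely.\<close>

definition V :: "real \<Rightarrow> 'a \<Rightarrow> real" where
  "V t \<omega> = W t \<omega> - W 0 \<omega>"

lemma V_measurable [measurable]: "0 \<le> t \<Longrightarrow> V t \<in> borel_measurable M"
  unfolding V_def [abs_def] using random_variable_W [of t] random_variable_W [of 0] by measurable

lemma V_continuous: "\<omega> \<in> space M \<Longrightarrow> continuous_on {0..} (\<lambda>t. V t \<omega>)"
  unfolding V_def by (intro continuous_intros continuous_paths)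

text \<open>\<open>indep_var\<close> needs both variables to have the same type, so the increment is wrapped as a
  function on a one-point index set.\<close>

lemma indep_var_finite_past_increment:
  assumes J: "finite J" "J \<subseteq> {0..u}" and u: "0 \<le> u" "u < T"
  shows "indep_var (PiM J (\<lambda>_. borel)) (\<lambda>\<omega>. \<lambda>j\<in>J. V j \<omega>) 
    (PiM {0} (\<lambda>_. borel)) (\<lambda>\<omega>. \<lambda>_\<in>{0}. V T \<omega> - V u \<omega>)"
proof -
  \<comment> \<open>With 0 in the grid, each V j is a sum of increments from the first grid point;
    with u in the grid, u is the last grid point and the next increment is the one up to T.\<close>
  define A where "A = insert 0 (insert u J)"
  define L where "L = sorted_list_of_set A"
  define n where "n = length L"
  \<comment> \<open>The sorted grid is followed by T, so of the n increments those with index below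
    n - 1 belong to the past and the one with index n - 1 is the future increment.\<close>
  define r where "r = (\<lambda>i. if i < n then L ! i else T)"
  have A: "finite A" "A \<subseteq> {0..u}" "0 \<in> A" "u \<in> A"
    using J u by (auto simp: A_def)
  have L: "set L = A" "sorted L" "L \<noteq> []"
    using A by (auto simp: L_def)
  have n: "n > 0"
    using L(3) by (simp add: n_def)
  have idx: "\<exists>i<n. r i = a" if "a \<in> A" for a
  proof -
    from that obtain i where "i < length L" "L ! i = a"
      using L(1) by (metis in_set_conv_nth)
    then show ?thesis
      by (intro exI [of _ i]) (simp add: r_def n_def)
  qed
  have r_in: "r i \<in> {0..u}" if "i < n" for i
  proof -
    have "L ! i \<in> A"
      using that L(1) nth_mem [of i L] by (simp add: n_def)
    then show ?thesis
      using that A(2) by (auto simp: r_def)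
  qed
  have r_mono: "r i \<le> r j" if "i \<le> j" "j < n" for i j
    using that L(2) by (simp add: r_def n_def sorted_nth_mono)
  have r0: "r 0 = 0"
  proof -
    obtain i where i: "i < n" "r i = 0" using idx [OF A(3)] by auto
    then have "r 0 \<le> 0" using r_mono [of 0 i] by simp
    then show ?thesis using r_in [OF n] by auto
  qed
  have rlast: "r (n - 1) = u"
  proof -
    obtain i where i: "i < n" "r i = u" using idx [OF A(4)] by auto
    then have "u \<le> r (n - 1)" using r_mono [of i "n - 1"] n by simp
    then show ?thesis using r_in [of "n - 1"] n by auto
  qed
  have rn: "r n = T" by (simp add: r_def)
  have steps: "r i \<le> r (Suc i)" if "i < n" for i
  proof (cases "Suc i < n")
    case True
    then show ?thesis by (intro r_mono) auto
  next
    case False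
    with that have "Suc i = n" by simp
    then show ?thesis using rn r_in [OF that] u by auto
  qed
  define D where "D = (\<lambda>i \<omega>. W (r (Suc i)) \<omega> - W (r i) \<omega>)"
  have "indep_vars (\<lambda>_. borel) D {..<n}"
    unfolding D_def by (rule independent_increments) (use r0 steps in auto)
  then have ind: "indep_var (PiM {..<n - 1} (\<lambda>_. borel)) (\<lambda>\<omega>. \<lambda>i\<in>{..<n - 1}. D i \<omega>)
      (PiM {n - 1} (\<lambda>_. borel)) (\<lambda>\<omega>. \<lambda>i\<in>{n - 1}. D i \<omega>)"
    by (rule indep_var_restrict) (use n in auto)
  obtain ix where ix: "\<And>j. j \<in> J \<Longrightarrow> ix j < n" "\<And>j. j \<in> J \<Longrightarrow> r (ix j) = j"
    using idx unfolding A_def by (metis insertCI)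
  \<comment> \<open>By telescoping, partial sums of the past increments recover the values V j;
    since ix j \<le> n - 1, no sum reaches the future increment.\<close>
  define Y where "Y = (\<lambda>x::nat \<Rightarrow> real. \<lambda>j\<in>J. \<Sum>i<ix j. x i)"
  have Ym: "Y \<in> measurable (PiM {..<n - 1} (\<lambda>_. borel)) (PiM J (\<lambda>_. borel))"
    unfolding Y_def
  proof (rule measurable_restrict)
    fix j assume "j \<in> J"
    then have lt: "i < n - 1" if "i < ix j" for i
      using ix(1) [of j] that by simp
    show "(\<lambda>x::nat \<Rightarrow> real. \<Sum>i<ix j. x i) \<in> borel_measurable (PiM {..<n - 1} (\<lambda>_. borel))"
      by (rule borel_measurable_sum [where f = "\<lambda>i x. x i" and S = "{..<ix j}"])
        (rule measurable_component_singleton, use lt in auto)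
  qed
  have "indep_var (PiM J (\<lambda>_. borel)) (Y \<circ> (\<lambda>\<omega>. \<lambda>i\<in>{..<n - 1}. D i \<omega>))
      (PiM {0} (\<lambda>_. borel)) ((\<lambda>x. \<lambda>_\<in>{0}. x (n - 1)) \<circ> (\<lambda>\<omega>. \<lambda>i\<in>{n - 1}. D i \<omega>))"
    by (rule indep_var_compose [OF ind Ym]) (auto intro!: measurable_restrict measurable_component_singleton)
  moreover have "Y \<circ> (\<lambda>\<omega>. \<lambda>i\<in>{..<n - 1}. D i \<omega>) = (\<lambda>\<omega>. \<lambda>j\<in>J. V j \<omega>)"
  proof (intro ext)
    fix \<omega> j
    show "(Y \<circ> (\<lambda>\<omega>. \<lambda>i\<in>{..<n - 1}. D i \<omega>)) \<omega> j = (\<lambda>j\<in>J. V j \<omega>) j"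
    proof (cases "j \<in> J")
      case True
      then have "(\<Sum>i<ix j. (\<lambda>i\<in>{..<n - 1}. D i \<omega>) i) = (\<Sum>i<ix j. D i \<omega>)"
        using ix(1) [of j] by (intro sum.cong) auto
      also have "\<dots> = W (r (ix j)) \<omega> - W (r 0) \<omega>"
        unfolding D_def by (rule sum_lessThan_telescope)
      finally show ?thesis
        using True by (simp add: Y_def V_def r0 ix)
    qed (simp add: Y_def)
  qed
  moreover have "(\<lambda>x. \<lambda>_\<in>{0}. x (n - 1)) \<circ> (\<lambda>\<omega>. \<lambda>i\<in>{n - 1}. D i \<omega>) = (\<lambda>\<omega>. \<lambda>_\<in>{0::real}. V T \<omega> - V u \<omega>)"
    using n rlast by (auto simp: fun_eq_iff D_def V_def rn)
  ultimately show ?thesis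
    by simp
qed

lemma indep_var_past_increment:
  assumes "0 \<le> u" "u < T"
  shows "indep_var (PiM {0..u} (\<lambda>_. borel)) (\<lambda>\<omega>. \<lambda>s\<in>{0..u}. V s \<omega>) 
    (PiM {0} (\<lambda>_. borel)) (\<lambda>\<omega>. \<lambda>_\<in>{0}. V T \<omega> - V u \<omega>)"
proof (rule indep_var_PiM_if_finite_indep)
  show "indep_var (PiM J (\<lambda>_. borel)) (\<lambda>\<omega>. \<lambda>s\<in>J. V s \<omega>)
      (PiM {0} (\<lambda>_. borel)) (\<lambda>\<omega>. \<lambda>_\<in>{0}. V T \<omega> - V u \<omega>)"
    if "finite J" "J \<subseteq> {0..u}" for J
    using that assms by (rule indep_var_finite_past_increment)
qed auto

end

section \<open>Hitting times of continuous paths and their measurability\<close>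

lemma hitting_time_nonneg: "0 \<le> hitting_time Y b \<omega>"
  unfolding hitting_time_def by (intro Inf_greatest) auto

lemma hitting_time_le:
  "0 < s \<Longrightarrow> Y s \<omega> \<le> b s \<Longrightarrow> hitting_time Y b \<omega> \<le> ereal s"
  unfolding hitting_time_def by (intro Inf_lower) auto

lemma continuous_on_nonneg_isCont:
  fixes f :: "real \<Rightarrow> real"
  assumes "continuous_on {0..} f" "0 < t"
  shows "isCont f t"
proof -
  have "continuous_on {0<..} f"
    using assms(1) by (rule continuous_on_subset) auto
  then show ?thesis
    using assms(2) by (simp add: continuous_on_eq_continuous_at)
qed

text \<open>Without a hit in (0, t], the path lies strictly above the boundary at t, and continuity
  excludes hits up to some t + d with d > 0, so the infimum exceeds t.\<close>

lemma hitting_time_le_iff: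
  assumes Y: "continuous_on {0..} (\<lambda>t. Y t \<omega>)" and b: "\<And>t. isCont b t" and t: "0 < t"
  shows "hitting_time Y b \<omega> \<le> ereal t \<longleftrightarrow> (\<exists>s\<in>{0<..t}. Y s \<omega> \<le> b s)"
proof
  assume "\<exists>s\<in>{0<..t}. Y s \<omega> \<le> b s"
  then obtain s where s: "0 < s" "s \<le> t" "Y s \<omega> \<le> b s" by auto
  then have "hitting_time Y b \<omega> \<le> ereal s" by (intro hitting_time_le)
  also have "\<dots> \<le> ereal t" using s by simp
  finally show "hitting_time Y b \<omega> \<le> ereal t" .
next
  assume le: "hitting_time Y b \<omega> \<le> ereal t"
  show "\<exists>s\<in>{0<..t}. Y s \<omega> \<le> b s"
  proof (rule ccontr)
    assume "\<not> ?thesis"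
    then have gt: "b s < Y s \<omega>" if "0 < s" "s \<le> t" for s
      using that by force
    have "isCont (\<lambda>s. Y s \<omega> - b s) t"
      using continuous_on_nonneg_isCont [OF Y t] b by (intro continuous_intros) auto
    then have "eventually (\<lambda>s. 0 < Y s \<omega> - b s) (at t)"
      unfolding isCont_def by (rule order_tendstoD) (use gt [of t] t in simp)
    then obtain d where d: "d > 0" "\<And>s. s \<noteq> t \<Longrightarrow> \<bar>s - t\<bar> < d \<Longrightarrow> b s < Y s \<omega>"
      unfolding eventually_at by (auto simp: dist_real_def)
    have "ereal (t + d) \<le> hitting_time Y b \<omega>"
      unfolding hitting_time_def
    proof (intro Inf_greatest)
      fix z assume "z \<in> ereal ` {t. 0 < t \<and> Y t \<omega> \<le> b t}"
      then obtain s where s: "z = ereal s" "0 < s" "Y s \<omega> \<le> b s" by auto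
      have "t < s" using gt [of s] s by force
      then have "t + d \<le> s" using d(2) [of s] s by force
      then show "ereal (t + d) \<le> z" using s by simp
    qed
    with le have "ereal (t + d) \<le> ereal t" by (rule order_trans [rotated])
    with d show False by simp
  qed
qed

text \<open>Near a point where f \<le> 0 there are rationals with small values, as a < t leaves room
  for them; conversely the minimum on the compact interval cannot be positive. An uncountable union
  over times thus becomes a countable expression.\<close>

lemma continuous_le_zero_iff_Rats:
  fixes f :: "real \<Rightarrow> real"
  assumes f: "continuous_on {a..t} f" and at: "a < t"
  shows "(\<exists>s\<in>{a..t}. f s \<le> 0) \<longleftrightarrow> (\<forall>k::nat. \<exists>q\<in>\<rat> \<inter> {a..t}. f q < 1 / Suc k)"
proof safe
  fix s k assume s: "s \<in> {a..t}" "f s \<le> 0"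
  have "1 / real (Suc k) > 0" by simp
  then obtain d where d: "d > 0" "\<And>x. x \<in> {a..t} \<Longrightarrow> dist x s < d \<Longrightarrow> dist (f x) (f s) < 1 / Suc k"
    using f s(1) unfolding continuous_on_iff by blast
  have "max a (s - d) < min t (s + d)"
    using at d(1) s(1) by auto
  then obtain q where q: "q \<in> \<rat>" "max a (s - d) < q" "q < min t (s + d)"
    using Rats_dense_in_real by blast
  then have "dist (f q) (f s) < 1 / Suc k"
    by (intro d) (auto simp: dist_real_def)
  then have "f q < 1 / Suc k"
    using s(2) by (simp add: dist_real_def)
  then show "\<exists>q\<in>\<rat> \<inter> {a..t}. f q < 1 / Suc k"
    using q by (intro bexI [of _ q]) auto
next
  assume *: "\<forall>k::nat. \<exists>q\<in>\<rat> \<inter> {a..t}. f q < 1 / Suc k"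
  obtain s where s: "s \<in> {a..t}" "\<And>x. x \<in> {a..t} \<Longrightarrow> f s \<le> f x"
    using continuous_attains_inf [of "{a..t}" f] f at by auto
  have "f s \<le> 0"
  proof (rule ccontr)
    assume "\<not> ?thesis"
    then obtain k where k: "inverse (real (Suc k)) < f s"
      using reals_Archimedean [of "f s"] by auto
    obtain q where "q \<in> {a..t}" "f q < 1 / Suc k"
      using * by blast
    with s(2) [of q] k show False
      by (simp add: inverse_eq_divide)
  qed
  with s(1) show "\<exists>s\<in>{a..t}. f s \<le> 0" by blast
qed

text \<open>The event of a hit by time t, for continuous paths, as a set of paths on [0, u] that
  uses countably many coordinates and so is measurable in the product sigma-algebra. The left ends 1
  / (n + 1) exhaust (0, t], time 0 not counting as a hit. Keeping u separate from t puts events for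
  several times on one path space.\<close>

definition hit_paths :: "(real \<Rightarrow> real) \<Rightarrow> real \<Rightarrow> real \<Rightarrow> (real \<Rightarrow> real) set" where
  "hit_paths b t u = (\<Union>n\<in>{n. 1 / real (Suc n) < t}. \<Inter>k::nat. \<Union>q\<in>\<rat> \<inter> {1 / real (Suc n)..t}.
     {x \<in> space (PiM {0..u} (\<lambda>_. borel)). x q - b q < 1 / real (Suc k)})"

lemma sets_hit_paths:
  assumes "t \<le> u"
  shows "hit_paths b t u \<in> sets (PiM {0..u} (\<lambda>_. borel))"
  unfolding hit_paths_def
proof (intro sets.countable_UN'' sets.countable_INT image_subsetI)
  fix n k :: nat and q :: real assume q: "q \<in> \<rat> \<inter> {1 / real (Suc n)..t}"
  then have "0 \<le> q"
    by (auto intro: order_trans [of _ "1 / real (Suc n)"])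
  with q assms have [measurable]: "(\<lambda>x. x q) \<in> borel_measurable (PiM {0..u} (\<lambda>_. borel))"
    by (intro measurable_component_singleton) auto
  show "{x \<in> space (PiM {0..u} (\<lambda>_. borel)). x q - b q < 1 / real (Suc k)} \<in> sets (PiM {0..u} (\<lambda>_. borel))"
    by measurable
qed (auto intro: countable_subset [OF _ countable_rat])

lemma hitting_time_le_iff_hit_paths:
  assumes Y: "continuous_on {0..} (\<lambda>t. Y t \<omega>)" and b: "\<And>t. isCont b t" and t: "0 < t" "t \<le> u"
  shows "hitting_time Y b \<omega> \<le> ereal t \<longleftrightarrow> (\<lambda>s\<in>{0..u}. Y s \<omega>) \<in> hit_paths b t u"
proof -
  have "(\<exists>s\<in>{0<..t}. Y s \<omega> \<le> b s) \<longleftrightarrow> (\<exists>n. 1 / real (Suc n) < t \<and> (\<exists>s\<in>{1 / real (Suc n)..t}. Y s \<omega> - b s \<le> 0))"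
  proof safe
    fix s assume s: "s \<in> {0<..t}" "Y s \<omega> \<le> b s"
    \<comment> \<open>Halving t guarantees 1 / (n + 1) < t strictly even when s = t, so the interval
      is nondegenerate.\<close>
    then have "0 < min s (t / 2)" using t by auto
    then obtain n where "inverse (real (Suc n)) < min s (t / 2)"
      using reals_Archimedean by blast
    then have n: "1 / real (Suc n) < s" "1 / real (Suc n) < t"
      using t by (auto simp: inverse_eq_divide)
    then show "\<exists>n. 1 / real (Suc n) < t \<and> (\<exists>s\<in>{1 / real (Suc n)..t}. Y s \<omega> - b s \<le> 0)"
      using s by (intro exI [of _ n] conjI bexI [of _ s]) auto
  next
    fix n s assume "1 / real (Suc n) < t" and s: "s \<in> {1 / real (Suc n)..t}" "Y s \<omega> - b s \<le> 0"
    have "0 < 1 / real (Suc n)" by simp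
    with s have "0 < s" by (meson atLeastAtMost_iff less_le_trans)
    with s show "\<exists>s\<in>{0<..t}. Y s \<omega> \<le> b s"
      by (intro bexI [of _ s]) auto
  qed
  also have "\<dots> \<longleftrightarrow> (\<exists>n. 1 / real (Suc n) < t \<and> (\<forall>k::nat. \<exists>q\<in>\<rat> \<inter> {1 / real (Suc n)..t}. Y q \<omega> - b q < 1 / real (Suc k)))"
  proof (intro ex_cong1 conj_cong refl)
    fix n assume n: "1 / real (Suc n) < t"
    have "0 \<le> 1 / real (Suc n)" by simp
    then have "{1 / real (Suc n)..t} \<subseteq> {0..}"
      by (meson atLeastAtMost_iff atLeast_iff order_trans subsetI)
    then have "continuous_on {1 / real (Suc n)..t} (\<lambda>s. Y s \<omega> - b s)"
      by (intro continuous_on_diff continuous_on_subset [OF Y] continuous_at_imp_continuous_on) (use b in auto)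
    then show "(\<exists>s\<in>{1 / real (Suc n)..t}. Y s \<omega> - b s \<le> 0) \<longleftrightarrow>
        (\<forall>k::nat. \<exists>q\<in>\<rat> \<inter> {1 / real (Suc n)..t}. Y q \<omega> - b q < 1 / real (Suc k))"
      using n by (rule continuous_le_zero_iff_Rats)
  qed
  also have "\<dots> \<longleftrightarrow> (\<lambda>s\<in>{0..u}. Y s \<omega>) \<in> hit_paths b t u"
  proof -
    define x where "x = (\<lambda>s\<in>{0..u}. Y s \<omega>)"
    have q: "x q = Y q \<omega>" if "q \<in> \<rat> \<inter> {1 / real (Suc n)..t}" for q n
    proof -
      have "0 \<le> 1 / real (Suc n)" by simp
      also have "\<dots> \<le> q" using that by simp
      finally have "q \<in> {0..u}" using that t(2) by simp
      then show ?thesis by (simp add: x_def)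
    qed
    have "x \<in> space (PiM {0..u} (\<lambda>_. borel))"
      by (auto simp: space_PiM x_def)
    then have "x \<in> hit_paths b t u \<longleftrightarrow>
        (\<exists>n. 1 / real (Suc n) < t \<and> (\<forall>k::nat. \<exists>q\<in>\<rat> \<inter> {1 / real (Suc n)..t}. x q - b q < 1 / real (Suc k)))"
      unfolding hit_paths_def by auto
    also have "\<dots> \<longleftrightarrow>
        (\<exists>n. 1 / real (Suc n) < t \<and> (\<forall>k::nat. \<exists>q\<in>\<rat> \<inter> {1 / real (Suc n)..t}. Y q \<omega> - b q < 1 / real (Suc k)))"
      by (intro ex_cong1 conj_cong all_cong1 bex_cong refl) (simp only: q)
    finally show ?thesis
      by (simp only: x_def)
  qed
  finally show ?thesis
    using hitting_time_le_iff [where Y = Y and \<omega> = \<omega>, OF Y b t(1)] by simp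
qed

lemma hitting_time_measurable:
  assumes Y: "\<And>\<omega>. \<omega> \<in> space M \<Longrightarrow> continuous_on {0..} (\<lambda>t. Y t \<omega>)" and b: "\<And>t. isCont b t"
    and m: "\<And>t. 0 \<le> t \<Longrightarrow> Y t \<in> borel_measurable M"
  shows "hitting_time Y b \<in> borel_measurable M"
proof (rule borel_measurableI_le)
  have pos: "{\<omega> \<in> space M. hitting_time Y b \<omega> \<le> ereal t} \<in> sets M" if t: "0 < t" for t
  proof -
    have "(\<lambda>\<omega>. \<lambda>s\<in>{0..t}. Y s \<omega>) \<in> measurable M (PiM {0..t} (\<lambda>_. borel))"
      using m by (intro measurable_restrict) auto
    then have "(\<lambda>\<omega>. \<lambda>s\<in>{0..t}. Y s \<omega>) -` hit_paths b t t \<inter> space M \<in> sets M"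
      by (rule measurable_sets) (simp add: sets_hit_paths)
    also have "(\<lambda>\<omega>. \<lambda>s\<in>{0..t}. Y s \<omega>) -` hit_paths b t t \<inter> space M = {\<omega> \<in> space M. hitting_time Y b \<omega> \<le> ereal t}"
      using hitting_time_le_iff_hit_paths [where Y = Y, OF Y b t order_refl] by auto
    finally show ?thesis .
  qed
  fix z :: ereal
  show "{\<omega> \<in> space M. hitting_time Y b \<omega> \<le> z} \<in> sets M"
  proof (cases z)
    case (real t)
    consider "t > 0" | "t = 0" | "t < 0" by linarith
    then show ?thesis
    proof cases
      case 1
      then show ?thesis using pos real by simp
    next
      case 2
      \<comment> \<open>The infimum may be 0 without being attained, so level 0 is approached from
        above.\<close>
      have "{\<omega> \<in> space M. hitting_time Y b \<omega> \<le> z} = (\<Inter>n::nat. {\<omega> \<in> space M. hitting_time Y b \<omega> \<le> ereal (1 / Suc n)})"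
      proof safe
        fix \<omega> n assume "hitting_time Y b \<omega> \<le> z"
        moreover have "z \<le> ereal (1 / Suc n)" using 2 real by simp
        ultimately show "hitting_time Y b \<omega> \<le> ereal (1 / Suc n)" by (rule order_trans)
      next
        fix \<omega> assume *: "\<omega> \<in> (\<Inter>n::nat. {\<omega> \<in> space M. hitting_time Y b \<omega> \<le> ereal (1 / Suc n)})"
        then show "\<omega> \<in> space M" by auto
        have "(\<lambda>n. ereal (1 / real (Suc n))) \<longlonglongrightarrow> ereal 0"
          by (intro tendsto_ereal) real_asymp
        then have "hitting_time Y b \<omega> \<le> ereal 0"
          by (rule tendsto_lowerbound) (use * in auto)
        then show "hitting_time Y b \<omega> \<le> z" using 2 real by simp
      qed
      also have "\<dots> \<in> sets M"
        using pos by (intro sets.countable_INT) auto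
      finally show ?thesis .
    next
      case 3
      then have "z < 0" using real by simp
      then have "\<not> hitting_time Y b \<omega> \<le> z" for \<omega>
        using hitting_time_nonneg [of Y b \<omega>] by (simp add: not_le less_le_trans)
      then show ?thesis by simp
    qed
  next
    case MInf
    have "\<not> hitting_time Y b \<omega> \<le> z" for \<omega>
      using hitting_time_nonneg [of Y b \<omega>] MInf by auto
    then show ?thesis by simp
  qed simp
qed

text \<open>There is a hit at or before \<rho>, hence at \<rho> itself, which gives one inequality.
  Before \<rho> the path is not below the boundary, and the limit from the left gives the
  other.\<close>

lemma hitting_time_attained:
  assumes Y: "continuous_on {0..} (\<lambda>t. Y t \<omega>)" and b: "\<And>t. isCont b t"
    and h: "hitting_time Y b \<omega> = ereal \<rho>" and \<rho>: "0 < \<rho>"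
  shows "Y \<rho> \<omega> = b \<rho>"
proof (rule antisym)
  obtain s where s: "s \<in> {0<..\<rho>}" "Y s \<omega> \<le> b s"
    using hitting_time_le_iff [where Y = Y and \<omega> = \<omega>, OF Y b \<rho>] h by auto
  then have "ereal \<rho> \<le> ereal s"
    using hitting_time_le [of s Y \<omega> b] h by simp
  with s show "Y \<rho> \<omega> \<le> b \<rho>" by auto
  have gt: "b s \<le> Y s \<omega>" if "0 < s" "s < \<rho>" for s
    using hitting_time_le [of s Y \<omega> b] h that by force
  have "isCont (\<lambda>s. Y s \<omega> - b s) \<rho>"
    using continuous_on_nonneg_isCont [OF Y \<rho>] b by (intro continuous_intros) auto
  then have "((\<lambda>s. Y s \<omega> - b s) \<longlongrightarrow> Y \<rho> \<omega> - b \<rho>) (at_left \<rho>)"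
    unfolding isCont_def by (rule filterlim_mono [OF _ order_refl at_le]) simp
  then have "0 \<le> Y \<rho> \<omega> - b \<rho>"
  proof (rule tendsto_lowerbound)
    show "\<forall>\<^sub>F s in at_left \<rho>. 0 \<le> Y s \<omega> - b s"
      using eventually_at_left_real [OF \<rho>] by eventually_elim (use gt in auto)
  qed simp
  then show "b \<rho> \<le> Y \<rho> \<omega>" by simp
qed

section \<open>Gaussian probabilities and conditioning at a fixed time\<close>

lemma nn_integral_normal_density_atMost:
  assumes v: "0 < v"
  shows "(\<integral>\<^sup>+z. ennreal (normal_density m (sqrt v) z) * indicator {..y} z \<partial>lborel) =
    ennreal (std_normal_cdf ((y - m) / sqrt v))"
proof -
  interpret real_distribution "density lborel std_normal_density"
    by (rule real_distribution_std_normal)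
  have s: "sqrt v > 0" using v by simp
  have "(\<integral>\<^sup>+z. ennreal (normal_density m (sqrt v) z) * indicator {..y} z \<partial>lborel) =
    ennreal \<bar>sqrt v\<bar> * (\<integral>\<^sup>+z. ennreal (normal_density m (sqrt v) (m + sqrt v * z)) * indicator {..y} (m + sqrt v * z) \<partial>lborel)"
    using v by (intro nn_integral_real_affine) auto
  also have "\<dots> = (\<integral>\<^sup>+z. ennreal (sqrt v) * (ennreal (normal_density m (sqrt v) (m + sqrt v * z)) * indicator {..y} (m + sqrt v * z)) \<partial>lborel)"
    using v by (simp add: nn_integral_cmult)
  also have "\<dots> = (\<integral>\<^sup>+z. ennreal (std_normal_density z) * indicator {..(y - m) / sqrt v} z \<partial>lborel)"
  proof (intro nn_integral_cong)
    fix z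
    have "sqrt v * normal_density m (sqrt v) (m + sqrt v * z) = std_normal_density z"
      using v by (simp add: normal_density_def real_sqrt_mult power_mult_distrib)
    moreover have "m + sqrt v * z \<le> y \<longleftrightarrow> z \<le> (y - m) / sqrt v"
      using s by (auto simp: field_simps)
    ultimately show "ennreal (sqrt v) * (ennreal (normal_density m (sqrt v) (m + sqrt v * z)) * indicator {..y} (m + sqrt v * z)) =
        ennreal (std_normal_density z) * indicator {..(y - m) / sqrt v} z"
      using v by (auto simp: indicator_def ennreal_mult' [symmetric])
  qed
  also have "\<dots> = emeasure (density lborel std_normal_density) {..(y - m) / sqrt v}"
    by (subst emeasure_density) auto
  finally show ?thesis
    by (simp add: cdf_def emeasure_eq_measure)
qed

lemma std_normal_cdf_measurable [measurable]: "std_normal_cdf \<in> borel_measurable borel"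
  by (rule borel_measurable_continuous_onI)
    (auto intro!: continuous_at_imp_continuous_on DERIV_isCont std_normal_cdf_has_derivative)

context standard_brownian_motion
begin

text \<open>Given the path up to u, V at T is V at u plus an independent centred Gaussian of
  variance T - u. The joint law of past and increment is a product, so the increment can be
  integrated out first with the past frozen; its one-point wrapping is undone by reading it at index
  0.\<close>

lemma markov_step:
  assumes u: "0 \<le> u" "u < T" and E [measurable]: "E \<in> sets (PiM {0..u} (\<lambda>_. borel))"
  shows "emeasure M {\<omega> \<in> space M. (\<lambda>s\<in>{0..u}. V s \<omega>) \<in> E \<and> V T \<omega> \<le> y} =
    (\<integral>\<^sup>+\<omega>. indicator E (\<lambda>s\<in>{0..u}. V s \<omega>) * ennreal (std_normal_cdf ((y - V u \<omega>) / sqrt (T - u))) \<partial>M)"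
proof -
  let ?P = "PiM {0..u} (\<lambda>_. borel) :: (real \<Rightarrow> real) measure"
  let ?Q = "PiM {0} (\<lambda>_. borel) :: (real \<Rightarrow> real) measure"
  define X where "X = (\<lambda>\<omega>. \<lambda>s\<in>{0..u}. V s \<omega>)"
  define Z where "Z = (\<lambda>\<omega>. \<lambda>_\<in>{0::real}. V T \<omega> - V u \<omega>)"
  have VT [measurable]: "V T \<in> borel_measurable M" and Vu [measurable]: "V u \<in> borel_measurable M"
    using u by auto
  have ind: "indep_var ?P X ?Q Z"
    unfolding X_def Z_def by (rule indep_var_past_increment [OF u])
  then have X [measurable]: "X \<in> measurable M ?P" and Z [measurable]: "Z \<in> measurable M ?Q"
    and J: "distr M ?P X \<Otimes>\<^sub>M distr M ?Q Z = distr M (?P \<Otimes>\<^sub>M ?Q) (\<lambda>\<omega>. (X \<omega>, Z \<omega>))"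
    by (simp_all add: indep_var_distribution_eq)
  have Xu: "X \<omega> u = V u \<omega>" for \<omega> using u by (simp add: X_def)
  have Z0: "Z \<omega> 0 = V T \<omega> - V u \<omega>" for \<omega> by (simp add: Z_def)
  have [measurable]: "(\<lambda>x. x u) \<in> borel_measurable ?P" "(\<lambda>z. z 0) \<in> borel_measurable ?Q"
    using u by (auto intro: measurable_component_singleton)
  define f where "f = (\<lambda>(x, z). indicator E x * indicator {..y} (x u + z (0::real)) :: ennreal)"
  have f [measurable]: "f \<in> borel_measurable (?P \<Otimes>\<^sub>M ?Q)"
    unfolding f_def by measurable
  interpret PQ: prob_space "distr M ?Q Z"
    by (rule prob_space_distr) (rule Z)
  have inner: "(\<integral>\<^sup>+\<omega>. indicator {..y} (a + (V T \<omega> - V u \<omega>)) \<partial>M) = ennreal (std_normal_cdf ((y - a) / sqrt (T - u)))" for a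
  proof -
    have "(\<integral>\<^sup>+\<omega>. indicator {..y} (a + (V T \<omega> - V u \<omega>)) \<partial>M) = (\<integral>\<^sup>+\<omega>. indicator {..y - a} (W T \<omega> - W u \<omega>) \<partial>M)"
      by (intro nn_integral_cong) (auto simp: V_def indicator_def)
    also have "\<dots> = (\<integral>\<^sup>+z. ennreal (normal_density 0 (sqrt (T - u)) z) * indicator {..y - a} z \<partial>lborel)"
      by (rule distributed_nn_integral [OF gaussian_increments [OF u], symmetric]) simp
    also have "\<dots> = ennreal (std_normal_cdf ((y - a - 0) / sqrt (T - u)))"
      using u by (intro nn_integral_normal_density_atMost) simp
    finally show ?thesis by simp
  qed
  have "emeasure M {\<omega> \<in> space M. X \<omega> \<in> E \<and> V T \<omega> \<le> y} = (\<integral>\<^sup>+\<omega>. indicator {\<omega> \<in> space M. X \<omega> \<in> E \<and> V T \<omega> \<le> y} \<omega> \<partial>M)"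
    by (subst nn_integral_indicator) auto
  also have "\<dots> = (\<integral>\<^sup>+\<omega>. f (X \<omega>, Z \<omega>) \<partial>M)"
    by (intro nn_integral_cong) (auto simp: f_def Xu Z0 indicator_def)
  also have "\<dots> = (\<integral>\<^sup>+v. f v \<partial>distr M (?P \<Otimes>\<^sub>M ?Q) (\<lambda>\<omega>. (X \<omega>, Z \<omega>)))"
    by (subst nn_integral_distr) measurable
  also have "\<dots> = (\<integral>\<^sup>+v. f v \<partial>(distr M ?P X \<Otimes>\<^sub>M distr M ?Q Z))"
    by (simp only: J)
  also have "\<dots> = (\<integral>\<^sup>+x. (\<integral>\<^sup>+z. f (x, z) \<partial>distr M ?Q Z) \<partial>distr M ?P X)"
    by (rule PQ.nn_integral_fst [symmetric]) measurable
  also have "\<dots> = (\<integral>\<^sup>+x. (\<integral>\<^sup>+\<omega>'. f (x, Z \<omega>') \<partial>M) \<partial>distr M ?P X)"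
    by (intro nn_integral_cong nn_integral_distr) (auto intro: measurable_Pair2 [OF f])
  also have "\<dots> = (\<integral>\<^sup>+x. indicator E x * ennreal (std_normal_cdf ((y - x u) / sqrt (T - u))) \<partial>distr M ?P X)"
  proof (intro nn_integral_cong)
    fix x
    have "(\<integral>\<^sup>+\<omega>'. f (x, Z \<omega>') \<partial>M) = indicator E x * (\<integral>\<^sup>+\<omega>. indicator {..y} (x u + (V T \<omega> - V u \<omega>)) \<partial>M)"
      unfolding f_def by (simp add: Z0 nn_integral_cmult)
    then show "(\<integral>\<^sup>+\<omega>'. f (x, Z \<omega>') \<partial>M) = indicator E x * ennreal (std_normal_cdf ((y - x u) / sqrt (T - u)))"
      by (simp only: inner)
  qed
  also have "\<dots> = (\<integral>\<^sup>+\<omega>. indicator E (X \<omega>) * ennreal (std_normal_cdf ((y - V u \<omega>) / sqrt (T - u))) \<partial>M)"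
    by (subst nn_integral_distr) (auto simp: Xu)
  finally show ?thesis
    unfolding X_def .
qed

end

lemma std_normal_cdf_bounds: "0 \<le> std_normal_cdf x" "std_normal_cdf x \<le> 1"
proof -
  interpret real_distribution "density lborel std_normal_density"
    by (rule real_distribution_std_normal)
  show "0 \<le> std_normal_cdf x" "std_normal_cdf x \<le> 1"
    by (rule cdf_nonneg, rule cdf_bounded_prob)
qed

text \<open>Cells are open on the left and closed on the right, so the index is the ceiling of
  \<rho> (n + 1) / T minus one, and the right end is the first grid time at or after \<rho>.\<close>

lemma ex_grid_cell:
  fixes \<rho> T :: real
  assumes "0 < \<rho>" "\<rho> \<le> T"
  shows "\<exists>k<Suc n. real k * T / real (Suc n) < \<rho> \<and> \<rho> \<le> real (Suc k) * T / real (Suc n)"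
proof -
  let ?N = "real (Suc n)"
  have T: "0 < T" using assms by simp
  define m where "m = \<lceil>\<rho> * ?N / T\<rceil>"
  have m: "real_of_int m - 1 < \<rho> * ?N / T" "\<rho> * ?N / T \<le> real_of_int m"
    unfolding m_def by linarith+
  have "0 < \<rho> * ?N / T" using assms T by simp
  then have "m > 0" using m by linarith
  have "\<rho> * ?N / T \<le> ?N"
    using assms T by (simp add: divide_le_eq mult.commute)
  then have "m \<le> Suc n"
    unfolding m_def by (simp add: ceiling_le_iff)
  define k where "k = nat m - 1"
  have k: "real k = real_of_int m - 1" "k < Suc n"
    using \<open>m > 0\<close> \<open>m \<le> Suc n\<close> by (auto simp: k_def)
  show ?thesis
  proof (intro exI conjI)
    show "k < Suc n" by fact
    show "real k * T / ?N < \<rho>"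
      unfolding k(1) using m(1) T by (simp add: field_simps)
    show "\<rho> \<le> real (Suc k) * T / ?N"
    proof -
      have "real (Suc k) = real_of_int m" using k(1) by simp
      then show ?thesis using m(2) T by (simp only:) (simp add: field_simps)
    qed
  qed
qed

text \<open>The boundary lives on the whole line, so continuity has no endpoint cases; the
  application continues it to negative times by a constant.\<close>

locale brownian_hitting = standard_brownian_motion M W for M :: "'a measure" and W +
  fixes b :: "real \<Rightarrow> real" and c :: real
  assumes b_cont: "\<And>t. isCont b t"
    and b_gt: "\<And>t. c < b t"
    and c_neg: "c < 0"
    and hit_not_0: "measure M {\<omega> \<in> space M. hitting_time W b \<omega> = 0} = 0"
begin

text \<open>Built from V because the independence of past and increment is stated for V; it agrees
  almost surely with the hitting time of W.\<close>

definition \<tau> :: "'a \<Rightarrow> ereal" where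
  "\<tau> = hitting_time V b"

lemma \<tau>_measurable [measurable]: "\<tau> \<in> borel_measurable M"
  unfolding \<tau>_def using V_continuous b_cont V_measurable by (rule hitting_time_measurable)

lemma hitting_time_W_measurable [measurable]: "hitting_time W b \<in> borel_measurable M"
  using continuous_paths b_cont random_variable_W by (rule hitting_time_measurable)

lemma AE_hitting_time_eq: "AE \<omega> in M. hitting_time W b \<omega> = \<tau> \<omega>"
  using starts_at_0 by eventually_elim (simp add: \<tau>_def hitting_time_def V_def)

lemma \<tau>_nonneg: "0 \<le> \<tau> \<omega>"
  unfolding \<tau>_def by (rule hitting_time_nonneg)

lemma AE_\<tau>_pos: "AE \<omega> in M. 0 < \<tau> \<omega>"
proof -
  have "{\<omega> \<in> space M. hitting_time W b \<omega> = 0} \<in> null_sets M"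
    using hit_not_0 by (intro null_setsI) (auto simp: emeasure_eq_measure)
  then have "AE \<omega> in M. hitting_time W b \<omega> \<noteq> 0"
    by (intro AE_I') auto
  with AE_hitting_time_eq show ?thesis
    by eventually_elim (use \<tau>_nonneg in \<open>auto simp: order_le_less\<close>)
qed

lemma \<tau>_past:
  assumes "0 < t" "t \<le> u" "\<omega> \<in> space M"
  shows "\<tau> \<omega> \<le> ereal t \<longleftrightarrow> (\<lambda>s\<in>{0..u}. V s \<omega>) \<in> hit_paths b t u"
  unfolding \<tau>_def
  by (rule hitting_time_le_iff_hit_paths [where Y = V, OF V_continuous [OF assms(3)] b_cont assms(1,2)])

text \<open>Optional stopping for the bounded martingale \<open>P(W\<^sub>T \<le> y | W\<^sub>t)\<close>: on the grid of mesh \<open>T / n\<close> it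
  follows from independence of increments, and the grid times just after the hitting time
  decrease to it.\<close>

lemma prob_le_eq_expectation_at_hitting:
  assumes T: "0 < T" and y: "y \<le> c"
  shows "prob {\<omega> \<in> space M. V T \<omega> \<le> y} =
    (LINT \<omega>|M. (if \<tau> \<omega> < ereal T
       then std_normal_cdf ((y - b (real_of_ereal (\<tau> \<omega>))) / sqrt (T - real_of_ereal (\<tau> \<omega>))) else 0))"
    (is "_ = (LINT \<omega>|M. ?\<Psi> \<omega>)")
proof -
  define t where "t = (\<lambda>n k. real k * T / real (Suc n))"
  \<comment> \<open>With D n 0 empty, a possible \<tau> = 0 falls into the first cell, and the cells
    \<open>A n k\<close> with k \<le> n partition the event \<tau> \<le> T.\<close>
  define D where "D = (\<lambda>n k. if k = 0 then {} else {\<omega> \<in> space M. \<tau> \<omega> \<le> ereal (t n k)})"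
  define A where "A = (\<lambda>n k. D n (Suc k) - D n k)"
  define H where "H = {\<omega> \<in> space M. V T \<omega> \<le> y}"
  \<comment> \<open>The conditional probability of H at the grid time ending cell k. For the last
    cell that time is T, where the Gaussian formula would divide by 0 and the conditional
    probability is the indicator of H.\<close>
  define R where "R = (\<lambda>n k \<omega>. if Suc k < Suc n
     then std_normal_cdf ((y - V (t n (Suc k)) \<omega>) / sqrt (T - t n (Suc k))) else indicator H \<omega>)"
  define \<Psi> where "\<Psi> = (\<lambda>n \<omega>. \<Sum>k<Suc n. indicator (A n k) \<omega> * R n k \<omega>)"
  have t_nonneg: "0 \<le> t n k" for n k using T by (simp add: t_def)
  have t_pos: "0 < t n (Suc k)" for n k using T by (simp add: t_def)
  have t_mono: "t n j \<le> t n k" if "j \<le> k" for n j k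
    using that T by (simp add: t_def divide_right_mono mult_right_mono)
  have t_less: "t n k < T" if "k < Suc n" for n k
    using that T by (simp add: t_def divide_less_eq mult.commute)
  have t_end: "t n (Suc n) = T" for n by (simp add: t_def)
  have [measurable]: "V T \<in> borel_measurable M" "V (t n k) \<in> borel_measurable M" for n k
    using T t_nonneg by auto
  have H [measurable]: "H \<in> sets M" unfolding H_def by measurable
  have D [measurable]: "D n k \<in> sets M" for n k unfolding D_def by auto
  have A [measurable]: "A n k \<in> sets M" for n k unfolding A_def by measurable
  have R [measurable]: "R n k \<in> borel_measurable M" for n k
    unfolding R_def by (cases "Suc k < Suc n") auto
  have R01: "0 \<le> R n k \<omega>" "R n k \<omega> \<le> 1" for n k \<omega>
    by (auto simp: R_def std_normal_cdf_bounds indicator_def)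
  have D_mono: "D n k \<subseteq> D n (Suc k)" for n k
    using t_mono [of k "Suc k" n] by (auto simp: D_def intro: order_trans)
  have sumA: "(\<Sum>k<Suc n. indicator (A n k) \<omega>) = (indicator (D n (Suc n)) \<omega> :: real)" for n \<omega>
  proof -
    have "(\<Sum>k<Suc n. indicator (A n k) \<omega>) = (\<Sum>k<Suc n. indicator (D n (Suc k)) \<omega> - indicator (D n k) \<omega> :: real)"
      using D_mono by (intro sum.cong) (auto simp: A_def indicator_def)
    also have "\<dots> = indicator (D n (Suc n)) \<omega> - indicator (D n 0) \<omega>"
      by (rule sum_lessThan_telescope)
    finally show ?thesis by (simp add: D_def)
  qed
  have HD: "\<omega> \<in> D n (Suc n)" if "\<omega> \<in> H" for \<omega> n
  proof -
    have "V T \<omega> \<le> b T" using that y b_gt [of T] by (simp add: H_def)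
    then have "\<tau> \<omega> \<le> ereal T"
      unfolding \<tau>_def using T by (intro hitting_time_le) auto
    then show ?thesis using that by (simp add: D_def H_def t_end)
  qed
  have step: "prob (A n k \<inter> H) = (LINT \<omega>|M. indicator (A n k) \<omega> * R n k \<omega>)" if k: "k < Suc n" for n k
  proof (cases "Suc k < Suc n")
    case True
    define u where "u = t n (Suc k)"
    have u: "0 < u" "u < T" using t_pos t_less [OF True] by (auto simp: u_def)
    \<comment> \<open>Both hitting events are read off the same path segment on [0, u], so the cell
      belongs to the past at time u and \<open>markov_step\<close> applies.\<close>
    define E where "E = hit_paths b u u - (if k = 0 then {} else hit_paths b (t n k) u)"
    have tu: "t n k \<le> u" unfolding u_def by (rule t_mono) simp
    have E: "E \<in> sets (PiM {0..u} (\<lambda>_. borel))"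
      unfolding E_def using tu by (auto intro!: sets.Diff sets_hit_paths)
    have AE: "\<omega> \<in> A n k \<longleftrightarrow> (\<lambda>s\<in>{0..u}. V s \<omega>) \<in> E" if \<omega>: "\<omega> \<in> space M" for \<omega>
    proof (cases "k = 0")
      case True
      then show ?thesis
        using \<tau>_past [OF u(1) order_refl \<omega>] \<omega> by (simp add: A_def D_def E_def u_def)
    next
      case False
      then have "0 < t n k" using t_pos [of n "k - 1"] by simp
      from \<tau>_past [OF this tu \<omega>] \<tau>_past [OF u(1) order_refl \<omega>] False \<omega> show ?thesis
        by (simp add: A_def D_def E_def u_def)
    qed
    have "emeasure M (A n k \<inter> H) = emeasure M {\<omega> \<in> space M. (\<lambda>s\<in>{0..u}. V s \<omega>) \<in> E \<and> V T \<omega> \<le> y}"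
      using AE sets.sets_into_space [OF A [of n k]] by (intro arg_cong [where f = "emeasure M"]) (auto simp: H_def)
    also have "\<dots> = (\<integral>\<^sup>+\<omega>. indicator E (\<lambda>s\<in>{0..u}. V s \<omega>) * ennreal (std_normal_cdf ((y - V u \<omega>) / sqrt (T - u))) \<partial>M)"
      using u E by (intro markov_step) auto
    also have "\<dots> = (\<integral>\<^sup>+\<omega>. ennreal (indicator (A n k) \<omega> * R n k \<omega>) \<partial>M)"
      using True AE by (intro nn_integral_cong) (auto simp: R_def u_def indicator_def)
    finally have e: "emeasure M (A n k \<inter> H) = (\<integral>\<^sup>+\<omega>. ennreal (indicator (A n k) \<omega> * R n k \<omega>) \<partial>M)" .
    have "(LINT \<omega>|M. indicator (A n k) \<omega> * R n k \<omega>) = enn2real (\<integral>\<^sup>+\<omega>. ennreal (indicator (A n k) \<omega> * R n k \<omega>) \<partial>M)"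
      using R01 by (intro integral_eq_nn_integral) (auto simp: indicator_def)
    then show ?thesis
      by (simp add: e [symmetric] measure_def)
  next
    case False
    then have "(LINT \<omega>|M. indicator (A n k) \<omega> * R n k \<omega>) = (LINT \<omega>|M. indicator (A n k \<inter> H) \<omega>)"
      by (intro Bochner_Integration.integral_cong) (auto simp: R_def indicator_def)
    then show ?thesis by (simp add: Int_absorb2 sets.sets_into_space)
  qed
  have integ: "integrable M (\<lambda>\<omega>. indicator (A n k) \<omega> * R n k \<omega>)" for n k
    using R01 by (intro integrable_const_bound [where B = 1]) (auto simp: indicator_def)
  have eq: "prob H = (LINT \<omega>|M. \<Psi> n \<omega>)" for n
  proof -
    have "prob H = (LINT \<omega>|M. indicator H \<omega>)"
      by (simp add: Int_absorb2 sets.sets_into_space)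
    also have "\<dots> = (LINT \<omega>|M. (\<Sum>k<Suc n. indicator (A n k \<inter> H) \<omega>))"
    proof (intro Bochner_Integration.integral_cong refl)
      fix \<omega>
      have "(\<Sum>k<Suc n. indicator (A n k \<inter> H) \<omega>) = (\<Sum>k<Suc n. indicator (A n k) \<omega>) * (indicator H \<omega> :: real)"
        by (simp only: indicator_inter_arith sum_distrib_right)
      also have "\<dots> = indicator H \<omega>"
        unfolding sumA using HD [of \<omega> n] by (auto simp: indicator_def)
      finally show "indicator H \<omega> = (\<Sum>k<Suc n. indicator (A n k \<inter> H) \<omega> :: real)" by simp
    qed
    also have "\<dots> = (\<Sum>k<Suc n. LINT \<omega>|M. indicator (A n k \<inter> H) \<omega>)"
      by (intro Bochner_Integration.integral_sum) (auto simp: emeasure_eq_measure)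
    also have "\<dots> = (\<Sum>k<Suc n. LINT \<omega>|M. indicator (A n k) \<omega> * R n k \<omega>)"
      using step by (intro sum.cong refl) (simp add: Int_absorb2 sets.sets_into_space)
    also have "\<dots> = (LINT \<omega>|M. \<Psi> n \<omega>)"
      unfolding \<Psi>_def by (intro Bochner_Integration.integral_sum [symmetric] integ)
    finally show ?thesis .
  qed
  have lim: "(\<lambda>n. \<Psi> n \<omega>) \<longlonglongrightarrow> ?\<Psi> \<omega>" if \<omega>: "\<omega> \<in> space M" and pos: "0 < \<tau> \<omega>" for \<omega>
  proof (cases "\<tau> \<omega> \<le> ereal T")
    case False
    then have "indicator (A n k) \<omega> = (0::real)" if "k < Suc n" for n k
      using that t_mono [of "Suc k" "Suc n" n] by (auto simp: A_def D_def t_end indicator_def intro: order_trans)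
    then have "\<Psi> n \<omega> = 0" for n
      unfolding \<Psi>_def by simp
    moreover have "\<not> \<tau> \<omega> < ereal T" using False by (auto intro: less_imp_le)
    ultimately show ?thesis by simp
  next
    case True
    define \<rho> where "\<rho> = real_of_ereal (\<tau> \<omega>)"
    have \<rho>: "\<tau> \<omega> = ereal \<rho>" using True pos by (cases "\<tau> \<omega>") (auto simp: \<rho>_def)
    with pos True have \<rho>0: "0 < \<rho>" "\<rho> \<le> T" by auto
    have V\<rho>: "V \<rho> \<omega> = b \<rho>"
      by (rule hitting_time_attained [where Y = V, OF V_continuous [OF \<omega>] b_cont _ \<rho>0(1)]) (use \<rho> \<tau>_def in simp)
    have "\<forall>n. \<exists>k<Suc n. t n k < \<rho> \<and> \<rho> \<le> t n (Suc k)"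
      unfolding t_def using ex_grid_cell [OF \<rho>0] by blast
    then obtain \<kappa> where \<kappa>: "\<And>n. \<kappa> n < Suc n" "\<And>n. t n (\<kappa> n) < \<rho>" "\<And>n. \<rho> \<le> t n (Suc (\<kappa> n))"
      by metis
    have \<Psi>: "\<Psi> n \<omega> = R n (\<kappa> n) \<omega>" for n
    proof -
      have "indicator (A n j) \<omega> * R n j \<omega> = (if j = \<kappa> n then R n (\<kappa> n) \<omega> else 0)" for j
      proof -
        consider "j < \<kappa> n" | "j = \<kappa> n" | "j > \<kappa> n" by linarith
        then show ?thesis
        proof cases
          case 1
          then have "t n (Suc j) < \<rho>" using t_mono [of "Suc j" "\<kappa> n" n] \<kappa>(2) [of n] by simp
          then have "\<omega> \<notin> A n j" by (simp add: A_def D_def \<rho>)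
          with 1 show ?thesis by simp
        next
          case 2
          have "\<omega> \<in> A n j" using 2 \<kappa>(2,3) [of n] \<omega> by (auto simp: A_def D_def \<rho>)
          with 2 show ?thesis by simp
        next
          case 3
          then have "\<rho> \<le> t n j" using t_mono [of "Suc (\<kappa> n)" j n] \<kappa>(3) [of n] by simp
          then have "\<omega> \<notin> A n j" using 3 \<omega> by (simp add: A_def D_def \<rho>)
          with 3 show ?thesis by simp
        qed
      qed
      then show ?thesis
        unfolding \<Psi>_def using \<kappa>(1) [of n] by simp
    qed
    define s where "s = (\<lambda>n. t n (Suc (\<kappa> n)))"
    have s: "\<rho> \<le> s n" "s n \<le> \<rho> + T / Suc n" for n
      using \<kappa>(2,3) [of n] by (auto simp: s_def t_def add_divide_distrib distrib_right)
    have slim: "s \<longlonglongrightarrow> \<rho>"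
    proof (rule tendsto_sandwich [of "\<lambda>_. \<rho>" _ _ "\<lambda>n. \<rho> + T / Suc n"])
      show "(\<lambda>n. \<rho> + T / Suc n) \<longlonglongrightarrow> \<rho>" by real_asymp
    qed (use s in auto)
    show ?thesis
    proof (cases "\<rho> < T")
      case True
      \<comment> \<open>For \<rho> < T the cell containing \<rho> is eventually not the last one, so
        \<open>R\<close> is given by its Gaussian branch.\<close>
      have "\<forall>\<^sub>F n in sequentially. s n < T"
        using slim True by (rule order_tendstoD)
      then have ev: "\<forall>\<^sub>F n in sequentially. std_normal_cdf ((y - V (s n) \<omega>) / sqrt (T - s n)) = \<Psi> n \<omega>"
      proof eventually_elim
        case (elim n)
        have "\<kappa> n \<noteq> n" using elim t_end [of n] by (auto simp: s_def)
        then show ?case using \<kappa>(1) [of n] by (simp add: \<Psi> R_def s_def)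
      qed
      have "isCont (\<lambda>t. V t \<omega>) \<rho>"
        by (rule continuous_on_nonneg_isCont [OF V_continuous [OF \<omega>] \<rho>0(1)])
      then have "(\<lambda>n. V (s n) \<omega>) \<longlonglongrightarrow> b \<rho>"
        using isCont_tendsto_compose [OF _ slim] V\<rho> by fastforce
      then have "(\<lambda>n. (y - V (s n) \<omega>) / sqrt (T - s n)) \<longlonglongrightarrow> (y - b \<rho>) / sqrt (T - \<rho>)"
        using True slim by (intro tendsto_intros) auto
      then have "(\<lambda>n. std_normal_cdf ((y - V (s n) \<omega>) / sqrt (T - s n))) \<longlonglongrightarrow> std_normal_cdf ((y - b \<rho>) / sqrt (T - \<rho>))"
        by (rule isCont_tendsto_compose [OF DERIV_isCont [OF std_normal_cdf_has_derivative]])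
      then have "(\<lambda>n. \<Psi> n \<omega>) \<longlonglongrightarrow> std_normal_cdf ((y - b \<rho>) / sqrt (T - \<rho>))"
        using ev by (rule Lim_transform_eventually)
      then show ?thesis using True \<rho> by simp
    next
      case False
      with \<rho>0 have "\<rho> = T" by simp
      have "\<kappa> n = n" for n
      proof (rule ccontr)
        assume "\<kappa> n \<noteq> n"
        then have "Suc (\<kappa> n) < Suc n" using \<kappa>(1) [of n] by simp
        with t_less [OF this] \<kappa>(3) [of n] \<open>\<rho> = T\<close> show False by simp
      qed
      \<comment> \<open>For \<rho> = T the path ends on the boundary, and b(T) > c \<ge> y.\<close>
      moreover have "\<omega> \<notin> H" using V\<rho> \<open>\<rho> = T\<close> b_gt [of T] y by (simp add: H_def)
      ultimately have "\<Psi> n \<omega> = 0" for n by (simp add: \<Psi> R_def)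
      then show ?thesis using False \<rho> by simp
    qed
  qed
  have "(\<lambda>n. LINT \<omega>|M. \<Psi> n \<omega>) \<longlonglongrightarrow> (LINT \<omega>|M. ?\<Psi> \<omega>)"
  proof (rule integral_dominated_convergence [where w = "\<lambda>_. 1"])
    show "AE \<omega> in M. (\<lambda>n. \<Psi> n \<omega>) \<longlonglongrightarrow> ?\<Psi> \<omega>"
      using AE_\<tau>_pos AE_space by eventually_elim (rule lim)
    show "AE \<omega> in M. norm (\<Psi> n \<omega>) \<le> 1" for n
    proof (rule AE_I2)
      fix \<omega>
      have "0 \<le> \<Psi> n \<omega>" unfolding \<Psi>_def using R01 by (intro sum_nonneg) simp
      moreover have "\<Psi> n \<omega> \<le> (\<Sum>k<Suc n. indicator (A n k) \<omega>)"
        unfolding \<Psi>_def using R01 by (intro sum_mono) (auto simp: indicator_def)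
      ultimately show "norm (\<Psi> n \<omega>) \<le> 1"
        unfolding sumA by (cases "\<omega> \<in> D n (Suc n)") auto
    qed
    show "?\<Psi> \<in> borel_measurable M"
    proof -
      have [measurable]: "b \<in> borel_measurable borel"
        using b_cont by (intro borel_measurable_continuous_onI continuous_at_imp_continuous_on) auto
      show ?thesis by measurable
    qed
    show "\<Psi> n \<in> borel_measurable M" for n
      unfolding \<Psi>_def by measurable
  qed auto
  then have "(LINT \<omega>|M. ?\<Psi> \<omega>) = prob H"
    using eq by (simp add: LIMSEQ_const_iff flip: eq)
  then show ?thesis by (simp add: H_def)
qed

text \<open>\<open>real_of_ereal\<close> sends \<infinity> to 0, so without the restriction to
  finite \<tau> the probability of never hitting would become mass at time 0.\<close>

definition law :: "real measure" where
  "law = distr (density M (indicator {\<omega> \<in> space M. \<tau> \<omega> < \<infinity>})) borel (\<lambda>\<omega>. real_of_ereal (\<tau> \<omega>))"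

lemma b_measurable [measurable]: "b \<in> borel_measurable borel"
  using b_cont by (intro borel_measurable_continuous_onI continuous_at_imp_continuous_on) auto

lemma nn_integral_law:
  assumes [measurable]: "g \<in> borel_measurable borel"
  shows "(\<integral>\<^sup>+s. g s \<partial>law) =
    (\<integral>\<^sup>+\<omega>. indicator {\<omega> \<in> space M. \<tau> \<omega> < \<infinity>} \<omega> * g (real_of_ereal (\<tau> \<omega>)) \<partial>M)"
  unfolding law_def by (subst nn_integral_distr) (auto simp: nn_integral_density)

lemma emeasure_law_atMost: "emeasure law {..t} = emeasure M {\<omega> \<in> space M. \<tau> \<omega> \<le> ereal t}"
proof -
  have "emeasure law {..t} = (\<integral>\<^sup>+s. indicator {..t} s \<partial>law)"
    by (simp add: law_def)
  also have "\<dots> = (\<integral>\<^sup>+\<omega>. indicator {\<omega> \<in> space M. \<tau> \<omega> \<le> ereal t} \<omega> \<partial>M)"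
    unfolding nn_integral_law [OF borel_measurable_indicator [OF borel_closed [OF closed_atMost]]]
  proof (intro nn_integral_cong)
    fix \<omega>
    show "indicator {\<omega> \<in> space M. \<tau> \<omega> < \<infinity>} \<omega> * indicator {..t} (real_of_ereal (\<tau> \<omega>)) =
        (indicator {\<omega> \<in> space M. \<tau> \<omega> \<le> ereal t} \<omega> :: ennreal)"
      using \<tau>_nonneg [of \<omega>] by (cases "\<tau> \<omega>") (auto simp: indicator_def)
  qed
  finally show ?thesis by simp
qed

lemma cdf_law: "cdf law = hitting_cdf M W b"
proof
  fix t
  have "emeasure law {..t} = emeasure M {\<omega> \<in> space M. hitting_time W b \<omega> \<le> ereal t}"
    unfolding emeasure_law_atMost
    by (intro emeasure_eq_AE) (use AE_hitting_time_eq in \<open>auto elim!: eventually_mono\<close>)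
  then show "cdf law t = hitting_cdf M W b t"
    by (simp add: cdf_def hitting_cdf_def measure_def)
qed

lemma finite_borel_measure_law: "finite_borel_measure law"
proof (intro finite_borel_measure.intro finite_measureI finite_borel_measure_axioms.intro)
  have "emeasure law (space law) = (\<integral>\<^sup>+s. 1 \<partial>law)"
    by simp
  also have "\<dots> \<le> (\<integral>\<^sup>+\<omega>. 1 \<partial>M)"
    unfolding nn_integral_law [OF borel_measurable_const]
    by (intro nn_integral_mono) (auto simp: indicator_def)
  also have "\<dots> = 1"
    by (simp add: emeasure_space_1)
  finally show "emeasure law (space law) \<noteq> \<infinity>"
    by (auto simp: top_unique)
qed (simp add: law_def)

text \<open>Both are finite Borel measures with the same distribution function. This turns Stieltjes
  integrals against F into expectations over paths.\<close>

lemma interval_measure_hitting_cdf: "interval_measure (hitting_cdf M W b) = law"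
proof -
  interpret L: finite_borel_measure law
    by (rule finite_borel_measure_law)
  have "finite_borel_measure (interval_measure (cdf law))"
    by (rule finite_borel_measure_interval_measure [OF L.cdf_nondecreasing L.cdf_is_right_cont
          L.cdf_lim_at_bot L.cdf_lim_at_top]) auto
  moreover have "cdf (interval_measure (cdf law)) = cdf law"
    by (rule cdf_interval_measure [OF L.cdf_nondecreasing L.cdf_is_right_cont L.cdf_lim_at_bot])
  ultimately show ?thesis
    unfolding cdf_law [symmetric] using finite_borel_measure_law by (intro cdf_unique') auto
qed

text \<open>The inner normal integral in \<open>cdf_eq\<close> is the probability of ending at or
  below y after a hit at time s, so the change of variables from s to \<tau> reduces
  \<open>cdf_eq\<close> to \<open>prob_le_eq_expectation_at_hitting\<close>.\<close>

lemma first_passage_law: "first_passage_law law b c"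
proof (intro first_passage_law.intro first_passage_law_axioms.intro finite_borel_measure_law)
  show "AE s in law. 0 < s"
  proof -
    have "AE \<omega> in M. 0 < (indicator {\<omega> \<in> space M. \<tau> \<omega> < \<infinity>} \<omega> :: ennreal) \<longrightarrow> 0 < real_of_ereal (\<tau> \<omega>)"
      using AE_\<tau>_pos
    proof eventually_elim
      case (elim \<omega>)
      then show ?case by (cases "\<tau> \<omega>") (auto simp: indicator_def)
    qed
    then show ?thesis
      unfolding law_def by (subst AE_distr_iff) (auto simp: AE_density)
  qed
  fix T y :: real assume T: "0 < T" and y: "y \<le> c"
  let ?\<Psi> = "\<lambda>\<omega>. if \<tau> \<omega> < ereal T
       then std_normal_cdf ((y - b (real_of_ereal (\<tau> \<omega>))) / sqrt (T - real_of_ereal (\<tau> \<omega>))) else 0"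
  have [measurable]: "V T \<in> borel_measurable M"
    using T by simp
  have "(\<integral>\<^sup>+s. (\<integral>\<^sup>+x. ennreal (normal_density (b s) (sqrt (T - s)) x) * indicator {..y} x \<partial>lborel) * indicator {..<T} s \<partial>law) =
      (\<integral>\<^sup>+s. ennreal (std_normal_cdf ((y - b s) / sqrt (T - s))) * indicator {..<T} s \<partial>law)"
  proof (intro nn_integral_cong)
    fix s
    show "(\<integral>\<^sup>+x. ennreal (normal_density (b s) (sqrt (T - s)) x) * indicator {..y} x \<partial>lborel) * indicator {..<T} s =
        ennreal (std_normal_cdf ((y - b s) / sqrt (T - s))) * indicator {..<T} s"
      using nn_integral_normal_density_atMost [of "T - s" "b s" y] by (cases "s < T") auto
  qed
  also have "\<dots> = (\<integral>\<^sup>+\<omega>. ennreal (?\<Psi> \<omega>) \<partial>M)"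
  proof (subst nn_integral_law)
    show "(\<integral>\<^sup>+\<omega>. indicator {\<omega> \<in> space M. \<tau> \<omega> < \<infinity>} \<omega> *
        (ennreal (std_normal_cdf ((y - b (real_of_ereal (\<tau> \<omega>))) / sqrt (T - real_of_ereal (\<tau> \<omega>)))) *
          indicator {..<T} (real_of_ereal (\<tau> \<omega>))) \<partial>M) = (\<integral>\<^sup>+\<omega>. ennreal (?\<Psi> \<omega>) \<partial>M)"
    proof (intro nn_integral_cong)
      fix \<omega> assume "\<omega> \<in> space M"
      then show "indicator {\<omega> \<in> space M. \<tau> \<omega> < \<infinity>} \<omega> *
        (ennreal (std_normal_cdf ((y - b (real_of_ereal (\<tau> \<omega>))) / sqrt (T - real_of_ereal (\<tau> \<omega>)))) *
          indicator {..<T} (real_of_ereal (\<tau> \<omega>))) = ennreal (?\<Psi> \<omega>)"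
        using \<tau>_nonneg [of \<omega>] by (cases "\<tau> \<omega>") (auto simp: indicator_def)
    qed
  qed measurable
  also have "\<dots> = ennreal (LINT \<omega>|M. ?\<Psi> \<omega>)"
    by (intro nn_integral_eq_integral integrable_const_bound [where B = 1]) (auto simp: std_normal_cdf_bounds)
  also have "\<dots> = emeasure M {\<omega> \<in> space M. V T \<omega> \<le> y}"
    using prob_le_eq_expectation_at_hitting [OF T y] by (simp add: emeasure_eq_measure)
  also have "\<dots> = (\<integral>\<^sup>+\<omega>. indicator {\<omega> \<in> space M. V T \<omega> \<le> y} \<omega> \<partial>M)"
    by (subst nn_integral_indicator) auto
  also have "\<dots> = (\<integral>\<^sup>+\<omega>. indicator {..y} (W T \<omega> - W 0 \<omega>) \<partial>M)"
    by (intro nn_integral_cong) (auto simp: V_def indicator_def)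
  also have "\<dots> = (\<integral>\<^sup>+x. ennreal (normal_density 0 (sqrt (T - 0)) x) * indicator {..y} x \<partial>lborel)"
    by (rule distributed_nn_integral [OF gaussian_increments [OF order_refl T], symmetric]) simp
  finally show "(\<integral>\<^sup>+s. (\<integral>\<^sup>+x. ennreal (normal_density (b s) (sqrt (T - s)) x) * indicator {..y} x \<partial>lborel) * indicator {..<T} s \<partial>law) =
      (\<integral>\<^sup>+x. ennreal (normal_density 0 (sqrt T) x) * indicator {..y} x \<partial>lborel)"
    by simp
qed (use b_gt c_neg in auto)

end

section \<open>Transfer to the original boundary and assembly\<close>

theorem mainTheorem7:
  fixes M :: "'a measure" and W :: "real \<Rightarrow> 'a \<Rightarrow> real"
    and b :: "real \<Rightarrow> real" and c :: real and F :: "real \<Rightarrow> real"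
  assumes "continuous_on {0..} b"
    and "b 0 \<le> 0"
    and "c < 0"
    and "\<And>t. 0 \<le> t \<Longrightarrow> c < b t"
    and "standard_brownian_motion M W"
    and "measure M {\<omega> \<in> space M. hitting_time W b \<omega> = 0} = 0"
    and "F = hitting_cdf M W b"
  shows "(\<forall>\<alpha>\<ge>0. (LINT s:{0..}|interval_measure F. exp (- \<alpha> * b s - \<alpha>\<^sup>2 * s / 2)) = 1) \<and>
    (\<forall>p<1. \<forall>y\<le>c. \<forall>\<beta>>0.
      (LINT t:{0<..}|lborel. exp (- \<beta> * t) *
        (LINT s:{0..t}|interval_measure F.
          (if s < t
           then exp (- (b s - y)\<^sup>2 / (4 * (t - s))) * pcf_D p ((b s - y) / sqrt (t - s))
                  / (t - s) powr ((p + 1) / 2)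
           else 0)))
      = sqrt pi * 2 powr (p / 2) * \<beta> powr ((p - 1) / 2) * exp (y * sqrt (2 * \<beta>)) *
        (LINT s:{0..}|interval_measure F. exp (- sqrt (2 * \<beta>) * b s - \<beta> * s))) \<and>
    (\<forall>p<1. \<forall>y\<le>c. \<forall>\<beta>>0.
      (LINT t:{0<..}|lborel. exp (- \<beta> * t) *
        (exp (- y\<^sup>2 / (4 * t)) * pcf_D p (- y / sqrt t) / t powr ((p + 1) / 2)))
      = sqrt pi * 2 powr (p / 2) * \<beta> powr ((p - 1) / 2) * exp (y * sqrt (2 * \<beta>))) \<and>
    (\<forall>t>0. \<forall>p<1. \<forall>y\<le>c.
      (LINT s:{0..t}|interval_measure F.
        (if s < t
         then exp (- (b s - y)\<^sup>2 / (4 * (t - s))) * pcf_D p ((b s - y) / sqrt (t - s))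
                / (t - s) powr ((p + 1) / 2)
         else 0))
      = exp (- y\<^sup>2 / (4 * t)) * pcf_D p (- y / sqrt t) / t powr ((p + 1) / 2))"
proof -
  \<comment> \<open>Continuing b by b(0) to negative times makes it continuous and above c on the
    whole line. The hitting time and the integrals see only nonnegative times, so nothing
    changes.\<close>
  define d where "d = (\<lambda>t. b (max 0 t))"
  have d_eq: "d s = b s" if "0 \<le> s" for s
    using that by (simp add: d_def)
  interpret standard_brownian_motion M W by fact
  have hit: "hitting_time W d = hitting_time W b"
    unfolding hitting_time_def by (intro ext arg_cong [where f = Inf] arg_cong [where f = "image ereal"]) (auto simp: d_eq)
  interpret brownian_hitting M W d c
  proof
    have "continuous_on UNIV d"
      unfolding d_def by (rule continuous_on_compose2 [OF assms(1)]) (auto intro!: continuous_intros)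
    then show "isCont d t" for t
      by (simp add: continuous_on_eq_continuous_at)
    show "c < d t" for t
      using assms(4) by (simp add: d_def)
  qed (use assms hit in auto)
  interpret L: first_passage_law law d c
    by (rule first_passage_law)
  have F: "interval_measure F = law"
    using interval_measure_hitting_cdf assms(7) hit by (simp add: hitting_cdf_def [abs_def])
  have sets: "{0..t} \<in> sets law" "{0..} \<in> sets law" for t :: real
    by (auto simp: law_def)
  have fredholm: "(LINT s:{0..}|interval_measure F. exp (- \<alpha> * b s - \<alpha>\<^sup>2 * s / 2)) = 1" if "0 \<le> \<alpha>" for \<alpha>
    unfolding F L.fredholm [OF that, symmetric] by (rule set_lebesgue_integral_cong) (auto simp: sets d_eq)
  have laplace: "(LINT t:{0<..}|lborel. exp (- \<beta> * t) *
        (exp (- y\<^sup>2 / (4 * t)) * pcf_D p (- y / sqrt t) / t powr ((p + 1) / 2)))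
      = sqrt pi * 2 powr (p / 2) * \<beta> powr ((p - 1) / 2) * exp (y * sqrt (2 * \<beta>))"
    if "p < 1" "y \<le> c" "\<beta> > 0" for p y \<beta>
  proof -
    let ?f = "\<lambda>t. exp (- \<beta> * t) * pcf_kernel p (- y) t"
    have a: "- y > 0" using that assms(3) by simp
    have m: "(\<lambda>t. ennreal (pcf_kernel p (- y) t) * indicator {0<..} t) \<in> borel_measurable borel"
      by (rule pcf_kernel_measurable) (use that a in auto)
    have nonneg: "0 \<le> indicator {0<..} t * pcf_kernel p (- y) t" for t
      using pcf_kernel_nonneg [OF that(1) a, of t] by (auto simp: indicator_def)
    have "(\<lambda>t. enn2real (ennreal (pcf_kernel p (- y) t) * indicator {0<..} t)) \<in> borel_measurable borel"
      using m by measurable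
    also have "(\<lambda>t. enn2real (ennreal (pcf_kernel p (- y) t) * indicator {0<..} t)) = (\<lambda>t. indicator {0<..} t * pcf_kernel p (- y) t)"
      using pcf_kernel_nonneg [OF that(1) a] by (auto simp: fun_eq_iff indicator_def)
    finally have [measurable]: "(\<lambda>t. indicator {0<..} t * pcf_kernel p (- y) t) \<in> borel_measurable borel" .
    have "(LINT t:{0<..}|lborel. ?f t) = (LINT t|lborel. exp (- \<beta> * t) * (indicator {0<..} t * pcf_kernel p (- y) t))"
      unfolding set_lebesgue_integral_def by (intro Bochner_Integration.integral_cong) (auto simp: indicator_def)
    also have "\<dots> = enn2real (\<integral>\<^sup>+t. ennreal (exp (- \<beta> * t) * (indicator {0<..} t * pcf_kernel p (- y) t)) \<partial>lborel)"
      by (rule integral_eq_nn_integral) (use nonneg in auto)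
    also have "(\<integral>\<^sup>+t. ennreal (exp (- \<beta> * t) * (indicator {0<..} t * pcf_kernel p (- y) t)) \<partial>lborel) =
        (\<integral>\<^sup>+t. ennreal (?f t) * indicator {0<..} t \<partial>lborel)"
      by (intro nn_integral_cong) (auto simp: indicator_def)
    also have "\<dots> = ennreal (sqrt pi * 2 powr (p / 2) * \<beta> powr ((p - 1) / 2) * exp (- (- y) * sqrt (2 * \<beta>)))"
      using that a by (intro laplace_pcf_kernel)
    finally show ?thesis
      by (simp add: pcf_kernel_def)
  qed
  have volterra: "(LINT s:{0..t}|interval_measure F.
        (if s < t
         then exp (- (b s - y)\<^sup>2 / (4 * (t - s))) * pcf_D p ((b s - y) / sqrt (t - s))
                / (t - s) powr ((p + 1) / 2)
         else 0))
      = exp (- y\<^sup>2 / (4 * t)) * pcf_D p (- y / sqrt t) / t powr ((p + 1) / 2)"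
    if "t > 0" "p < 1" "y \<le> c" for t p y
  proof -
    have "(LINT s:{0..t}|interval_measure F.
        (if s < t
         then exp (- (b s - y)\<^sup>2 / (4 * (t - s))) * pcf_D p ((b s - y) / sqrt (t - s))
                / (t - s) powr ((p + 1) / 2)
         else 0)) = (LINT s:{0..t}|law. (if s < t then pcf_kernel p (d s - y) (t - s) else 0))"
      unfolding F by (rule set_lebesgue_integral_cong) (auto simp: sets d_eq pcf_kernel_def)
    also have "\<dots> = pcf_kernel p (- y) t"
      using that by (rule L.volterra)
    finally show ?thesis
      by (simp add: pcf_kernel_def)
  qed
  have fredholm_sqrt: "(LINT s:{0..}|interval_measure F. exp (- sqrt (2 * \<beta>) * b s - \<beta> * s)) = 1" if "\<beta> > 0" for \<beta>
    using fredholm [of "sqrt (2 * \<beta>)"] that by simp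
  \<comment> \<open>The Fredholm integral on the right is 1, and for each t > 0 the inner integral
    is the kernel at (- y, t) by the Volterra equation, so the claim reduces to
    \<open>laplace\<close>.\<close>
  have volterra_laplace: "(LINT t:{0<..}|lborel. exp (- \<beta> * t) *
        (LINT s:{0..t}|interval_measure F.
          (if s < t
           then exp (- (b s - y)\<^sup>2 / (4 * (t - s))) * pcf_D p ((b s - y) / sqrt (t - s))
                  / (t - s) powr ((p + 1) / 2)
           else 0)))
      = sqrt pi * 2 powr (p / 2) * \<beta> powr ((p - 1) / 2) * exp (y * sqrt (2 * \<beta>)) *
        (LINT s:{0..}|interval_measure F. exp (- sqrt (2 * \<beta>) * b s - \<beta> * s))"
    if "p < 1" "y \<le> c" "\<beta> > 0" for p y \<beta>
    unfolding fredholm_sqrt [OF that(3)] mult_1_right laplace [OF that, symmetric]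
    by (rule set_lebesgue_integral_cong) (use that in \<open>auto simp only: volterra greaterThan_iff sets_lborel borel_open open_greaterThan\<close>)
  show ?thesis
    using fredholm volterra_laplace laplace volterra by blast
qed

end
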